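(* Let $T^r$ act effectively and linearly on $S^{2n-1}$, let $X=S^{2n-1}/T^r$ with associated matroid $M=M_X$ of rank $r(M)$, and let $\mathcal{S}\subseteq X$ be the (rational) singular set of the action. Then the reduced Poincaré polynomial of $\mathcal{S}$ with integral coefficients is given by $$\tilde{\mathbb{P}}(\mathcal{S},t)=t^{\,r(M)-2}\,\big[\,T(M;1,t^2)-T(M;0,t^2)\,\big].$$
   Context: $T^r=(S^1)^r=T_1\times\cdots\times T_r$ is the real torus. A linear action of $T^r$ on $S^{2n-1}$ is one given by a continuous homomorphism $T^r\to O(2n)$. Up to conjugation in $O(2n)$, one has $S^{2n-1}=S_1*\cdots*S_n\subset\mathbb{C}^n$ ($S_j$ the unit circle of the $j$-th coordinate, $*$ the topological join) and there is an integer $r\times n$ matrix $Z=(z_{ij})$ such that $e^{\sqrt{-1}\theta}\in T_i$ acts on $S_j$ by multiplication by $e^{\sqrt{-1}z_{ij}\theta}$. $M_X$ is the matroid on the set of columns of $Z$, in which a set of columns is independent iff it is linearly independent over $\mathbb{Q}$. The rational singular set $\mathcal{S}$ is the image in $X$ of the points of $S^{2n-1}$ whose isotropy subgroup is infinite. The integral reduced Poincaré polynomial of a space $Y$ is $\tilde{\mathbb{P}}(Y,t)=\sum_i \operatorname{rk}\tilde H_i(Y;\mathbb{Z})\,t^i$. The Tutte polynomial $T(M;x,y)$ is the unique two-variable polynomial matroid invariant satisfying: $T(\text{single coloop};x,y)=x$ and $T(\text{single loop};x,y)=y$; $T(M;x,y)=T(e;x,y)\,T(M/e;x,y)$ if $e$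 is a loop or a coloop; and $T(M;x,y)=T(M-e;x,y)+T(M/e;x,y)$ if $e$ is neither ($M-e$ is the deletion and $M/e$ the contraction). *)

theory Defs
  imports
    "HOL-Analysis.Analysis"
    "HOL-Homology.Homology"
    "HOL-Computational_Algebra.Computational_Algebra"
begin

section \<open>Linear torus actions on odd spheres\<close>

text \<open>
  The torus \<open>T\<^sup>r\<close> is a subset of \<open>\<complex>\<^sup>r\<close> with \<open>r = CARD('r)\<close>; its group operation is the componentwise
  product, which is the operation \<open>*\<close> of the vector type. The sphere \<open>S\<^sup>2\<^sup>n\<^sup>-\<^sup>1\<close> is the unit sphere of the
  \<open>2n\<close>-dimensional real inner product space \<open>\<complex>\<^sup>n\<close> with \<open>n = CARD('n)\<close>. Index types are nonempty, so
  \<open>r \<ge> 1\<close> and \<open>n \<ge> 1\<close>.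
\<close>

definition torus :: "(complex ^ 'r) set" where
  "torus = {t. \<forall>i. norm (t $ i) = 1}"

abbreviation unit_sphere :: "(complex ^ 'n) set" where
  "unit_sphere \<equiv> sphere 0 1"

type_synonym ('r, 'n) torus_rep = "complex ^ 'r \<Rightarrow> ((complex ^ 'n) \<Rightarrow>\<^sub>L (complex ^ 'n))"

text \<open>
  A continuous homomorphism \<open>T\<^sup>r \<rightarrow> O(2n)\<close>, where \<open>O(2n)\<close> carries the topology of the operator norm.
  The values of \<open>\<rho>\<close> outside the torus are irrelevant.
\<close>

definition linear_torus_action :: "('r::finite, 'n::finite) torus_rep \<Rightarrow> bool" where
  "linear_torus_action \<rho> \<longleftrightarrow>
     continuous_on torus \<rho> \<and>
     (\<forall>t\<in>torus. orthogonal_transformation (blinfun_apply (\<rho> t))) \<and>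
     (\<forall>s\<in>torus. \<forall>t\<in>torus. \<rho> (s * t) = \<rho> s o\<^sub>L \<rho> t)"

definition effective_action :: "('r::finite, 'n::finite) torus_rep \<Rightarrow> bool" where
  "effective_action \<rho> \<longleftrightarrow>
     (\<forall>t\<in>torus. (\<forall>v\<in>unit_sphere. blinfun_apply (\<rho> t) v = v) \<longrightarrow> t = 1)"

text \<open>
  \<open>Z\<close> is a weight matrix of \<open>\<rho>\<close> if, after conjugation by some \<open>g \<in> O(2n)\<close>, every \<open>t \<in> T\<^sup>r\<close> multiplies the
  \<open>j\<close>-th complex coordinate by the product over \<open>i\<close> of \<open>t\<^sub>i\<close> to the power \<open>z\<^sub>i\<^sub>j\<close>. The rows of \<open>Z\<close> are
  indexed by \<open>'r\<close>, the columns by \<open>'n\<close>.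
\<close>

definition weight_matrix :: "('r::finite, 'n::finite) torus_rep \<Rightarrow> int ^ 'n ^ 'r \<Rightarrow> bool" where
  "weight_matrix \<rho> Z \<longleftrightarrow>
     (\<exists>g :: complex ^ 'n \<Rightarrow> complex ^ 'n. orthogonal_transformation g \<and>
        (\<forall>t\<in>torus. \<forall>v. g (blinfun_apply (\<rho> t) v) =
           (\<chi> j. (\<Prod>i\<in>UNIV. (t $ i) powi (Z $ i $ j)) * g v $ j)))"

definition torus_orbit :: "('r::finite, 'n::finite) torus_rep \<Rightarrow> complex ^ 'n \<Rightarrow> (complex ^ 'n) set" where
  "torus_orbit \<rho> v = (\<lambda>t. blinfun_apply (\<rho> t) v) ` torus"

definition isotropy :: "('r::finite, 'n::finite) torus_rep \<Rightarrow> complex ^ 'n \<Rightarrow> (complex ^ 'r) set" where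
  "isotropy \<rho> v = {t \<in> torus. blinfun_apply (\<rho> t) v = v}"

definition quotient_topology :: "'a topology \<Rightarrow> ('a \<Rightarrow> 'b) \<Rightarrow> 'b topology" where
  "quotient_topology X f =
     topology (\<lambda>U. U \<subseteq> f ` topspace X \<and> openin X {x \<in> topspace X. f x \<in> U})"

lemma openin_quotient_topology:
  "openin (quotient_topology X f) U \<longleftrightarrow>
     U \<subseteq> f ` topspace X \<and> openin X {x \<in> topspace X. f x \<in> U}"
proof -
  have "istopology (\<lambda>U. U \<subseteq> f ` topspace X \<and> openin X {x \<in> topspace X. f x \<in> U})"
    unfolding istopology_def
  proof (rule conjI, goal_cases)
    case 1
    have *: "{x \<in> topspace X. f x \<in> S \<inter> T} = {x \<in> topspace X. f x \<in> S} \<inter> {x \<in> topspace X. f x \<in> T}"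
      for S T by blast
    show ?case by (auto simp: * simp del: Int_iff)
  next
    case 2
    have *: "{x \<in> topspace X. f x \<in> \<Union>\<K>} = (\<Union>K\<in>\<K>. {x \<in> topspace X. f x \<in> K})" for \<K>
      by blast
    show ?case unfolding * by blast
  qed
  then show ?thesis
    by (simp add: quotient_topology_def)
qed

lemma topspace_quotient_topology: "topspace (quotient_topology X f) = f ` topspace X"
proof
  show "topspace (quotient_topology X f) \<subseteq> f ` topspace X"
    by (metis openin_quotient_topology openin_topspace)
  have "{x \<in> topspace X. f x \<in> f ` topspace X} = topspace X"
    by blast
  then show "f ` topspace X \<subseteq> topspace (quotient_topology X f)"
    by (metis openin_quotient_topology openin_subset openin_topspace order_refl)
qed

lemma quotient_map_quotient_topology: "quotient_map X (quotient_topology X f) f"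
  unfolding quotient_map_def
  by (auto simp: topspace_quotient_topology openin_quotient_topology)

definition orbit_space :: "('r::finite, 'n::finite) torus_rep \<Rightarrow> (complex ^ 'n) set topology" where
  "orbit_space \<rho> = quotient_topology (top_of_set unit_sphere) (torus_orbit \<rho>)"

definition singular_set :: "('r::finite, 'n::finite) torus_rep \<Rightarrow> (complex ^ 'n) set topology" where
  "singular_set \<rho> =
     subtopology (orbit_space \<rho>) (torus_orbit \<rho> ` {v \<in> unit_sphere. infinite (isotropy \<rho> v)})"


section \<open>Matroids\<close>

datatype 'a set_system = Set_System (ground: "'a set") (indeps: "'a set set")

definition matroid :: "'a set_system \<Rightarrow> bool" where
  "matroid M \<longleftrightarrow>
     finite (ground M) \<and> indeps M \<subseteq> Pow (ground M) \<and> {} \<in> indeps M \<and>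
     (\<forall>A\<in>indeps M. \<forall>B\<subseteq>A. B \<in> indeps M) \<and>
     (\<forall>A\<in>indeps M. \<forall>B\<in>indeps M. card A < card B \<longrightarrow> (\<exists>e\<in>B - A. insert e A \<in> indeps M))"

definition matroid_rank :: "'a set_system \<Rightarrow> nat" where
  "matroid_rank M = Max (card ` indeps M)"

definition matroid_basis :: "'a set_system \<Rightarrow> 'a set \<Rightarrow> bool" where
  "matroid_basis M B \<longleftrightarrow> B \<in> indeps M \<and> (\<forall>A\<in>indeps M. B \<subseteq> A \<longrightarrow> A = B)"

definition is_loop :: "'a set_system \<Rightarrow> 'a \<Rightarrow> bool" where
  "is_loop M e \<longleftrightarrow> e \<in> ground M \<and> {e} \<notin> indeps M"

definition is_coloop :: "'a set_system \<Rightarrow> 'a \<Rightarrow> bool" where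
  "is_coloop M e \<longleftrightarrow> e \<in> ground M \<and> (\<forall>B. matroid_basis M B \<longrightarrow> e \<in> B)"

definition deletion :: "'a set_system \<Rightarrow> 'a \<Rightarrow> 'a set_system" where
  "deletion M e = Set_System (ground M - {e}) {A \<in> indeps M. e \<notin> A}"

definition contraction :: "'a set_system \<Rightarrow> 'a \<Rightarrow> 'a set_system" where
  "contraction M e =
     (if is_loop M e then deletion M e
      else Set_System (ground M - {e}) {A. A \<subseteq> ground M - {e} \<and> insert e A \<in> indeps M})"

definition matroid_iso :: "'a set_system \<Rightarrow> 'a set_system \<Rightarrow> bool" where
  "matroid_iso M N \<longleftrightarrow>
     (\<exists>f. bij_betw f (ground M) (ground N) \<and>
        (\<forall>A\<subseteq>ground M. f ` A \<in> indeps N \<longleftrightarrow> A \<in> indeps M))"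

text \<open>
  The matroid of the columns of \<open>Z\<close>. Its ground set consists of the column indices, so that equal
  columns in different positions are distinct (and, if nonzero, parallel) elements.
\<close>

definition column_matroid :: "int ^ 'n ^ 'r \<Rightarrow> 'n set_system" where
  "column_matroid Z =
     (let col = (\<lambda>j. column j (map_matrix rat_of_int Z))
      in Set_System UNIV {A. inj_on col A \<and> vec.independent (col ` A)})"


section \<open>The Tutte polynomial\<close>

text \<open>
  A two-variable polynomial is an element of \<open>\<int>[x][y]\<close>: the inner variable is \<open>x\<close>, the outer one \<open>y\<close>.
\<close>

definition var_x :: "int poly poly" where "var_x = [:[:0, 1:]:]"

definition var_y :: "int poly poly" where "var_y = [:0, 1:]"

definition eval_xy :: "int poly poly \<Rightarrow> 'b :: comm_ring_1 \<Rightarrow> 'b \<Rightarrow> 'b" where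
  "eval_xy p x y = poly (map_poly (\<lambda>q. poly (map_poly of_int q) x) p) y"

text \<open>
  In the second clause the factor \<open>T(e; x, y)\<close>, the polynomial of a single coloop or loop, is written
  out as \<open>x\<close> or \<open>y\<close>. The clauses force the value \<open>1\<close> on the empty matroid.
\<close>

definition tutte_invariant :: "('a set_system \<Rightarrow> int poly poly) \<Rightarrow> bool" where
  "tutte_invariant T \<longleftrightarrow>
     (\<forall>M N. matroid M \<and> matroid N \<and> matroid_iso M N \<longrightarrow> T M = T N) \<and>
     (\<forall>M e. matroid M \<and> ground M = {e} \<longrightarrow>
        (is_coloop M e \<longrightarrow> T M = var_x) \<and> (is_loop M e \<longrightarrow> T M = var_y)) \<and>
     (\<forall>M e. matroid M \<and> e \<in> ground M \<longrightarrow>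
        (is_coloop M e \<longrightarrow> T M = var_x * T (contraction M e)) \<and>
        (is_loop M e \<longrightarrow> T M = var_y * T (contraction M e)) \<and>
        (\<not> is_coloop M e \<and> \<not> is_loop M e \<longrightarrow> T M = T (deletion M e) + T (contraction M e)))"

definition tutte_polynomial :: "'a set_system \<Rightarrow> int poly poly" where
  "tutte_polynomial M = (THE p. \<exists>T. tutte_invariant T \<and> T M = p)"


section \<open>The reduced Poincare polynomial\<close>

definition int_independent :: "('a, 'b) monoid_scheme \<Rightarrow> 'a set \<Rightarrow> bool" where
  "int_independent G B \<longleftrightarrow> B \<subseteq> carrier G \<and>
     (\<forall>F c. finite F \<and> F \<subseteq> B \<and> (\<Otimes>\<^bsub>G\<^esub>b\<in>F. b [^]\<^bsub>G\<^esub> (c b :: int)) = \<one>\<^bsub>G\<^esub> \<longrightarrow> (\<forall>b\<in>F. c b = 0))"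

text \<open>The rank is defined as a relation, so that a group of infinite rank has no rank at all.\<close>

definition has_rank :: "('a, 'b) monoid_scheme \<Rightarrow> nat \<Rightarrow> bool" where
  "has_rank G k \<longleftrightarrow>
     (\<exists>B. finite B \<and> int_independent G B \<and> card B = k) \<and>
     (\<forall>B. int_independent G B \<longrightarrow> finite B \<and> card B \<le> k)"

text \<open>
  The reduced homology of the empty space is a copy of the integers in degree \<open>-1\<close>, as given by the
  augmented singular chain complex; the library's \<^const>\<open>reduced_homology_group\<close> is trivial there. It
  agrees with the augmented version on all nonempty spaces.
\<close>

definition has_reduced_betti :: "'a topology \<Rightarrow> int \<Rightarrow> nat \<Rightarrow> bool" where
  "has_reduced_betti Y i k \<longleftrightarrow>
     (if topspace Y = {} then k = (if i = -1 then 1 else 0)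
      else has_rank (reduced_homology_group i Y) k)"

text \<open>
  The reduced Poincare polynomial \<open>\<Sum>\<^sub>i rk H\<^sub>i(Y) t\<^sup>i\<close> (with reduced homology) as a formal Laurent series
  in \<open>t\<close>, since the empty space contributes a term of degree \<open>-1\<close>.
\<close>

definition has_reduced_poincare :: "'a topology \<Rightarrow> int fls \<Rightarrow> bool" where
  "has_reduced_poincare Y P \<longleftrightarrow> (\<forall>i. \<exists>k. has_reduced_betti Y i k \<and> fls_nth P i = int k)"

end

theory Submission
  imports Defs
begin

text \<open>
  Let \<open>G\<close> be the image of the torus in the group of diagonal unitary matrices, acting by the characters
  \<open>\<chi>\<^sub>1, \<dots>, \<chi>\<^sub>n\<close> whose exponents are the columns of \<open>Z\<close>. An orthogonal conjugation identifies the orbit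
  space of the given action with that of \<open>G\<close>, and effectiveness forces \<open>Z\<close> to have full row rank \<open>r\<close>. The
  isotropy group of a vector \<open>v\<close> is cut out by the equations \<open>\<chi>\<^sub>j(t) = 1\<close> for \<open>j\<close> in the support of \<open>v\<close>, so it
  is infinite iff the columns in the support have rank less than \<open>r\<close>
  (\<open>infinite_isotropy_iff\<close>, \<open>singular_set_homeomorphic\<close>).

  The Betti numbers come from deletion and contraction, carried out in a class of spaces that is closed
  under both. For sets \<open>E\<close> and \<open>C\<close> of columns and a threshold \<open>k\<close>, let \<open>X(E, C)\<close> be the space of unit vectors
  whose support \<open>A \<subseteq> E\<close> satisfies \<open>rk (A \<union> C) \<le> k\<close>, modulo the subgroup of \<open>G\<close> that fixes the coordinates
  in \<open>C\<close>. The singular set is \<open>X(UNIV, {})\<close> for \<open>k = r - 1\<close>. If \<open>e \<in> E\<close> is not a loop of the contraction by \<open>C\<close>,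
  the group takes all unit complex values at the coordinate \<open>e\<close>. Therefore the open set \<open>v\<^sub>e \<noteq> 0\<close> of the
  orbit space is contractible, the open set \<open>|v\<^sub>e| < 1\<close> contracts to \<open>X(E - e, C)\<close>, and their intersection
  is an open interval times \<open>X(E - e, C + e)\<close>: so \<open>X(E, C)\<close> is the mapping cone of a map from
  \<open>X(E - e, C + e)\<close> to \<open>X(E - e, C)\<close>. By induction the rational homology of these two spaces sits in degrees
  of one parity each, and the parities differ by one. The connecting maps of the long exact sequence then
  have rank zero and the Betti numbers add up (\<open>betti_deletion_contraction\<close>).

  The induction has two ends. If deleting \<open>e\<close> lowers the rank of \<open>E \<union> C\<close> below \<open>k\<close>, then \<open>e\<close> is a coloop, all
  subsets of \<open>E\<close> are allowed, and \<open>X(E, C)\<close> is contractible, since the phase of \<open>v\<^sub>e\<close> can be changed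
  independently of the other coordinates (\<open>contractible_coloop\<close>). If \<open>rk C = k\<close>, only loops are left and the
  group acts through a finite group on the unit sphere of \<open>l\<close> complex coordinates; the quotient has the
  rational homology of a sphere of dimension \<open>2l - 1\<close> (\<open>betti_finite_quotient\<close>). That follows from another
  induction, on \<open>l\<close>, which covers the circle of values of \<open>v\<^sub>e\<close>, modulo roots of unity, by two arcs. It rests
  on one geometric fact: the projection of a sphere to its orbit space has nonzero degree, as all points of
  an orbit without isotropy contribute equally to it (\<open>orbit_projection_reflects_torsion\<close>).

  On the combinatorial side, the Tutte polynomial is the sum over all \<open>A\<close> of
  \<open>(x - 1)\<close> to the power \<open>r - r(A)\<close> times \<open>(y - 1)\<close> to the power \<open>|A| - r(A)\<close> (\<open>tutte_polynomial_eq\<close>). In the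
  difference of its values at \<open>x = 1\<close> and \<open>x = 0\<close> the sets of full rank cancel, and what remains is a signed
  sum over the supports of the singular points. Such sums obey the recursion of the Betti numbers, vanish
  for a coloop, and are powers of \<open>y\<close> for loops; both sides are therefore equal (\<open>betti_support_family\<close>).
\<close>

text \<open>The dollar sign is reserved for components of vectors.\<close>

no_notation fps_nth (infixl "$" 75)

section \<open>Ranks of abelian groups\<close>

text \<open>Elimination of the unknown \<open>j0\<close> from the equation \<open>i0\<close>; cross-multiplication with the pivot
  \<open>a j0 i0\<close> keeps the system integral.\<close>

lemma integer_relation:
  fixes a :: "'j \<Rightarrow> 'i \<Rightarrow> int"
  assumes "finite I" "finite J" "card I < card J"
  shows "\<exists>c. (\<exists>j\<in>J. c j \<noteq> 0) \<and> (\<forall>i\<in>I. (\<Sum>j\<in>J. c j * a j i) = 0)"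
  using assms
proof (induction I arbitrary: J a rule: finite_induct)
  case empty
  then obtain j where "j \<in> J" by fastforce
  then show ?case by (intro exI[of _ "\<lambda>_. 1"]) auto
next
  case (insert i0 I)
  show ?case
  proof (cases "\<forall>j\<in>J. a j i0 = 0")
    case True
    have "card I < card J" using insert by simp
    from insert.IH[OF insert.prems(1) this, of a] True show ?thesis
      by auto
  next
    case False
    then obtain j0 where j0: "j0 \<in> J" "a j0 i0 \<noteq> 0" by auto
    define b where "b = (\<lambda>j i. a j0 i0 * a j i - a j i0 * a j0 i)"
    have "card I < card (J - {j0})" using insert j0 by simp
    from insert.IH[OF _ this, of b] insert.prems(1) obtain c
      where c: "\<exists>j\<in>J-{j0}. c j \<noteq> 0" "\<And>i. i \<in> I \<Longrightarrow> (\<Sum>j\<in>J-{j0}. c j * b j i) = 0"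
      by auto
    define d where "d = (\<lambda>j. if j = j0 then - (\<Sum>j\<in>J-{j0}. c j * a j i0) else c j * a j0 i0)"
    have sumd: "(\<Sum>j\<in>J. d j * a j i) = (\<Sum>j\<in>J-{j0}. c j * b j i)" for i
    proof -
      have "(\<Sum>j\<in>J. d j * a j i) = d j0 * a j0 i + (\<Sum>j\<in>J-{j0}. d j * a j i)"
        using j0(1) insert.prems(1) by (simp add: sum.remove)
      also have "(\<Sum>j\<in>J-{j0}. d j * a j i) = (\<Sum>j\<in>J-{j0}. c j * a j0 i0 * a j i)"
        by (rule sum.cong) (auto simp: d_def)
      also have "d j0 * a j0 i = - (\<Sum>j\<in>J-{j0}. c j * a j i0 * a j0 i)"
        by (simp add: d_def sum_distrib_right)
      finally show ?thesis
        by (simp add: b_def algebra_simps sum_subtractf)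
    qed
    have "\<exists>j\<in>J. d j \<noteq> 0" using c(1) j0 by (auto simp: d_def)
    moreover have "(\<Sum>j\<in>J. d j * a j i) = 0" if "i \<in> insert i0 I" for i
    proof (cases "i = i0")
      case True
      show ?thesis unfolding sumd True by (simp add: b_def)
    next
      case False
      then show ?thesis unfolding sumd using c(2) that by simp
    qed
    ultimately show ?thesis by blast
  qed
qed

definition int_comb :: "('a, 'b) monoid_scheme \<Rightarrow> ('i \<Rightarrow> 'a) \<Rightarrow> 'i set \<Rightarrow> ('i \<Rightarrow> int) \<Rightarrow> 'a" where
  "int_comb G u I c = finprod G (\<lambda>i. u i [^]\<^bsub>G\<^esub> c i) I"

context comm_group
begin

lemma int_comb_closed [simp]: "u \<in> I \<rightarrow> carrier G \<Longrightarrow> int_comb G u I c \<in> carrier G"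
  unfolding int_comb_def by (rule finprod_closed) auto

lemma int_comb_add:
  assumes "u \<in> I \<rightarrow> carrier G"
  shows "int_comb G u I c \<otimes> int_comb G u I d = int_comb G u I (\<lambda>i. c i + d i)"
proof -
  have "int_comb G u I (\<lambda>i. c i + d i) = finprod G (\<lambda>i. u i [^] c i \<otimes> u i [^] d i) I"
    unfolding int_comb_def using assms by (intro finprod_cong') (auto simp: int_pow_mult Pi_iff)
  also have "\<dots> = int_comb G u I c \<otimes> int_comb G u I d"
    unfolding int_comb_def using assms by (intro finprod_multf) auto
  finally show ?thesis by simp
qed

lemma int_comb_pow:
  assumes "finite I" "u \<in> I \<rightarrow> carrier G"
  shows "int_comb G u I c [^] (k::int) = int_comb G u I (\<lambda>i. k * c i)"
  using assms
proof (induction I rule: finite_induct)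
  case empty
  then show ?case by (simp add: int_comb_def)
next
  case (insert x F)
  have u: "u \<in> F \<rightarrow> carrier G" "u x \<in> carrier G" using insert by auto
  have "int_comb G u (insert x F) c [^] k = (u x [^] c x \<otimes> int_comb G u F c) [^] k"
    unfolding int_comb_def using insert u by (subst finprod_insert) (auto simp: Pi_iff)
  also have "\<dots> = (u x [^] c x) [^] k \<otimes> int_comb G u F c [^] k"
    using u by (intro int_pow_distrib) auto
  also have "\<dots> = u x [^] (k * c x) \<otimes> int_comb G u F (\<lambda>i. k * c i)"
    using insert.IH u by (simp add: int_pow_pow mult.commute)
  also have "\<dots> = int_comb G u (insert x F) (\<lambda>i. k * c i)"
    unfolding int_comb_def using insert u by (subst finprod_insert) (auto simp: Pi_iff)
  finally show ?case .
qed

lemma int_comb_zero: "(\<And>i. i \<in> I \<Longrightarrow> c i = 0) \<Longrightarrow> int_comb G u I c = \<one>"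
  unfolding int_comb_def by (rule finprod_one_eqI) simp

lemma int_comb_cong:
  "u \<in> I \<rightarrow> carrier G \<Longrightarrow> (\<And>i. i \<in> I \<Longrightarrow> c i = d i) \<Longrightarrow> int_comb G u I c = int_comb G u I d"
  unfolding int_comb_def by (rule finprod_cong') auto

lemma int_comb_insert:
  assumes "finite I" "x \<notin> I" "u \<in> insert x I \<rightarrow> carrier G"
  shows "int_comb G u (insert x I) c = u x [^] c x \<otimes> int_comb G u I c"
  unfolding int_comb_def using assms by (subst finprod_insert) (auto simp: Pi_iff)

lemma int_comb_single:
  assumes "finite I" "x \<in> I" "u \<in> I \<rightarrow> carrier G"
  shows "int_comb G u I (\<lambda>i. if i = x then k else 0) = u x [^] k"
proof -
  have I: "I = insert x (I - {x})" using assms by auto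
  have "int_comb G u I (\<lambda>i. if i = x then k else 0)
     = u x [^] k \<otimes> int_comb G u (I - {x}) (\<lambda>i. if i = x then k else 0)"
    by (subst I, subst int_comb_insert) (use assms in auto)
  also have "int_comb G u (I - {x}) (\<lambda>i. if i = x then k else 0) = \<one>"
    by (rule int_comb_zero) auto
  finally show ?thesis using assms by (auto simp: Pi_iff)
qed

lemma int_comb_int_comb:
  assumes "finite I" "u \<in> I \<rightarrow> carrier G" "finite J"
  shows "int_comb G (\<lambda>j. int_comb G u I (a j)) J c = int_comb G u I (\<lambda>i. \<Sum>j\<in>J. c j * a j i)"
  using assms(3)
proof (induction J rule: finite_induct)
  case empty
  have "int_comb G u I (\<lambda>i. 0) = \<one>" by (rule int_comb_zero) simp
  then show ?case by (simp add: int_comb_def)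
next
  case (insert x F)
  have "int_comb G (\<lambda>j. int_comb G u I (a j)) (insert x F) c
      = int_comb G u I (a x) [^] c x \<otimes> int_comb G (\<lambda>j. int_comb G u I (a j)) F c"
    by (rule int_comb_insert) (use insert assms in auto)
  also have "\<dots> = int_comb G u I (\<lambda>i. c x * a x i) \<otimes> int_comb G u I (\<lambda>i. \<Sum>j\<in>F. c j * a j i)"
    using assms insert.IH by (simp add: int_comb_pow)
  also have "\<dots> = int_comb G u I (\<lambda>i. c x * a x i + (\<Sum>j\<in>F. c j * a j i))"
    using assms by (simp add: int_comb_add)
  finally show ?case using insert by simp
qed

lemma int_comb_Plus:
  assumes "finite I" "finite J" "u \<in> I <+> J \<rightarrow> carrier G"
  shows "int_comb G u (I <+> J) c = int_comb G (u \<circ> Inl) I (c \<circ> Inl) \<otimes> int_comb G (u \<circ> Inr) J (c \<circ> Inr)"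
proof -
  have "int_comb G u (I <+> J) c
      = finprod G (\<lambda>i. u i [^] c i) (Inl ` I) \<otimes> finprod G (\<lambda>i. u i [^] c i) (Inr ` J)"
    unfolding int_comb_def Plus_def
    by (rule finprod_Un_disjoint) (use assms in \<open>auto simp: Pi_iff\<close>)
  also have "finprod G (\<lambda>i. u i [^] c i) (Inl ` I) = int_comb G (u \<circ> Inl) I (c \<circ> Inl)"
    unfolding int_comb_def o_def by (rule finprod_reindex) (use assms in \<open>auto simp: Pi_iff\<close>)
  also have "finprod G (\<lambda>i. u i [^] c i) (Inr ` J) = int_comb G (u \<circ> Inr) J (c \<circ> Inr)"
    unfolding int_comb_def o_def by (rule finprod_reindex) (use assms in \<open>auto simp: Pi_iff\<close>)
  finally show ?thesis .
qed

end

lemma hom_int_comb: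
  assumes "comm_group G" "comm_group H" "h \<in> hom G H" "finite I" "u \<in> I \<rightarrow> carrier G"
  shows "h (int_comb G u I c) = int_comb H (h \<circ> u) I c"
  using assms(4,5)
proof (induction I rule: finite_induct)
  case empty
  interpret G: comm_group G by fact
  interpret H: comm_group H by fact
  show ?case using hom_one[OF assms(3) G.is_group H.is_group] by (simp add: int_comb_def)
next
  case (insert x F)
  interpret G: comm_group G by fact
  interpret H: comm_group H by fact
  have u: "u x \<in> carrier G" "u \<in> F \<rightarrow> carrier G" using insert by auto
  have hu: "h (u x) \<in> carrier H" "(h \<circ> u) \<in> insert x F \<rightarrow> carrier H"
    using insert assms(3) by (auto simp: hom_def)
  have "h (int_comb G u (insert x F) c) = h (u x [^]\<^bsub>G\<^esub> c x \<otimes>\<^bsub>G\<^esub> int_comb G u F c)"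
    using insert by (subst G.int_comb_insert) auto
  also have "\<dots> = h (u x [^]\<^bsub>G\<^esub> c x) \<otimes>\<^bsub>H\<^esub> h (int_comb G u F c)"
    using assms(3) u by (simp add: hom_mult)
  also have "\<dots> = h (u x) [^]\<^bsub>H\<^esub> c x \<otimes>\<^bsub>H\<^esub> int_comb H (h \<circ> u) F c"
    using insert u hom_int_pow[OF assms(3) u(1) G.is_group H.is_group] by (simp add: comp_def)
  also have "\<dots> = int_comb H (h \<circ> u) (insert x F) c"
    using insert hu by (subst H.int_comb_insert) auto
  finally show ?case .
qed

text \<open>A basis after tensoring with the rationals. It is an indexed family and not a set, so that bases of two
  groups can be put together along a disjoint sum of index sets.\<close>

definition rational_basis :: "('a, 'b) monoid_scheme \<Rightarrow> 'i set \<Rightarrow> ('i \<Rightarrow> 'a) \<Rightarrow> bool" where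
  "rational_basis G I u \<longleftrightarrow> finite I \<and> u \<in> I \<rightarrow> carrier G \<and>
     (\<forall>c. int_comb G u I c = \<one>\<^bsub>G\<^esub> \<longrightarrow> (\<forall>i\<in>I. c i = 0)) \<and>
     (\<forall>x\<in>carrier G. \<exists>N c. N \<noteq> 0 \<and> x [^]\<^bsub>G\<^esub> (N::int) = int_comb G u I c)"

definition torsion_elt :: "('a, 'b) monoid_scheme \<Rightarrow> 'a \<Rightarrow> bool" where
  "torsion_elt G x \<longleftrightarrow> (\<exists>N::int. N \<noteq> 0 \<and> x [^]\<^bsub>G\<^esub> N = \<one>\<^bsub>G\<^esub>)"

context comm_group
begin

text \<open>Nonzero multiples of more than \<open>card I\<close> elements are integer combinations of the basis, so
  \<open>integer_relation\<close> yields a relation between them.\<close>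

lemma rational_basis_imp_has_rank:
  assumes "rational_basis G I u"
  shows "has_rank G (card I)"
proof -
  have fin: "finite I" and u: "u \<in> I \<rightarrow> carrier G"
    and ind: "\<And>c i. int_comb G u I c = \<one> \<Longrightarrow> i \<in> I \<Longrightarrow> c i = 0"
    and gen: "\<And>x. x \<in> carrier G \<Longrightarrow> \<exists>N c. N \<noteq> 0 \<and> x [^] (N::int) = int_comb G u I c"
    using assms unfolding rational_basis_def by blast+
  have inj: "inj_on u I"
  proof (rule inj_onI, rule ccontr)
    fix i j assume ij: "i \<in> I" "j \<in> I" "u i = u j" "i \<noteq> j"
    define c where "c = (\<lambda>k. (if k = i then 1 else 0) + (if k = j then - 1 else 0 :: int))"
    have "int_comb G u I c = u i [^] (1::int) \<otimes> u j [^] (- 1 :: int)"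
      unfolding c_def using ij fin u by (subst int_comb_add[symmetric]) (auto simp: int_comb_single)
    also have "\<dots> = u i [^] (1 + - 1 :: int)"
      unfolding ij(3)[symmetric] using u ij by (subst int_pow_mult) auto
    also have "\<dots> = \<one>" by simp
    finally have "c i = 0" by (rule ind) fact
    then show False using ij by (simp add: c_def)
  qed
  have "int_independent G (u ` I)"
    unfolding int_independent_def
  proof (intro conjI allI impI ballI)
    show "u ` I \<subseteq> carrier G" using u by auto
    fix F b and c :: "'a \<Rightarrow> int"
    assume F': "finite F \<and> F \<subseteq> u ` I \<and> (\<Otimes>b\<in>F. b [^] c b) = \<one>" and b: "b \<in> F"
    then have F: "finite F" "F \<subseteq> u ` I" "(\<Otimes>b\<in>F. b [^] c b) = \<one>" by auto
    define d where "d = (\<lambda>i. if u i \<in> F then c (u i) else 0)"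
    have "int_comb G u I d = finprod G (\<lambda>b. b [^] (if b \<in> F then c b else 0)) (u ` I)"
      unfolding int_comb_def d_def using u inj by (subst finprod_reindex) (auto simp: Pi_iff)
    also have "\<dots> = (\<Otimes>b\<in>F. b [^] c b)"
      using F fin u by (intro finprod_mono_neutral_cong_left[symmetric]) auto
    finally have 0: "int_comb G u I d = \<one>" using F by simp
    from b F obtain i where "i \<in> I" "b = u i" by auto
    with ind[OF 0 this(1)] b show "c b = 0" by (simp add: d_def)
  qed
  moreover have "finite B \<and> card B \<le> card I" if B: "int_independent G B" for B
  proof (rule ccontr)
    assume "\<not> ?thesis"
    then obtain J where J: "finite J" "J \<subseteq> B" "card J = Suc (card I)"
      by (metis infinite_arbitrarily_large not_less_eq_eq obtain_subset_with_card_n)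
    have Jc: "J \<subseteq> carrier G" using J B by (auto simp: int_independent_def)
    have "\<forall>b\<in>J. \<exists>N c. N \<noteq> 0 \<and> b [^] (N::int) = int_comb G u I c" using gen Jc by blast
    then obtain N a where N: "\<And>b. b \<in> J \<Longrightarrow> N b \<noteq> (0::int) \<and> b [^] N b = int_comb G u I (a b)"
      by metis
    obtain c where c: "\<exists>j\<in>J. c j \<noteq> 0" "\<And>i. i \<in> I \<Longrightarrow> (\<Sum>j\<in>J. c j * a j i) = 0"
      using integer_relation[OF fin J(1), of a] J(3) by auto
    have "(\<Otimes>b\<in>J. b [^] (N b * c b)) = int_comb G (\<lambda>j. int_comb G u I (a j)) J c"
      unfolding int_comb_def[of G _ J]
    proof (rule finprod_cong')
      fix b assume "b \<in> J"
      then show "b [^] (N b * c b) = int_comb G u I (a b) [^] c b"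
        using N[of b] Jc by (metis int_pow_pow subsetD)
    qed (use u in auto)
    also have "\<dots> = int_comb G u I (\<lambda>i. \<Sum>j\<in>J. c j * a j i)"
      by (rule int_comb_int_comb) (use fin u J in auto)
    also have "\<dots> = \<one>" by (rule int_comb_zero) (use c in auto)
    finally have "\<forall>b\<in>J. N b * c b = 0"
      using B J unfolding int_independent_def by metis
    then show False using c(1) N by auto
  qed
  ultimately show ?thesis
    unfolding has_rank_def using fin card_image[OF inj] by (metis finite_imageI)
qed

text \<open>In an independent set of maximal size, maximality gives every further element a nonzero multiple in the
  subgroup generated by the set.\<close>

lemma has_rank_imp_rational_basis:
  assumes "has_rank G k"
  shows "\<exists>B. rational_basis G B id \<and> card B = k"
proof -
  obtain B where B: "finite B" "int_independent G B" "card B = k"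
    and max: "\<And>B. int_independent G B \<Longrightarrow> finite B \<and> card B \<le> k"
    using assms unfolding has_rank_def by auto
  have Bc: "B \<subseteq> carrier G" using B by (simp add: int_independent_def)
  have ind: "c i = 0" if "int_comb G id B c = \<one>" "i \<in> B" for c i
    using B that unfolding int_independent_def int_comb_def by auto
  have "\<exists>N c. N \<noteq> 0 \<and> x [^] (N::int) = int_comb G id B c" if x: "x \<in> carrier G" for x
  proof (cases "x \<in> B")
    case True
    then have "x [^] (1::int) = int_comb G id B (\<lambda>i. if i = x then 1 else 0)"
      using B Bc x by (subst int_comb_single) auto
    then show ?thesis by (metis zero_neq_one)
  next
    case False
    then have "card (insert x B) = Suc k" using B by simp
    then have "\<not> int_independent G (insert x B)" using max by fastforce
    then obtain F c b where F: "finite F" "F \<subseteq> insert x B" "(\<Otimes>b\<in>F. b [^] (c b::int)) = \<one>" "b \<in> F" "c b \<noteq> 0"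
      using Bc x unfolding int_independent_def by auto
    define d where "d = (\<lambda>b. if b \<in> F then c b else 0)"
    have "int_comb G id (insert x B) d = (\<Otimes>b\<in>F. b [^] c b)"
      unfolding int_comb_def d_def
      using F B Bc x by (intro finprod_mono_neutral_cong_left[symmetric]) auto
    then have 0: "x [^] d x \<otimes> int_comb G id B d = \<one>"
      using F B Bc x False by (subst (asm) int_comb_insert) auto
    have cl: "int_comb G id B d \<in> carrier G" using Bc by (intro int_comb_closed) auto
    have "d x \<noteq> 0"
    proof
      assume dx: "d x = 0"
      then have "int_comb G id B d = \<one>" using 0 cl by simp
      then have "\<forall>i\<in>B. d i = 0" using ind by blast
      then show False using dx F by (auto simp: d_def split: if_splits)
    qed
    moreover have "x [^] d x = int_comb G id B (\<lambda>i. - 1 * d i)"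
    proof -
      have "int_comb G id B (\<lambda>i. - 1 * d i) = inv (int_comb G id B d)"
        using B Bc cl by (subst int_comb_pow[symmetric]) (auto simp: int_pow_neg)
      then show ?thesis using 0 cl x by (metis int_pow_closed inv_equality inv_inv)
    qed
    ultimately show ?thesis by blast
  qed
  then have "rational_basis G B id"
    unfolding rational_basis_def using B Bc ind by auto
  then show ?thesis using B by blast
qed

lemma has_rank_unique: "has_rank G k \<Longrightarrow> has_rank G l \<Longrightarrow> k = l"
  unfolding has_rank_def by (metis le_antisym)

lemma has_rank_0_iff: "has_rank G 0 \<longleftrightarrow> (\<forall>x\<in>carrier G. torsion_elt G x)"
proof
  assume "has_rank G 0"
  then obtain B where B: "rational_basis G B id" "card B = 0"
    using has_rank_imp_rational_basis by blast
  then have "B = {}" by (simp add: rational_basis_def)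
  then have "int_comb G id B c = \<one>" for c by (simp add: int_comb_def)
  then show "\<forall>x\<in>carrier G. torsion_elt G x"
    using B unfolding rational_basis_def torsion_elt_def by metis
next
  assume *: "\<forall>x\<in>carrier G. torsion_elt G x"
  have "rational_basis G ({}::'a set) id"
    using * unfolding rational_basis_def torsion_elt_def by (auto simp: int_comb_def)
  then show "has_rank G 0" using rational_basis_imp_has_rank by fastforce
qed

lemma torsion_elt_pow:
  assumes "x \<in> carrier G" "torsion_elt G (x [^] (N::int))" "N \<noteq> 0"
  shows "torsion_elt G x"
  using assms unfolding torsion_elt_def by (metis int_pow_pow mult_eq_0_iff)

end

text \<open>Ranks are additive along \<open>B \<rightarrow> C \<rightarrow> D\<close> as soon as the sequence is exact at \<open>C\<close> and, at the two ends,
  exact up to torsion: the image of a rational basis of \<open>B\<close>, together with lifts of multiples of a rational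
  basis of \<open>D\<close>, is a rational basis of \<open>C\<close>.\<close>

lemma has_rank_exact:
  assumes "comm_group B" "comm_group C" "comm_group D"
    and g: "g \<in> hom B C" and h: "h \<in> hom C D"
    and ex: "kernel C D h = g ` carrier B"
    and tg: "\<And>b. b \<in> carrier B \<Longrightarrow> g b = \<one>\<^bsub>C\<^esub> \<Longrightarrow> torsion_elt B b"
    and th: "\<And>d. d \<in> carrier D \<Longrightarrow> \<exists>N::int. N \<noteq> 0 \<and> d [^]\<^bsub>D\<^esub> N \<in> h ` carrier C"
    and rB: "has_rank B m" and rD: "has_rank D n"
  shows "has_rank C (m + n)"
proof -
  interpret B: comm_group B by fact
  interpret C: comm_group C by fact
  interpret D: comm_group D by fact
  obtain I where I: "rational_basis B I id" "card I = m" using B.has_rank_imp_rational_basis rB by blast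
  obtain J where J: "rational_basis D J id" "card J = n" using D.has_rank_imp_rational_basis rD by blast
  have fI: "finite I" "I \<subseteq> carrier B" and fJ: "finite J" "J \<subseteq> carrier D"
    using I J by (auto simp: rational_basis_def)
  have "\<forall>d\<in>J. \<exists>N x. N \<noteq> (0::int) \<and> x \<in> carrier C \<and> d [^]\<^bsub>D\<^esub> N = h x"
    using th fJ by blast
  then obtain N l where l: "\<And>d. d \<in> J \<Longrightarrow> N d \<noteq> (0::int) \<and> l d \<in> carrier C \<and> d [^]\<^bsub>D\<^esub> N d = h (l d)"
    by metis
  define u where "u = case_sum g l"
  have uc: "u \<in> I <+> J \<rightarrow> carrier C"
    using l g fI by (auto simp: u_def Plus_def hom_def)
  have gc: "g \<in> I \<rightarrow> carrier C" "l \<in> J \<rightarrow> carrier C" using g fI l by (auto simp: hom_def)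
  have uP: "int_comb C u (I <+> J) c = int_comb C g I (c \<circ> Inl) \<otimes>\<^bsub>C\<^esub> int_comb C l J (c \<circ> Inr)" for c
    using C.int_comb_Plus[OF fI(1) fJ(1) uc, of c] by (simp add: u_def comp_def)
  have gI: "g (int_comb B id I c) = int_comb C g I c" for c
  proof -
    have "id \<in> I \<rightarrow> carrier B" using fI by auto
    from hom_int_comb[OF assms(1,2) g fI(1) this, of c] show ?thesis by simp
  qed
  have hg: "h (g b) = \<one>\<^bsub>D\<^esub>" if "b \<in> carrier B" for b
    using ex that by (auto simp: kernel_def)
  have hI: "h (int_comb C g I c) = \<one>\<^bsub>D\<^esub>" for c
    using gI hg fI by (metis B.int_comb_closed Pi_I id_apply subsetD)
  have lJ: "h (int_comb C l J c) = int_comb D id J (\<lambda>d. N d * c d)" for c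
  proof -
    have "h (int_comb C l J c) = int_comb D (h \<circ> l) J c"
      using hom_int_comb[OF assms(2,3) h fJ(1), of l c] l by auto
    also have "\<dots> = int_comb D id J (\<lambda>d. N d * c d)"
      unfolding int_comb_def
    proof (rule D.finprod_cong')
      fix d assume "d \<in> J"
      then show "(h \<circ> l) d [^]\<^bsub>D\<^esub> c d = id d [^]\<^bsub>D\<^esub> (N d * c d)"
        using l[of d] fJ by (metis D.int_pow_pow comp_apply id_apply subsetD)
    qed (use fJ in auto)
    finally show ?thesis .
  qed
  have "rational_basis C (I <+> J) u"
    unfolding rational_basis_def
  proof (intro conjI allI impI ballI)
    show "finite (I <+> J)" using fI fJ by simp
    show "u \<in> I <+> J \<rightarrow> carrier C" by (rule uc)
  next
    fix c i
    assume 0: "int_comb C u (I <+> J) c = \<one>\<^bsub>C\<^esub>" and i: "i \<in> I <+> J"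
    have "\<one>\<^bsub>D\<^esub> = h (int_comb C g I (c \<circ> Inl) \<otimes>\<^bsub>C\<^esub> int_comb C l J (c \<circ> Inr))"
      using 0 uP[of c] hom_one[OF h] by simp
    also have "\<dots> = int_comb D id J (\<lambda>d. N d * (c \<circ> Inr) d)"
      using h gc fJ by (subst hom_mult[OF h]) (auto simp: hI lJ intro!: D.l_one D.int_comb_closed)
    finally have "\<forall>d\<in>J. N d * (c \<circ> Inr) d = 0"
      using J(1) unfolding rational_basis_def by metis
    then have cJ: "\<And>d. d \<in> J \<Longrightarrow> c (Inr d) = 0" using l by auto
    then have "int_comb C l J (c \<circ> Inr) = \<one>\<^bsub>C\<^esub>" by (intro C.int_comb_zero) auto
    then have "g (int_comb B id I (c \<circ> Inl)) = \<one>\<^bsub>C\<^esub>"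
      using 0 uP[of c] gc gI by simp
    then have "torsion_elt B (int_comb B id I (c \<circ> Inl))"
      using fI by (intro tg B.int_comb_closed) auto
    then obtain M where M: "M \<noteq> (0::int)" "int_comb B id I (c \<circ> Inl) [^]\<^bsub>B\<^esub> M = \<one>\<^bsub>B\<^esub>"
      unfolding torsion_elt_def by auto
    then have "int_comb B id I (\<lambda>i. M * (c \<circ> Inl) i) = \<one>\<^bsub>B\<^esub>"
      using fI by (subst B.int_comb_pow[symmetric]) auto
    then have "\<forall>i\<in>I. M * (c \<circ> Inl) i = 0"
      using I(1) unfolding rational_basis_def by metis
    then show "c i = 0" using M cJ i by (auto simp: Plus_def)
  next
    fix x assume x: "x \<in> carrier C"
    then have hx: "h x \<in> carrier D" using h by (auto simp: hom_def)
    then obtain K a where K: "K \<noteq> (0::int)" "h x [^]\<^bsub>D\<^esub> K = int_comb D id J a"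
      using J(1) unfolding rational_basis_def by metis
    \<comment> \<open>the lifts \<open>l d\<close> belong to different multiples \<open>N d\<close>, which the factor \<open>P\<close> clears all at once\<close>
    define P where "P = (\<Prod>d\<in>J. N d)"
    have P0: "P \<noteq> 0" using l fJ by (simp add: P_def)
    define a' where "a' = (\<lambda>d. (P div N d) * a d)"
    have a': "N d * a' d = P * a d" if "d \<in> J" for d
    proof -
      have "N d dvd P" using that fJ by (auto simp: P_def)
      then show ?thesis by (simp add: a'_def)
    qed
    have "h (x [^]\<^bsub>C\<^esub> (K * P)) = (h x [^]\<^bsub>D\<^esub> K) [^]\<^bsub>D\<^esub> P"
      using hom_int_pow[OF h x C.is_group D.is_group] hx by (simp add: D.int_pow_pow)
    also have "\<dots> = int_comb D id J (\<lambda>d. P * a d)"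
      unfolding K using fJ by (subst D.int_comb_pow) auto
    also have "\<dots> = int_comb D id J (\<lambda>d. N d * a' d)"
      using fJ a' by (intro D.int_comb_cong) auto
    also have "\<dots> = h (int_comb C l J a')" by (simp add: lJ)
    finally have e: "h (x [^]\<^bsub>C\<^esub> (K * P)) = h (int_comb C l J a')" .
    define y where "y = x [^]\<^bsub>C\<^esub> (K * P) \<otimes>\<^bsub>C\<^esub> inv\<^bsub>C\<^esub> (int_comb C l J a')"
    interpret hh: group_hom C D h by unfold_locales (rule h)
    have lc: "int_comb C l J a' \<in> carrier C" using gc by simp
    have "y \<in> kernel C D h"
      using x lc e unfolding kernel_def y_def by simp
    then obtain b where b: "b \<in> carrier B" "y = g b" using ex by auto
    obtain L e where L: "L \<noteq> (0::int)" "b [^]\<^bsub>B\<^esub> L = int_comb B id I e"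
      using I(1) b(1) unfolding rational_basis_def by metis
    have yL: "y [^]\<^bsub>C\<^esub> L = int_comb C g I e"
      using b L gI[of e] hom_int_pow[OF g b(1) B.is_group C.is_group, of L] by simp
    have xy: "x [^]\<^bsub>C\<^esub> (K * P) = y \<otimes>\<^bsub>C\<^esub> int_comb C l J a'"
      using x lc by (simp add: y_def C.m_assoc)
    have yc: "y \<in> carrier C" using x lc by (simp add: y_def)
    have "x [^]\<^bsub>C\<^esub> (K * P * L) = (y \<otimes>\<^bsub>C\<^esub> int_comb C l J a') [^]\<^bsub>C\<^esub> L"
      using x by (metis C.int_pow_pow xy)
    also have "\<dots> = y [^]\<^bsub>C\<^esub> L \<otimes>\<^bsub>C\<^esub> int_comb C l J a' [^]\<^bsub>C\<^esub> L"
      using yc lc by (rule C.int_pow_distrib)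
    also have "\<dots> = int_comb C g I e \<otimes>\<^bsub>C\<^esub> int_comb C l J (\<lambda>d. L * a' d)"
      using yL gc fJ by (simp add: C.int_comb_pow)
    also have "\<dots> = int_comb C u (I <+> J) (case_sum e (\<lambda>d. L * a' d))"
      by (simp add: uP comp_def)
    finally show "\<exists>N c. N \<noteq> 0 \<and> x [^]\<^bsub>C\<^esub> (N::int) = int_comb C u (I <+> J) c"
      using K P0 L by (metis mult_eq_0_iff)
  qed
  from C.rational_basis_imp_has_rank[OF this] show ?thesis
    using fI fJ I J by (simp add: card_Plus)
qed

text \<open>An isomorphism is a short exact sequence whose third group is trivial.\<close>

lemma has_rank_iso:
  assumes G: "comm_group G" and H: "comm_group H" and h: "h \<in> iso G H" and r: "has_rank G k"
  shows "has_rank H k"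
proof -
  interpret H: comm_group H by fact
  interpret G: comm_group G by fact
  define D :: "unit monoid" where "D = \<lparr>carrier = {()}, monoid.mult = \<lambda>_ _. (), one = ()\<rparr>"
  have D: "comm_group D"
    unfolding D_def by (rule comm_groupI) auto
  interpret D: comm_group D by (rule D)
  have "has_rank D 0"
    unfolding D.has_rank_0_iff torsion_elt_def by (metis (mono_tags) unit_eq zero_neq_one)
  have "has_rank H (k + 0)"
  proof (rule has_rank_exact[OF G H D, of h "\<lambda>_. ()"])
    show "h \<in> hom G H" using h by (simp add: iso_def)
    show "(\<lambda>_. ()) \<in> hom H D" by (simp add: hom_def D_def)
    show "kernel H D (\<lambda>_. ()) = h ` carrier G"
      using h by (auto simp: kernel_def D_def iso_def bij_betw_def)
    fix b assume b: "b \<in> carrier G" "h b = \<one>\<^bsub>H\<^esub>"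
    then have "b = \<one>\<^bsub>G\<^esub>"
      using h unfolding iso_def bij_betw_def by (auto dest: inj_onD[of h _ b "\<one>\<^bsub>G\<^esub>"] simp: hom_one)
    then show "torsion_elt G b" by (auto simp: torsion_elt_def intro: exI[of _ 1])
  next
    fix d assume "d \<in> carrier D"
    show "\<exists>N::int. N \<noteq> 0 \<and> d [^]\<^bsub>D\<^esub> N \<in> (\<lambda>_. ()) ` carrier H"
      by (intro exI[of _ 1]) auto
  qed fact+
  then show ?thesis by simp
qed

lemma has_rank_trivial_group: "trivial_group G \<Longrightarrow> comm_group G \<Longrightarrow> has_rank G 0"
  by (subst comm_group.has_rank_0_iff)
     (auto simp: trivial_group_def torsion_elt_def intro!: exI[of _ "1::int"] group.int_pow_one)

lemma has_rank_integer: "h \<in> iso G integer_group \<Longrightarrow> comm_group G \<Longrightarrow> has_rank G 1"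
proof -
  assume h: "h \<in> iso G integer_group" and G: "comm_group G"
  interpret G: comm_group G by fact
  interpret Z: comm_group integer_group by (rule group.group_comm_groupI) auto
  have pow: "x [^]\<^bsub>integer_group\<^esub> (k::int) = k * x" for x k by simp
  have *: "int_comb integer_group (\<lambda>_::unit. 1) {()} c = c ()" for c
    unfolding int_comb_def by (subst Z.finprod_insert) auto
  have "rational_basis integer_group {()} (\<lambda>_::unit. 1)"
    unfolding rational_basis_def
  proof (intro conjI ballI allI impI)
    fix x :: int
    show "\<exists>N c. N \<noteq> 0 \<and> x [^]\<^bsub>integer_group\<^esub> (N::int) = int_comb integer_group (\<lambda>_. 1) {()} c"
      by (rule exI[of _ 1], rule exI[of _ "\<lambda>_. x"]) (simp add: *)
  qed (auto simp: *)
  from Z.rational_basis_imp_has_rank[OF this] have 1: "has_rank integer_group 1" by simp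
  obtain k where "k \<in> iso integer_group G"
    using G.iso_sym[of integer_group] h unfolding is_iso_def by blast
  from has_rank_iso[OF Z.comm_group_axioms G this 1] show ?thesis .
qed

lemma torsion_elt_hom:
  assumes "comm_group G" "comm_group H" "h \<in> hom G H" "x \<in> carrier G" "torsion_elt G x"
  shows "torsion_elt H (h x)"
proof -
  obtain N where N: "N \<noteq> (0::int)" "x [^]\<^bsub>G\<^esub> N = \<one>\<^bsub>G\<^esub>" using assms(5) by (auto simp: torsion_elt_def)
  have "h x [^]\<^bsub>H\<^esub> N = h (x [^]\<^bsub>G\<^esub> N)"
    using hom_int_pow[OF assms(3,4)] assms(1,2) by (simp add: comm_group_def)
  also have "\<dots> = \<one>\<^bsub>H\<^esub>" using N hom_one[OF assms(3)] assms(1,2) by (simp add: comm_group_def)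
  finally show ?thesis using N by (auto simp: torsion_elt_def)
qed

lemma torsion_elt_iso:
  assumes "comm_group G" "comm_group H" "h \<in> iso G H" "x \<in> carrier G" "torsion_elt H (h x)"
  shows "torsion_elt G x"
proof -
  interpret G: comm_group G by fact
  interpret H: comm_group H by fact
  have h: "h \<in> hom G H" "inj_on h (carrier G)" using assms(3) by (auto simp: iso_def bij_betw_def)
  obtain N where N: "N \<noteq> (0::int)" "h x [^]\<^bsub>H\<^esub> N = \<one>\<^bsub>H\<^esub>" using assms(5) by (auto simp: torsion_elt_def)
  have "h (x [^]\<^bsub>G\<^esub> N) = h \<one>\<^bsub>G\<^esub>"
    using hom_int_pow[OF h(1) assms(4) G.is_group H.is_group] N hom_one[OF h(1) G.is_group H.is_group] by simp
  then have "x [^]\<^bsub>G\<^esub> N = \<one>\<^bsub>G\<^esub>" using h(2) assms(4) by (auto dest: inj_onD)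
  then show ?thesis using N by (auto simp: torsion_elt_def)
qed

text \<open>An isomorphism after tensoring with the rationals.\<close>

definition rational_iso :: "('a, 'c) monoid_scheme \<Rightarrow> ('b, 'd) monoid_scheme \<Rightarrow> ('a \<Rightarrow> 'b) \<Rightarrow> bool" where
  "rational_iso G H h \<longleftrightarrow>
     (\<forall>x\<in>carrier G. torsion_elt H (h x) \<longrightarrow> torsion_elt G x) \<and>
     (\<forall>y\<in>carrier H. \<exists>N::int. N \<noteq> 0 \<and> y [^]\<^bsub>H\<^esub> N \<in> h ` carrier G)"

text \<open>The inclusions of orbit spaces below can be computed only after replacing both spaces by homotopy
  equivalent ones; this brings the result back to the inclusion \<open>i\<close>.\<close>

lemma rational_iso_conjugate:
  assumes gr: "comm_group A" "comm_group B" "comm_group C" "comm_group D"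
    and a: "a \<in> iso A B" and r: "r \<in> iso C D" and i: "i \<in> hom B C" and n: "rational_iso A D n"
    and eq: "\<And>x. x \<in> carrier A \<Longrightarrow> r (i (a x)) = n x"
  shows "rational_iso B C i"
  unfolding rational_iso_def
proof (intro conjI ballI impI)
  interpret C: comm_group C by fact
  interpret D: comm_group D by fact
  have rh: "r \<in> hom C D" "inj_on r (carrier C)" and ah: "a \<in> hom A B" using r a by (auto simp: iso_def bij_betw_def)
  have sa: "\<exists>w\<in>carrier A. x = a w" if "x \<in> carrier B" for x using that a by (auto simp: iso_def bij_betw_def)
  {
    fix x assume x: "x \<in> carrier B" "torsion_elt C (i x)"
    then obtain w where w: "w \<in> carrier A" "x = a w" using sa by blast
    have "i x \<in> carrier C" using i x by (auto simp: hom_def)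
    from torsion_elt_hom[OF gr(3,4) rh(1) this x(2)] have "torsion_elt D (n w)" using eq w by simp
    then have "torsion_elt A w" using n w by (auto simp: rational_iso_def)
    from torsion_elt_hom[OF gr(1,2) ah w(1) this] show "torsion_elt B x" using w by simp
  }
  fix y assume y: "y \<in> carrier C"
  then have ry: "r y \<in> carrier D" using rh by (auto simp: hom_def)
  then obtain N w where N: "N \<noteq> (0::int)" "w \<in> carrier A" "r y [^]\<^bsub>D\<^esub> N = n w"
    using n unfolding rational_iso_def by blast
  have aw: "a w \<in> carrier B" using ah N by (auto simp: hom_def)
  have "r (y [^]\<^bsub>C\<^esub> N) = r (i (a w))"
    using hom_int_pow[OF rh(1) y C.is_group D.is_group, of N] N eq by simp
  moreover have "i (a w) \<in> carrier C" using i aw by (auto simp: hom_def)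
  ultimately have "y [^]\<^bsub>C\<^esub> N = i (a w)" using rh(2) y by (auto dest: inj_onD)
  then show "\<exists>N::int. N \<noteq> 0 \<and> y [^]\<^bsub>C\<^esub> N \<in> i ` carrier B" using N aw by blast
qed

lemma rational_iso_of_iso:
  assumes "comm_group G" "comm_group H" "h \<in> iso G H"
  shows "rational_iso G H h"
  unfolding rational_iso_def
proof (intro conjI ballI impI)
  show "torsion_elt G x" if "x \<in> carrier G" "torsion_elt H (h x)" for x
    using torsion_elt_iso[OF assms that] .
  fix y assume y: "y \<in> carrier H"
  then have "y [^]\<^bsub>H\<^esub> (1::int) \<in> h ` carrier G"
    using assms by (simp add: iso_def bij_betw_def comm_group_def group.int_pow_1)
  then show "\<exists>N::int. N \<noteq> 0 \<and> y [^]\<^bsub>H\<^esub> N \<in> h ` carrier G" by (intro exI[of _ 1]) simp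
qed

lemma torsion_rational_iso:
  assumes "comm_group G" "comm_group H" "n \<in> hom G H" "has_rank G 0" "has_rank H 0"
  shows "rational_iso G H n"
  unfolding rational_iso_def
proof (intro conjI ballI impI)
  show "torsion_elt G x" if "x \<in> carrier G" for x
    using that assms(1,4) by (simp add: comm_group.has_rank_0_iff)
  fix y assume "y \<in> carrier H"
  then obtain N where "N \<noteq> (0::int)" "y [^]\<^bsub>H\<^esub> N = \<one>\<^bsub>H\<^esub>"
    using assms(2,5) by (auto simp: comm_group.has_rank_0_iff torsion_elt_def)
  moreover have "\<one>\<^bsub>H\<^esub> = n \<one>\<^bsub>G\<^esub>" using hom_one[OF assms(3)] assms(1,2) by (simp add: comm_group_def)
  moreover have "\<one>\<^bsub>G\<^esub> \<in> carrier G" using assms(1) by (simp add: comm_group_def group.is_monoid monoid.one_closed)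
  ultimately show "\<exists>N::int. N \<noteq> 0 \<and> y [^]\<^bsub>H\<^esub> N \<in> n ` carrier G" by (metis imageI)
qed

lemma rank_one_proportional:
  assumes "comm_group H" "has_rank H 1" "s \<in> carrier H" "\<not> torsion_elt H s" "x \<in> carrier H"
  shows "\<exists>N m. N \<noteq> (0::int) \<and> x [^]\<^bsub>H\<^esub> N = s [^]\<^bsub>H\<^esub> (m::int)"
proof -
  interpret comm_group H by fact
  obtain B where B: "rational_basis H B id" "card B = 1" using has_rank_imp_rational_basis assms(2) by blast
  then obtain b where b: "B = {b}" by (auto simp: card_1_singleton_iff)
  have bc: "b \<in> carrier H" using B b by (auto simp: rational_basis_def)
  have cb: "int_comb H id B c = b [^]\<^bsub>H\<^esub> c b" for c
    unfolding b int_comb_def using bc by simp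
  obtain N c where s: "N \<noteq> (0::int)" "s [^]\<^bsub>H\<^esub> N = b [^]\<^bsub>H\<^esub> (c::int)"
    using B assms(3) cb unfolding rational_basis_def by metis
  obtain M d where x: "M \<noteq> (0::int)" "x [^]\<^bsub>H\<^esub> M = b [^]\<^bsub>H\<^esub> (d::int)"
    using B assms(5) cb unfolding rational_basis_def by metis
  have "c \<noteq> 0"
  proof
    assume "c = 0"
    then have "torsion_elt H s" using s by (auto simp: torsion_elt_def)
    then show False using assms(4) by simp
  qed
  have "x [^]\<^bsub>H\<^esub> (M * c) = (x [^]\<^bsub>H\<^esub> M) [^]\<^bsub>H\<^esub> c" using assms(5) by (simp add: int_pow_pow)
  also have "\<dots> = (b [^]\<^bsub>H\<^esub> c) [^]\<^bsub>H\<^esub> d" unfolding x using bc by (simp add: int_pow_pow mult.commute)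
  also have "\<dots> = s [^]\<^bsub>H\<^esub> (N * d)" unfolding s(2)[symmetric] using assms(3) by (simp add: int_pow_pow)
  finally show ?thesis using x(1) \<open>c \<noteq> 0\<close> by (metis mult_eq_0_iff)
qed

text \<open>Between groups of rank one, a homomorphism is rationally either zero or an isomorphism, so one element
  with nontorsion image decides.\<close>

lemma rank_one_rational_iso:
  assumes "comm_group G" "comm_group H" "n \<in> hom G H" "has_rank G 1" "has_rank H 1"
    and s: "s \<in> carrier G" "\<not> torsion_elt H (n s)"
  shows "rational_iso G H n"
  unfolding rational_iso_def
proof (intro conjI ballI impI)
  interpret G: comm_group G by fact
  interpret H: comm_group H by fact
  have ns: "n s \<in> carrier H" using assms(3) s by (auto simp: hom_def)
  have nts: "\<not> torsion_elt G s" using torsion_elt_hom[OF assms(1-3) s(1)] s(2) by blast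
  note hp = hom_int_pow[OF assms(3) _ G.is_group H.is_group]
  {
    fix x assume x: "x \<in> carrier G" "torsion_elt H (n x)"
    obtain N m where N: "N \<noteq> (0::int)" "x [^]\<^bsub>G\<^esub> N = s [^]\<^bsub>G\<^esub> (m::int)"
      using rank_one_proportional[OF assms(1,4) s(1) nts x(1)] by blast
    obtain M where M: "M \<noteq> (0::int)" "n x [^]\<^bsub>H\<^esub> M = \<one>\<^bsub>H\<^esub>" using x(2) by (auto simp: torsion_elt_def)
    have nx: "n x \<in> carrier H" using assms(3) x by (auto simp: hom_def)
    have "n s [^]\<^bsub>H\<^esub> m = n x [^]\<^bsub>H\<^esub> N" using N(2) hp[OF x(1), of N] hp[OF s(1), of m] by simp
    then have "n s [^]\<^bsub>H\<^esub> (m * M) = (n x [^]\<^bsub>H\<^esub> N) [^]\<^bsub>H\<^esub> M" using ns by (simp flip: H.int_pow_pow)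
    also have "\<dots> = (n x [^]\<^bsub>H\<^esub> M) [^]\<^bsub>H\<^esub> N" using nx by (simp add: H.int_pow_pow mult.commute)
    also have "\<dots> = \<one>\<^bsub>H\<^esub>" using M by simp
    finally have "m * M = 0" using s(2) unfolding torsion_elt_def by blast
    then have "x [^]\<^bsub>G\<^esub> N = \<one>\<^bsub>G\<^esub>" using M N by simp
    then show "torsion_elt G x" using N by (auto simp: torsion_elt_def)
  }
  fix y assume y: "y \<in> carrier H"
  obtain N m where N: "N \<noteq> (0::int)" "y [^]\<^bsub>H\<^esub> N = n s [^]\<^bsub>H\<^esub> (m::int)"
    using rank_one_proportional[OF assms(2,5) ns s(2) y] by blast
  have "y [^]\<^bsub>H\<^esub> N = n (s [^]\<^bsub>G\<^esub> m)" using N(2) hp[OF s(1), of m] by simp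
  then show "\<exists>N::int. N \<noteq> 0 \<and> y [^]\<^bsub>H\<^esub> N \<in> n ` carrier G" using N s by blast
qed

section \<open>Attaching a contractible open set\<close>

lemma comm_group_reduced_homology_group [simp]: "comm_group (reduced_homology_group p X)"
  unfolding reduced_homology_group_def by (simp add: group.abelian_subgroup_generated)

lemma has_reduced_betti_homotopy_equivalent:
  assumes "X homotopy_equivalent_space Y" "has_reduced_betti X i b"
  shows "has_reduced_betti Y i b"
proof -
  have "topspace X = {} \<longleftrightarrow> topspace Y = {}"
    using assms(1) by (fastforce simp: homotopy_equivalent_space_def continuous_map_def)
  moreover obtain h where "h \<in> iso (reduced_homology_group i X) (reduced_homology_group i Y)"
    using homotopy_equivalent_space_imp_isomorphic_reduced_homology_groups[OF assms(1)]
    unfolding is_iso_def by blast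
  ultimately show ?thesis
    using assms(2) unfolding has_reduced_betti_def
    by (metis comm_group_reduced_homology_group has_rank_iso)
qed

lemma has_reduced_betti_contractible:
  assumes "contractible_space X" "topspace X \<noteq> {}"
  shows "has_reduced_betti X i 0"
  using assms unfolding has_reduced_betti_def
  by (simp add: has_rank_trivial_group trivial_reduced_homology_group_contractible_space)

lemma has_reduced_betti_unique:
  "has_reduced_betti X i a \<Longrightarrow> has_reduced_betti X i b \<Longrightarrow> a = b"
  unfolding has_reduced_betti_def
  by (metis comm_group_reduced_homology_group comm_group.has_rank_unique)

lemma has_reduced_betti_0_iff:
  assumes "topspace X \<noteq> {}"
  shows "has_reduced_betti X i 0 \<longleftrightarrow>
    (\<forall>x\<in>carrier (reduced_homology_group i X). torsion_elt (reduced_homology_group i X) x)"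
  using assms unfolding has_reduced_betti_def
  by (simp add: comm_group.has_rank_0_iff)

text \<open>Up to homotopy, \<open>X\<close> is the mapping cone of the inclusion of \<open>U \<inter> V\<close> into \<open>U\<close>. The intersection may be
  empty: its Betti number in degree \<open>-1\<close> then stands for the component \<open>V\<close> that \<open>X\<close> has in addition to \<open>U\<close>.\<close>

locale contractible_patch =
  fixes X :: "'a topology" and U V :: "'a set"
  assumes opU: "openin X U" and opV: "openin X V" and UV: "U \<union> V = topspace X"
    and con: "contractible_space (subtopology X V)" and ne: "V \<noteq> {}"
begin

abbreviation "XU \<equiv> subtopology X U"
abbreviation "XV \<equiv> subtopology X V"
abbreviation "XW \<equiv> subtopology X (U \<inter> V)"

lemma sub: "U \<subseteq> topspace X" "V \<subseteq> topspace X" using UV by auto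

lemma XVW: "subtopology XV (U \<inter> V) = XW"
  by (simp add: subtopology_subtopology Int_commute Int_left_commute)

lemma excision:
  "hom_induced p XV (U \<inter> V) X U id \<in> iso (relative_homology_group p XV (U \<inter> V)) (relative_homology_group p X U)"
proof -
  define K where "K = topspace X - V"
  have "closedin X K" using opV by (auto simp: K_def)
  then have "X closure_of K \<subseteq> X interior_of U"
    using opU UV by (auto simp: K_def interior_of_openin closure_of_closedin)
  from homology_excision_axiom[OF this sub(1), of p]
  have "hom_induced p (subtopology X (topspace X - K)) (U - K) (subtopology X (topspace X)) U id
    \<in> iso (relative_homology_group p (subtopology X (topspace X - K)) (U - K))
          (relative_homology_group p (subtopology X (topspace X)) U)" .
  moreover have "topspace X - K = V" "U - K = U \<inter> V" using sub by (auto simp: K_def)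
  ultimately show ?thesis by (simp add: subtopology_topspace)
qed

lemma boundary_iso:
  assumes "U \<inter> V \<noteq> {}"
  shows "hom_boundary p XV (U \<inter> V) \<in> iso (relative_homology_group p XV (U \<inter> V)) (reduced_homology_group (p - 1) XW)"
proof -
  have "topspace XV \<inter> (U \<inter> V) \<noteq> {}" using assms sub by auto
  from iso_relative_homology_of_contractible[OF con this, of p] show ?thesis by (simp add: XVW)
qed

text \<open>The relative homology of \<open>(X, U)\<close> is that of \<open>(V, U \<inter> V)\<close> by excision, and the boundary map takes it to
  the reduced homology of \<open>U \<inter> V\<close> because \<open>V\<close> is contractible. For an empty intersection it is the homology of
  \<open>V\<close>, which agrees with the convention for the empty space.\<close>

lemma rank_relative:
  assumes "has_reduced_betti XW (p - 1) c"
  shows "has_rank (relative_homology_group p X U) c"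
proof (cases "U \<inter> V = {}")
  case False
  have "topspace XW \<noteq> {}" using False sub by auto
  then have r: "has_rank (reduced_homology_group (p - 1) XW) c"
    using assms by (simp add: has_reduced_betti_def)
  obtain k where k: "k \<in> iso (reduced_homology_group (p - 1) XW) (relative_homology_group p XV (U \<inter> V))"
    using group.iso_sym[OF group_relative_homology_group] boundary_iso[OF False, of p]
    unfolding is_iso_def by blast
  have "has_rank (relative_homology_group p XV (U \<inter> V)) c"
    using has_rank_iso[OF _ _ k r] by simp
  from has_rank_iso[OF _ _ excision this] show ?thesis by simp
next
  case True
  then have "topspace XW = {}" by simp
  then have c: "c = (if p = 0 then 1 else 0)" using assms by (simp add: has_reduced_betti_def)
  have e: "hom_induced p XV {} X U id \<in> iso (homology_group p XV) (relative_homology_group p X U)"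
    using excision[of p] True by simp
  have "has_rank (homology_group p XV) c"
  proof (cases "p = 0")
    case True
    have "path_connected_space XV" by (rule contractible_imp_path_connected_space[OF con])
    moreover have "topspace XV \<noteq> {}" using ne sub by auto
    ultimately have "homology_group 0 XV \<cong> integer_group"
      by (rule isomorphic_integer_zeroth_homology_group)
    then obtain k where "k \<in> iso (homology_group 0 XV) integer_group" unfolding is_iso_def by blast
    from has_rank_integer[OF this] show ?thesis using True c by simp
  next
    case False
    have "trivial_group (homology_group p XV)"
      using trivial_reduced_homology_group_contractible_space[OF con, of p]
      by (simp add: un_reduced_homology_group[OF False])
    then show ?thesis using False c by (simp add: has_rank_trivial_group)
  qed
  from has_rank_iso[OF _ _ e this] show ?thesis by simp
qed

text \<open>The connecting maps of the long exact sequence of \<open>(X, U)\<close> run from the homology of \<open>U \<inter> V\<close> to that of \<open>U\<close>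
  in the degrees \<open>i\<close> and \<open>i - 1\<close>. When one of the two groups is torsion, the connecting map is rationally zero,
  and the part of the sequence around \<open>X\<close> becomes short exact up to torsion.\<close>

lemma betti_sum:
  assumes b: "has_reduced_betti XU i b" and c: "has_reduced_betti XW (i - 1) c"
    and z: "has_reduced_betti XW i 0 \<or> has_reduced_betti XU i 0"
    and z': "has_reduced_betti XW (i - 1) 0 \<or> has_reduced_betti XU (i - 1) 0"
  shows "has_reduced_betti X i (b + c)"
proof (cases "U = {}")
  case True
  have "X = XV" using UV True by (simp add: subtopology_topspace)
  then have "has_reduced_betti X i 0"
    using has_reduced_betti_contractible[OF con] ne sub by (metis topspace_subtopology_subset)
  moreover have "topspace XU = {}" "topspace XW = {}" using True by auto
  ultimately show ?thesis using b c z z' by (auto simp: has_reduced_betti_def split: if_splits)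
next
  case False
  let ?RU = "\<lambda>p. reduced_homology_group p XU"
  let ?R = "\<lambda>p. relative_homology_group p X U"
  let ?g = "hom_induced i XU {} X {} id" and ?h = "hom_induced i X {} X U id"
  have Une: "topspace X \<inter> U \<noteq> {}" "topspace XU \<noteq> {}" "topspace X \<noteq> {}" using False sub by auto
  note e1 = homology_exactness_reduced_1[OF Une(1), of i]
  note e2 = homology_exactness_reduced_2[of "i + 1" X U]
  note e3 = homology_exactness_reduced_3[of i X U]
  have g: "?g \<in> hom (?RU i) (reduced_homology_group i X)" by (rule hom_induced_reduced_hom)
  have h: "?h \<in> hom (reduced_homology_group i X) (?R i)"
    using e3 by (simp add: group_hom_def group_hom_axioms_def)
  have rR: "has_rank (?R i) c" by (rule rank_relative[OF c])
  have "has_rank (reduced_homology_group i X) (b + c)"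
  proof (rule has_rank_exact[OF _ _ _ g h _ _ _ _ rR])
    show "Coset.kernel (reduced_homology_group i X) (?R i) ?h = ?g ` carrier (?RU i)"
      using e3 by simp
    show "has_rank (?RU i) b" using b Une by (simp add: has_reduced_betti_def)
  next
    fix x assume x: "x \<in> carrier (?RU i)" "?g x = \<one>\<^bsub>reduced_homology_group i X\<^esub>"
    then have "x \<in> kernel (?RU i) (reduced_homology_group i X) ?g" by (simp add: kernel_def)
    then obtain y where y: "y \<in> carrier (?R (i+1))" "x = hom_boundary (i+1) X U y"
      using e2 by auto
    from z show "torsion_elt (?RU i) x"
    proof
      assume "has_reduced_betti XW i 0"
      then have "has_rank (?R (i+1)) 0" by (intro rank_relative) simp
      then have "torsion_elt (?R (i+1)) y" using y by (simp add: comm_group.has_rank_0_iff)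
      then show ?thesis
        using torsion_elt_hom[OF _ _ hom_boundary_reduced_hom[of "i+1" X U] y(1)] y(2) by simp
    next
      assume "has_reduced_betti XU i 0"
      then show ?thesis using has_reduced_betti_0_iff[OF Une(2)] x by blast
    qed
  next
    fix d assume d: "d \<in> carrier (?R i)"
    from z' show "\<exists>N::int. N \<noteq> 0 \<and> d [^]\<^bsub>?R i\<^esub> N \<in> ?h ` carrier (reduced_homology_group i X)"
    proof
      assume "has_reduced_betti XW (i - 1) 0"
      then have "has_rank (?R i) 0" by (intro rank_relative)
      then obtain N where N: "N \<noteq> (0::int)" "d [^]\<^bsub>?R i\<^esub> N = \<one>\<^bsub>?R i\<^esub>"
        using d by (auto simp: comm_group.has_rank_0_iff torsion_elt_def)
      have "\<one>\<^bsub>?R i\<^esub> = ?h \<one>\<^bsub>reduced_homology_group i X\<^esub>"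
        using hom_one[OF h] by simp
      moreover have "\<one>\<^bsub>reduced_homology_group i X\<^esub> \<in> carrier (reduced_homology_group i X)"
        by (simp add: group.is_monoid monoid.one_closed)
      ultimately show ?thesis using N by (metis imageI)
    next
      assume 0: "has_reduced_betti XU (i - 1) 0"
      let ?d = "hom_boundary i X U"
      have hd: "?d \<in> hom (?R i) (?RU (i-1))" by (rule hom_boundary_reduced_hom)
      then have "?d d \<in> carrier (?RU (i-1))" using d by (rule hom_in_carrier)
      then obtain N where N: "N \<noteq> (0::int)" "?d d [^]\<^bsub>?RU (i-1)\<^esub> N = \<one>\<^bsub>?RU (i-1)\<^esub>"
        using 0 Une by (auto simp: has_reduced_betti_0_iff torsion_elt_def)
      have "?d (d [^]\<^bsub>?R i\<^esub> N) = \<one>\<^bsub>?RU (i-1)\<^esub>"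
        using hom_int_pow[OF hd d] N by simp
      moreover have "d [^]\<^bsub>?R i\<^esub> N \<in> carrier (?R i)"
        using d by (simp add: group.int_pow_closed)
      ultimately have "d [^]\<^bsub>?R i\<^esub> N \<in> kernel (?R i) (?RU (i-1)) ?d"
        by (simp add: kernel_def)
      then show ?thesis using e1 N by auto
    qed
  qed simp_all
  then show ?thesis using Une by (simp add: has_reduced_betti_def)
qed

text \<open>The mapping cone of a rational homology isomorphism is rationally acyclic.\<close>

lemma betti_zero:
  assumes ne': "U \<inter> V \<noteq> {}"
    and ri: "\<And>p. rational_iso (reduced_homology_group p XW) (reduced_homology_group p XU)
       (hom_induced p XW {} XU {} id)"
  shows "has_reduced_betti X i 0"
proof -
  let ?RX = "reduced_homology_group i X"
  let ?RU = "\<lambda>p. reduced_homology_group p XU"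
  let ?RW = "\<lambda>p. reduced_homology_group p XW"
  let ?R = "relative_homology_group i X U"
  let ?RV = "relative_homology_group i XV (U \<inter> V)"
  let ?g = "hom_induced i XU {} X {} id" and ?h = "hom_induced i X {} X U id"
  have Une: "topspace X \<inter> U \<noteq> {}" "topspace XU \<noteq> {}" "topspace X \<noteq> {}" using ne' sub by auto
  note e1 = homology_exactness_reduced_1[OF Une(1), of i]
  note e3 = homology_exactness_reduced_3[of i X U]
  have inj: "torsion_elt (?RW p) w"
    if "w \<in> carrier (?RW p)" "torsion_elt (?RU p) (hom_induced p XW {} XU {} id w)" for p w
    using ri[of p] that unfolding rational_iso_def by blast
  have surj: "\<exists>N::int. N \<noteq> 0 \<and> y [^]\<^bsub>?RU p\<^esub> N \<in> hom_induced p XW {} XU {} id ` carrier (?RW p)"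
    if "y \<in> carrier (?RU p)" for p y
    using ri[of p] that unfolding rational_iso_def by blast
  interpret RX: comm_group ?RX by simp
  have g: "?g \<in> hom (?RU i) ?RX" by (rule hom_induced_reduced_hom)
  have h: "?h \<in> hom ?RX ?R"
    using e3 by (simp add: group_hom_def group_hom_axioms_def)
  have "torsion_elt ?RX x" if x: "x \<in> carrier ?RX" for x
  proof -
    have hx: "?h x \<in> carrier ?R" using h x by (rule hom_in_carrier)
    obtain z where z: "z \<in> carrier ?RV" "?h x = hom_induced i XV (U \<inter> V) X U id z"
      using excision[of i] hx by (auto simp: iso_def bij_betw_def)
    let ?w = "hom_boundary i XV (U \<inter> V) z"
    have w: "?w \<in> carrier (?RW (i-1))"
      using boundary_iso[OF ne', of i] z(1) by (auto simp: iso_def hom_def)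
    have "hom_boundary i X U (?h x) = \<one>\<^bsub>?RU (i-1)\<^esub>"
    proof -
      have "?h x \<in> kernel ?R (?RU (i-1)) (hom_boundary i X U)"
        using e1 x by auto
      then show ?thesis by (simp add: kernel_def)
    qed
    also have "hom_boundary i X U (?h x) = hom_induced (i-1) XW {} XU {} id ?w"
    proof -
      have "continuous_map XV X id" by (simp add: continuous_map_from_subtopology)
      from naturality_hom_induced[OF this, of "U \<inter> V" U i]
      show ?thesis using z(2) by (auto simp: fun_eq_iff XVW)
    qed
    finally have "torsion_elt (?RU (i-1)) (hom_induced (i-1) XW {} XU {} id ?w)"
      by (auto simp: torsion_elt_def group.int_pow_one intro!: exI[of _ "1::int"])
    then have "torsion_elt (?RW (i-1)) ?w" by (rule inj[OF w])
    from torsion_elt_iso[OF _ _ boundary_iso[OF ne'] z(1) this]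
    have "torsion_elt ?RV z" by simp
    moreover have "hom_induced i XV (U \<inter> V) X U id \<in> hom ?RV ?R"
      using excision[of i] by (simp add: iso_def)
    ultimately have "torsion_elt ?R (?h x)"
      unfolding z(2) using z(1) torsion_elt_hom[of ?RV ?R] by simp
    then obtain N where N: "N \<noteq> (0::int)" "?h x [^]\<^bsub>?R\<^esub> N = \<one>\<^bsub>?R\<^esub>"
      by (auto simp: torsion_elt_def)
    have "?h (x [^]\<^bsub>?RX\<^esub> N) = \<one>\<^bsub>?R\<^esub>"
      using hom_int_pow[OF h x] N by simp
    then have "x [^]\<^bsub>?RX\<^esub> N \<in> kernel ?RX ?R ?h" using x by (simp add: kernel_def)
    then obtain u where u: "u \<in> carrier (?RU i)" "x [^]\<^bsub>?RX\<^esub> N = ?g u"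
      using e3 by auto
    obtain M w where M: "M \<noteq> (0::int)" "w \<in> carrier (?RW i)" "u [^]\<^bsub>?RU i\<^esub> M = hom_induced i XW {} XU {} id w"
      using surj[OF u(1)] by auto
    have "x [^]\<^bsub>?RX\<^esub> (N * M) = (?g u) [^]\<^bsub>?RX\<^esub> M"
      using x u by (simp flip: RX.int_pow_pow)
    also have "\<dots> = ?g (u [^]\<^bsub>?RU i\<^esub> M)"
      using hom_int_pow[OF g u(1)] by simp
    also have "\<dots> = hom_induced i XW {} X {} id w"
      unfolding M(3) by (subst hom_induced_compose') (auto simp: continuous_map_from_subtopology continuous_map_in_subtopology)
    also have "\<dots> = hom_induced i XV {} X {} id (hom_induced i XW {} XV {} id w)"
      by (subst hom_induced_compose') (auto simp: continuous_map_from_subtopology continuous_map_in_subtopology)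
    also have "hom_induced i XW {} XV {} id w = \<one>\<^bsub>reduced_homology_group i XV\<^esub>"
      using hom_in_carrier[OF hom_induced_reduced_hom M(2), of XV id]
        trivial_reduced_homology_group_contractible_space[OF con, of i]
      by (simp add: trivial_group_def)
    also have "hom_induced i XV {} X {} id \<dots> = \<one>\<^bsub>?RX\<^esub>"
      by (rule hom_one[OF hom_induced_reduced_hom]) simp_all
    finally show ?thesis unfolding torsion_elt_def using N M by (metis mult_eq_0_iff)
  qed
  then show ?thesis using has_reduced_betti_0_iff[OF Une(3)] by blast
qed

end

section \<open>Orbit spaces of groups of diagonal unitary matrices\<close>

text \<open>A point of the torus is read as a diagonal unitary matrix: the componentwise product is the group operation
  as well as the action on vectors.\<close>

definition torus_subgroup :: "(complex ^ 'n) set \<Rightarrow> bool" where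
  "torus_subgroup G \<longleftrightarrow> G \<subseteq> torus \<and> 1 \<in> G \<and> (\<forall>g\<in>G. \<forall>h\<in>G. g * h \<in> G) \<and> (\<forall>g\<in>G. \<exists>h\<in>G. h * g = 1)"

definition orb :: "(complex ^ 'n) set \<Rightarrow> complex ^ 'n \<Rightarrow> (complex ^ 'n) set" where
  "orb G v = (\<lambda>g. g * v) ` G"

definition orbit_top :: "(complex ^ 'n) set \<Rightarrow> (complex ^ 'n) set \<Rightarrow> (complex ^ 'n) set topology" where
  "orbit_top G S = quotient_topology (top_of_set S) (orb G)"

definition invariant :: "(complex ^ 'n) set \<Rightarrow> (complex ^ 'n) set \<Rightarrow> bool" where
  "invariant G S \<longleftrightarrow> (\<forall>g\<in>G. \<forall>v\<in>S. g * v \<in> S)"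

text \<open>The map between orbit spaces induced by \<open>f\<close>; the union has just one member when \<open>f\<close>
  respects orbits.\<close>

definition orbit_map :: "(complex ^ 'n) set \<Rightarrow> (complex ^ 'm \<Rightarrow> complex ^ 'n) \<Rightarrow> (complex ^ 'm) set \<Rightarrow> (complex ^ 'n) set" where
  "orbit_map H f x = (\<Union>v\<in>x. orb H (f v))"

lemma continuous_on_vec_mult [continuous_intros]:
  fixes f g :: "'a::topological_space \<Rightarrow> complex ^ 'n"
  assumes "continuous_on S f" "continuous_on S g"
  shows "continuous_on S (\<lambda>x. f x * g x)"
  unfolding times_vec_def by (intro continuous_intros assms)

locale torus_group =
  fixes G :: "(complex ^ 'n) set"
  assumes tg: "torus_subgroup G"
begin

lemma one_mem [simp]: "1 \<in> G" and mult_mem [simp]: "g \<in> G \<Longrightarrow> h \<in> G \<Longrightarrow> g * h \<in> G"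
  and norm_comp [simp]: "g \<in> G \<Longrightarrow> norm (g $ j) = 1"
  using tg by (auto simp: torus_subgroup_def torus_def)

lemma inv_ex: assumes "g \<in> G" obtains h where "h \<in> G" "h * g = 1" "g * h = 1"
proof -
  obtain h where h: "h \<in> G" "h * g = 1" using tg assms unfolding torus_subgroup_def by blast
  moreover have "g * h = 1" using h(2) mult.commute[of g h] by simp
  ultimately show ?thesis using that by blast
qed

lemma orb_self [simp]: "v \<in> orb G v"
  unfolding orb_def using one_mem mult_1_left by (metis image_eqI)

lemma orb_mult: assumes "g \<in> G" shows "orb G (g * v) = orb G v"
proof -
  obtain h where h: "h \<in> G" "h * g = 1" using inv_ex assms by metis
  have 1: "k * v = (k * h) * (g * v)" for k
  proof -
    have "(k * h) * (g * v) = k * ((h * g) * v)" by (simp only: mult.assoc)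
    then show ?thesis using h by simp
  qed
  have 2: "k * (g * v) = (k * g) * v" for k by (simp add: mult.assoc)
  show ?thesis
  proof
    show "orb G (g * v) \<subseteq> orb G v"
      unfolding orb_def
    proof (rule image_subsetI)
      fix k assume "k \<in> G"
      then show "k * (g * v) \<in> (\<lambda>g. g * v) ` G"
        unfolding 2 by (intro imageI mult_mem assms)
    qed
    show "orb G v \<subseteq> orb G (g * v)"
      unfolding orb_def
    proof (rule image_subsetI)
      fix k assume "k \<in> G"
      then show "k * v \<in> (\<lambda>k. k * (g * v)) ` G"
        unfolding 1[of k] by (intro imageI mult_mem h)
    qed
  qed
qed

lemma orb_eq_iff: "orb G v = orb G w \<longleftrightarrow> (\<exists>g\<in>G. w = g * v)"
proof
  assume "orb G v = orb G w"
  then have "w \<in> orb G v" by simp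
  then show "\<exists>g\<in>G. w = g * v" by (auto simp: orb_def)
qed (auto simp: orb_mult)

lemma orb_subset: "invariant G S \<Longrightarrow> v \<in> S \<Longrightarrow> orb G v \<subseteq> S"
  by (auto simp: orb_def invariant_def)

lemma mem_orb_imp_eq: "w \<in> orb G v \<Longrightarrow> orb G w = orb G v"
proof -
  assume "w \<in> orb G v"
  then obtain g where "g \<in> G" "w = g * v" unfolding orb_def by auto
  then show ?thesis by (simp add: orb_mult)
qed

lemma mem_orb_image:
  "invariant G S \<Longrightarrow> orb G v \<in> orb G ` S \<longleftrightarrow> v \<in> S"
proof -
  assume S: "invariant G S"
  have "v \<in> S" if "orb G v = orb G s" "s \<in> S" for s
  proof -
    have "v \<in> orb G s" using that(1) orb_self[of v] by simp
    then show ?thesis using orb_subset[OF S that(2)] by blast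
  qed
  then show ?thesis by auto
qed

lemma orb_image_Int:
  "invariant G S \<Longrightarrow> invariant G T \<Longrightarrow> orb G ` S \<inter> orb G ` T = orb G ` (S \<inter> T)"
proof -
  assume S: "invariant G S" and T: "invariant G T"
  show ?thesis
  proof
    show "orb G ` S \<inter> orb G ` T \<subseteq> orb G ` (S \<inter> T)"
    proof
      fix x assume x: "x \<in> orb G ` S \<inter> orb G ` T"
      then obtain v where "v \<in> S" "x = orb G v" by auto
      then show "x \<in> orb G ` (S \<inter> T)" using x mem_orb_image[OF T] by auto
    qed
  qed auto
qed

lemma topspace_orbit_top [simp]: "topspace (orbit_top G S) = orb G ` S"
  by (simp add: orbit_top_def topspace_quotient_topology)

lemma quotient_map_orb: "quotient_map (top_of_set S) (orbit_top G S) (orb G)"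
  unfolding orbit_top_def by (rule quotient_map_quotient_topology)

lemma openin_orbit_top:
  "openin (orbit_top G S) A \<longleftrightarrow> A \<subseteq> orb G ` S \<and> openin (top_of_set S) {v \<in> S. orb G v \<in> A}"
  by (simp add: orbit_top_def openin_quotient_topology)

lemma openin_orb_image:
  assumes "invariant G S" "invariant G T" "openin (top_of_set S) T"
  shows "openin (orbit_top G S) (orb G ` T)"
proof -
  have "T \<subseteq> S" using assms(3) openin_imp_subset by blast
  then have "{v \<in> S. orb G v \<in> orb G ` T} = T" using mem_orb_image[OF assms(2)] by auto
  then show ?thesis using assms(3) \<open>T \<subseteq> S\<close> by (auto simp: openin_orbit_top)
qed

lemma open_map_orb:
  assumes "invariant G S" "openin (top_of_set S) O'"
  shows "openin (orbit_top G S) (orb G ` O')"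
proof -
  have O: "O' \<subseteq> S" using assms(2) openin_imp_subset by blast
  have "{v \<in> S. orb G v \<in> orb G ` O'} = (\<Union>g\<in>G. {v \<in> S. g * v \<in> O'})"
    using O by (auto simp: image_iff orb_eq_iff)
  moreover have "openin (top_of_set S) {v \<in> S. g * v \<in> O'}" if "g \<in> G" for g
  proof -
    have "continuous_map (top_of_set S) (top_of_set S) (\<lambda>v. g * v)"
      using assms(1) that by (auto intro!: continuous_intros simp: invariant_def)
    from openin_continuous_map_preimage[OF this assms(2)] show ?thesis by simp
  qed
  ultimately show ?thesis using O by (auto simp: openin_orbit_top)
qed

text \<open>The orbit projection is open, so its restriction to an invariant subset is again a quotient map.\<close>

lemma subtopology_orbit_top:
  assumes S: "invariant G S" and T: "invariant G T" and TS: "T \<subseteq> S"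
  shows "subtopology (orbit_top G S) (orb G ` T) = orbit_top G T"
  unfolding topology_eq openin_subtopology
proof (intro allI iffI)
  fix A assume "\<exists>B. openin (orbit_top G S) B \<and> A = B \<inter> orb G ` T"
  then obtain B where B: "openin (orbit_top G S) B" "A = B \<inter> orb G ` T" by auto
  have "{v \<in> T. orb G v \<in> A} = T \<inter> {v \<in> S. orb G v \<in> B}" using B TS by auto
  moreover have "openin (top_of_set T) (T \<inter> {v \<in> S. orb G v \<in> B})"
  proof -
    have "openin (top_of_set S) {v \<in> S. orb G v \<in> B}" using B(1) by (simp add: openin_orbit_top)
    then obtain O' where "open O'" "{v \<in> S. orb G v \<in> B} = S \<inter> O'" by (auto simp: openin_open)
    then show ?thesis using TS by (auto simp: openin_open)
  qed
  ultimately show "openin (orbit_top G T) A" using B by (auto simp: openin_orbit_top)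
next
  fix A assume A: "openin (orbit_top G T) A"
  then obtain O' where O: "open O'" "{v \<in> T. orb G v \<in> A} = T \<inter> O'"
    unfolding openin_orbit_top openin_open by auto
  let ?B = "orb G ` (S \<inter> O')"
  have "openin (orbit_top G S) ?B" by (rule open_map_orb[OF S]) (use O in auto)
  moreover have "A = ?B \<inter> orb G ` T"
  proof
    show "A \<subseteq> ?B \<inter> orb G ` T"
    proof
      fix x assume x: "x \<in> A"
      then obtain v where v: "v \<in> T" "x = orb G v" using A by (auto simp: openin_orbit_top)
      then have "v \<in> T \<inter> O'" using O(2) x by auto
      then show "x \<in> ?B \<inter> orb G ` T" using v TS by auto
    qed
    show "?B \<inter> orb G ` T \<subseteq> A"
    proof
      fix x assume x: "x \<in> ?B \<inter> orb G ` T"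
      then obtain u where u: "x = orb G u" "u \<in> O'" by auto
      then have "u \<in> T" using x mem_orb_image[OF T] by auto
      then show "x \<in> A" using u O by auto
    qed
  qed
  ultimately show "\<exists>B. openin (orbit_top G S) B \<and> A = B \<inter> orb G ` T" by blast
qed

lemma continuous_map_from_orbit_top:
  assumes "continuous_map (top_of_set S) Y f" "\<And>v. v \<in> S \<Longrightarrow> F (orb G v) = f v"
  shows "continuous_map (orbit_top G S) Y F"
proof -
  have "continuous_map (top_of_set S) Y (F \<circ> orb G)"
    by (rule continuous_map_eq[OF assms(1)]) (simp add: assms(2))
  then show ?thesis by (rule continuous_compose_quotient_map[OF quotient_map_orb])
qed

end

lemma torus_group_trivial: "torus_group {1 :: complex ^ 'n}"
  unfolding torus_group_def torus_subgroup_def by (auto simp: torus_def)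

lemma orbit_map_orb:
  assumes "torus_group G" "\<And>g. g \<in> G \<Longrightarrow> orb H (f (g * v)) = orb H (f v)"
  shows "orbit_map H f (orb G v) = orb H (f v)"
proof -
  interpret torus_group G by fact
  have "G \<noteq> {}" using one_mem by blast
  then show ?thesis unfolding orbit_map_def orb_def[of G] using assms(2) by simp
qed

lemma continuous_map_orbit_map:
  assumes G: "torus_group G" and H: "torus_group H"
    and f: "continuous_on S f" "f ` S \<subseteq> S'" and eq: "\<And>g v. g \<in> G \<Longrightarrow> v \<in> S \<Longrightarrow> orb H (f (g * v)) = orb H (f v)"
  shows "continuous_map (orbit_top G S) (orbit_top H S') (orbit_map H f)"
proof (rule torus_group.continuous_map_from_orbit_top[OF G])
  show "continuous_map (top_of_set S) (orbit_top H S') (orb H \<circ> f)"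
    by (rule continuous_map_compose[OF _ quotient_imp_continuous_map[OF torus_group.quotient_map_orb[OF H]]])
      (use f in auto)
  show "orbit_map H f (orb G v) = (orb H \<circ> f) v" if "v \<in> S" for v
    unfolding comp_def using eq that by (intro orbit_map_orb[OF G]) auto
qed

text \<open>As the unit interval is locally compact, its product with the orbit projection is a quotient map. So a
  homotopy that respects orbits descends to the orbit spaces.\<close>

lemma homotopic_orbit_map:
  assumes G: "torus_group G" and H: "torus_group H"
    and h: "continuous_on ({0..1} \<times> S) (\<lambda>(t, v). h t v)"
    and im: "\<And>t v. t \<in> {0..1::real} \<Longrightarrow> v \<in> S \<Longrightarrow> h t v \<in> S'"
    and eq: "\<And>t g v. t \<in> {0..1} \<Longrightarrow> g \<in> G \<Longrightarrow> v \<in> S \<Longrightarrow> orb H (h t (g * v)) = orb H (h t v)"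
    and f: "\<And>v. v \<in> S \<Longrightarrow> f (orb G v) = orb H (h 0 v)"
    and f': "\<And>v. v \<in> S \<Longrightarrow> f' (orb G v) = orb H (h 1 v)"
  shows "homotopic_with (\<lambda>_. True) (orbit_top G S) (orbit_top H S') f f'"
proof -
  interpret G: torus_group G by fact
  interpret H: torus_group H by fact
  let ?I = "top_of_set {0..1::real}"
  let ?k = "\<lambda>(t, x). orbit_map H (h t) x"
  have q: "quotient_map (prod_topology ?I (top_of_set S)) (prod_topology ?I (orbit_top G S)) (\<lambda>(t, v). (t, orb G v))"
  proof (rule quotient_map_prod_right[OF _ _ G.quotient_map_orb])
    show "locally_compact_space ?I"
      by (simp add: compact_imp_locally_compact_space compact_space_subtopology)
  qed (simp add: Hausdorff_space_subtopology)
  have "continuous_map (prod_topology ?I (top_of_set S)) (orbit_top H S') (?k \<circ> (\<lambda>(t, v). (t, orb G v)))"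
  proof (rule continuous_map_eq)
    show "continuous_map (prod_topology ?I (top_of_set S)) (orbit_top H S') (orb H \<circ> (\<lambda>(t, v). h t v))"
      by (rule continuous_map_compose[OF _ quotient_imp_continuous_map[OF H.quotient_map_orb]])
        (use h im in auto)
    fix p assume "p \<in> topspace (prod_topology ?I (top_of_set S))"
    then show "(orb H \<circ> (\<lambda>(t, v). h t v)) p = (?k \<circ> (\<lambda>(t, v). (t, orb G v))) p"
      using eq by (cases p) (auto intro!: orbit_map_orb[OF G, symmetric])
  qed
  then have k: "continuous_map (prod_topology ?I (orbit_top G S)) (orbit_top H S') ?k"
    by (rule continuous_compose_quotient_map[OF q])
  have 0: "orbit_map H (h t) (orb G v) = orb H (h t v)" if "t \<in> {0..1}" "v \<in> S" for t v
    using eq that by (intro orbit_map_orb[OF G]) auto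
  show ?thesis
    unfolding homotopic_with[where P="\<lambda>_. True", OF refl]
    using k f f' 0 by (intro exI[of _ ?k]) auto
qed

text \<open>The value of \<open>f\<close> at \<open>v\<close> is computed from an arbitrary element of the compact set \<open>C\<close> that satisfies a closed
  condition depending on \<open>v\<close>; there may be no continuous way to choose this element. Still \<open>f\<close> is continuous:
  the preimage of a closed set is the projection of a closed subset of \<open>C \<times> S\<close>, and projections along a
  compact factor are closed maps.\<close>

lemma continuous_map_compact_choice:
  fixes S :: "'a::metric_space set" and C :: "'b::metric_space set"
  assumes C: "compact C" and R: "closedin (top_of_set (C \<times> S)) R"
    and m: "continuous_map (top_of_set R) Y m"
    and ex: "\<And>v. v \<in> S \<Longrightarrow> \<exists>g\<in>C. (g, v) \<in> R"
    and f: "\<And>g v. (g, v) \<in> R \<Longrightarrow> f v = m (g, v)"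
  shows "continuous_map (top_of_set S) Y f"
  unfolding continuous_map_closedin
proof (intro conjI allI impI)
  have RCS: "R \<subseteq> C \<times> S" using closedin_subset[OF R] by simp
  show "f \<in> topspace (top_of_set S) \<rightarrow> topspace Y"
  proof
    fix v assume "v \<in> topspace (top_of_set S)"
    then obtain g where "(g, v) \<in> R" using ex by auto
    then show "f v \<in> topspace Y"
      using f m continuous_map_image_subset_topspace[OF m] by fastforce
  qed
  fix D assume D: "closedin Y D"
  let ?P = "{p \<in> topspace (top_of_set R). m p \<in> D}"
  have "closedin (top_of_set R) ?P"
    by (rule closedin_continuous_map_preimage[OF m D])
  then have "closedin (top_of_set (C \<times> S)) ?P"
    using R closedin_trans by blast
  then have P: "closedin (prod_topology (top_of_set C) (top_of_set S)) ?P"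
    by simp
  have "closed_map (prod_topology (top_of_set C) (top_of_set S)) (top_of_set S) snd"
    by (rule Abstract_Topological_Spaces.closed_map_snd) (simp add: C compact_space_subtopology)
  then have "closedin (top_of_set S) (snd ` ?P)" using P by (simp add: closed_map_def)
  moreover have "snd ` ?P = {v \<in> topspace (top_of_set S). f v \<in> D}"
  proof
    show "snd ` ?P \<subseteq> {v \<in> topspace (top_of_set S). f v \<in> D}"
    proof
      fix v assume "v \<in> snd ` ?P"
      then obtain g where g: "(g, v) \<in> R" "m (g, v) \<in> D" by auto
      then show "v \<in> {v \<in> topspace (top_of_set S). f v \<in> D}" using f[OF g(1)] RCS by auto
    qed
    show "{v \<in> topspace (top_of_set S). f v \<in> D} \<subseteq> snd ` ?P"
    proof
      fix v assume v: "v \<in> {v \<in> topspace (top_of_set S). f v \<in> D}"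
      then obtain g where "(g, v) \<in> R" using ex by auto
      then have "(g, v) \<in> ?P" using v f by auto
      then show "v \<in> snd ` ?P" by (rule rev_image_eqI) simp
    qed
  qed
  ultimately show "closedin (top_of_set S) {v \<in> topspace (top_of_set S). f v \<in> D}" by simp
qed

section \<open>Splitting off one coordinate\<close>

definition supp :: "complex ^ 'n \<Rightarrow> 'n set" where "supp v = {j. v $ j \<noteq> 0}"

definition sph :: "'n set set \<Rightarrow> (complex ^ 'n::finite) set" where
  "sph K = {v. norm v = 1 \<and> supp v \<in> K}"

definition rest :: "'n \<Rightarrow> complex ^ 'n \<Rightarrow> complex ^ 'n::finite" where
  "rest e v = (\<chi> j. if j = e then 0 else v $ j)"

text \<open>The unit sphere is the topological join of the circle of the coordinate \<open>e\<close> and the unit sphere of the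
  other coordinates; \<open>unit_rest\<close> and \<open>join\<close> are the corresponding coordinates and parametrization
  (\<open>join_unit_rest\<close>).\<close>

definition unit_rest :: "'n \<Rightarrow> complex ^ 'n \<Rightarrow> complex ^ 'n::finite" where
  "unit_rest e v = inverse (norm (rest e v)) *\<^sub>R rest e v"

definition join :: "'n \<Rightarrow> complex ^ 'n \<Rightarrow> complex \<Rightarrow> complex ^ 'n::finite" where
  "join e w z = sqrt (1 - (norm z)\<^sup>2) *\<^sub>R w + axis e z"

text \<open>In a family closed under subsets, that is, in a simplicial complex, these are the deletion and the link of
  the vertex \<open>e\<close>.\<close>

definition del :: "'n set set \<Rightarrow> 'n \<Rightarrow> 'n set set" where "del K e = {A \<in> K. e \<notin> A}"

definition lnk :: "'n set set \<Rightarrow> 'n \<Rightarrow> 'n set set" where "lnk K e = {A. e \<notin> A \<and> insert e A \<in> K}"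

definition stab :: "(complex ^ 'n) set \<Rightarrow> 'n \<Rightarrow> (complex ^ 'n) set" where "stab G e = {g \<in> G. g $ e = 1}"

lemma rest_nth [simp]: "rest e v $ j = (if j = e then 0 else v $ j)" by (simp add: rest_def)

lemma axis_nth': "axis e z $ j = (if j = e then z else 0)" by (simp add: axis_def)

lemma norm_vec_sq: "(norm (v :: complex ^ 'n::finite))\<^sup>2 = (\<Sum>j\<in>UNIV. (norm (v $ j))\<^sup>2)"
  unfolding norm_vec_def L2_set_def by (rule real_sqrt_pow2) (simp add: sum_nonneg)

lemma norm_split: "(norm v)\<^sup>2 = (norm (rest e v))\<^sup>2 + (norm (v $ e))\<^sup>2"
proof -
  have "(norm v)\<^sup>2 = (norm (v $ e))\<^sup>2 + (\<Sum>j\<in>UNIV - {e}. (norm (v $ j))\<^sup>2)"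
    unfolding norm_vec_sq by (subst sum.remove[of _ e]) auto
  also have "(\<Sum>j\<in>UNIV - {e}. (norm (v $ j))\<^sup>2) = (\<Sum>j\<in>UNIV - {e}. (norm (rest e v $ j))\<^sup>2)"
    by (rule sum.cong) auto
  also have "\<dots> = (norm (rest e v))\<^sup>2"
    unfolding norm_vec_sq by (subst (2) sum.remove[of _ e]) auto
  finally show ?thesis by simp
qed

lemma norm_axis': "norm (axis e z :: complex ^ 'n::finite) = norm z"
proof -
  have "(norm (axis e z :: complex ^ 'n))\<^sup>2 = (norm z)\<^sup>2"
  proof -
    have "rest e (axis e z) = 0" by (simp add: vec_eq_iff axis_nth')
    then show ?thesis using norm_split[of "axis e z" e] by (simp add: axis_nth')
  qed
  then show ?thesis by simp
qed

lemma join_nth: "join e w z $ j = sqrt (1 - (norm z)\<^sup>2) *\<^sub>R w $ j + (if j = e then z else 0)"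
  by (simp add: join_def axis_nth')

lemma join_e [simp]: "w $ e = 0 \<Longrightarrow> join e w z $ e = z" by (simp add: join_nth)

lemma rest_join: "w $ e = 0 \<Longrightarrow> rest e (join e w z) = sqrt (1 - (norm z)\<^sup>2) *\<^sub>R w"
  by (auto simp: vec_eq_iff join_nth)

lemma norm_join:
  assumes "norm w = 1" "w $ e = 0" "norm z \<le> 1"
  shows "norm (join e w z) = 1"
proof -
  have "(norm z)\<^sup>2 \<le> 1" using assms(3) by (simp add: power_le_one)
  then have "(norm (join e w z))\<^sup>2 = 1"
    using assms by (simp add: norm_split[of _ e] rest_join)
  then show ?thesis by (simp add: power2_eq_1_iff) (metis norm_ge_zero not_one_le_zero neg_0_le_iff_le order.trans neg_le_0_iff_le zero_le_one)
qed

lemma norm_rest: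
  assumes "norm v = 1" shows "norm (rest e v) = sqrt (1 - (norm (v $ e))\<^sup>2)"
  using norm_split[of v e] assms by (metis add_diff_cancel_right' norm_ge_zero one_power2 real_sqrt_unique)

lemma norm_rest_pos:
  assumes "norm v = 1" "norm (v $ e) < 1" shows "norm (rest e v) > 0"
  using assms by (simp add: norm_rest power_less_one_iff abs_square_less_1)

lemma unit_rest_e [simp]: "unit_rest e v $ e = 0" by (simp add: unit_rest_def)

lemma norm_unit_rest:
  assumes "norm v = 1" "norm (v $ e) < 1" shows "norm (unit_rest e v) = 1"
  using norm_rest_pos[OF assms] by (simp add: unit_rest_def)

lemma join_unit_rest:
  assumes "norm v = 1" "norm (v $ e) < 1" shows "join e (unit_rest e v) (v $ e) = v"
proof -
  have "join e (unit_rest e v) (v $ e) = rest e v + axis e (v $ e)"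
    using norm_rest_pos[OF assms] by (simp add: join_def unit_rest_def norm_rest[OF assms(1)])
  also have "\<dots> = v" by (auto simp: vec_eq_iff axis_nth')
  finally show ?thesis .
qed

lemma unit_rest_id:
  assumes "norm w = 1" "w $ e = 0" shows "unit_rest e w = w"
proof -
  have "rest e w = w" using assms by (auto simp: vec_eq_iff)
  then show ?thesis using assms by (simp add: unit_rest_def)
qed

lemma unit_rest_join:
  assumes "norm w = 1" "w $ e = 0" "norm z < 1" shows "unit_rest e (join e w z) = w"
proof -
  have "(norm z)\<^sup>2 < 1" using assms(3) by (simp add: abs_square_less_1)
  then show ?thesis using assms by (simp add: unit_rest_def rest_join)
qed

lemma supp_unit_rest:
  assumes "norm v = 1" "norm (v $ e) < 1" shows "supp (unit_rest e v) = supp v - {e}"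
  using norm_rest_pos[OF assms] by (auto simp: supp_def unit_rest_def)

lemma supp_join:
  assumes "w $ e = 0" "norm z < 1" shows "supp (join e w z) = (if z = 0 then supp w else insert e (supp w))"
proof -
  have "(norm z)\<^sup>2 < 1" using assms(2) by (simp add: abs_square_less_1)
  then show ?thesis using assms by (auto simp: supp_def join_nth)
qed

lemma continuous_on_rest [continuous_intros]:
  "continuous_on S f \<Longrightarrow> continuous_on S (\<lambda>x. rest e (f x))"
  unfolding rest_def
proof (rule continuous_on_vec_lambda)
  fix j assume "continuous_on S f"
  then show "continuous_on S (\<lambda>x. if j = e then 0 else f x $ j)"
    by (cases "j = e") (auto intro!: continuous_intros)
qed

lemma continuous_on_axis [continuous_intros]:
  "continuous_on S f \<Longrightarrow> continuous_on S (\<lambda>x. axis e (f x) :: complex ^ 'n::finite)"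
  unfolding axis_def
proof (rule continuous_on_vec_lambda)
  fix j assume "continuous_on S f"
  then show "continuous_on S (\<lambda>x. if j = e then f x else 0)"
    by (cases "j = e") auto
qed

lemma continuous_on_join [continuous_intros]:
  "continuous_on S f \<Longrightarrow> continuous_on S g \<Longrightarrow> continuous_on S (\<lambda>x. join e (f x) (g x))"
  unfolding join_def by (intro continuous_intros)

lemma continuous_on_unit_rest [continuous_intros]:
  assumes "continuous_on S f" "\<And>x. x \<in> S \<Longrightarrow> norm (f x) = 1 \<and> norm (f x $ e) < 1"
  shows "continuous_on S (\<lambda>x. unit_rest e (f x))"
  unfolding unit_rest_def using assms norm_rest_pos[of _ e]
  by (intro continuous_intros) fastforce+

lemma rest_mult: "rest e (g * v) = g * rest e v" by (auto simp: vec_eq_iff)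

lemma scaleR_mult_vec: "g * (c *\<^sub>R v) = c *\<^sub>R (g * v :: complex ^ 'n)" by (simp add: vec_eq_iff)

context torus_group
begin

lemma norm_mult_vec [simp]: "g \<in> G \<Longrightarrow> norm (g * v) = norm v"
  unfolding norm_vec_def by (simp add: norm_mult)

lemma supp_mult [simp]: "g \<in> G \<Longrightarrow> supp (g * v) = supp v"
  using norm_comp unfolding supp_def by (metis (no_types, lifting) mult_eq_0_iff norm_zero vector_mult_component zero_neq_one)

lemma unit_rest_mult: "g \<in> G \<Longrightarrow> unit_rest e (g * v) = g * unit_rest e v"
  by (simp add: unit_rest_def rest_mult scaleR_mult_vec)

lemma join_mult: "g \<in> G \<Longrightarrow> join e (g * w) (g $ e * z) = g * join e w z"
  by (auto simp: vec_eq_iff join_nth norm_mult algebra_simps)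

lemma invariant_sph [simp]: "invariant G (sph K)"
  by (simp add: invariant_def sph_def)

lemma torus_group_stab: "torus_group (stab G e)"
proof -
  have "\<exists>h\<in>stab G e. h * g = 1" if "g \<in> stab G e" for g
  proof -
    have g: "g \<in> G" "g $ e = 1" using that by (auto simp: stab_def)
    obtain h where h: "h \<in> G" "h * g = 1" using inv_ex[OF g(1)] by metis
    have "h $ e * g $ e = 1" using h(2) by (metis one_index vector_mult_component)
    then show ?thesis using h g by (auto simp: stab_def)
  qed
  moreover have "stab G e \<subseteq> torus" using tg by (auto simp: stab_def torus_subgroup_def)
  ultimately show ?thesis
    unfolding torus_group_def torus_subgroup_def by (auto simp: stab_def)
qed

end

text \<open>An open cone \<open>\<Omega>\<close> of values of the coordinate \<open>e\<close> on which the group acts so that the rays of the quotient are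
  parametrized by an interval \<open>I\<close>: the angle \<open>\<theta>\<close> is constant on orbits and on rays, and \<open>cis\<close> provides a section
  of it. There are two instances, the punctured plane for a group that is transitive on the circle, where \<open>I\<close>
  is a point, and sectors for a group of roots of unity.

  The set \<open>SO\<close>, where the coordinate \<open>e\<close> is not the only nonzero one, contracts modulo \<open>G\<close> to the orbit space
  \<open>Y\<close> of the deletion. The orbit space of the set \<open>SN\<close>, where the coordinate \<open>e\<close> lies in \<open>\<Omega>\<close>, is contractible,
  and that of \<open>SO \<inter> SN\<close> is equivalent to the orbit space \<open>W\<close> of the link under the stabilizer of the
  coordinate.\<close>

locale coordinate_chart = torus_group G for G :: "(complex ^ 'n::finite) set" +
  fixes K :: "'n set set" and e :: 'n and \<Omega> :: "complex set" and \<theta> :: "complex \<Rightarrow> real"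
    and I :: "real set" and \<theta>0 :: real
  assumes cpt: "compact G"
    and down: "A \<in> K \<Longrightarrow> B \<subseteq> A \<Longrightarrow> B \<in> K"
    and open_\<Omega>: "open \<Omega>" and nz: "0 \<notin> \<Omega>"
    and inv: "z \<in> \<Omega> \<Longrightarrow> g \<in> G \<Longrightarrow> g $ e * z \<in> \<Omega> \<and> \<theta> (g $ e * z) = \<theta> z"
    and scl: "z \<in> \<Omega> \<Longrightarrow> s > 0 \<Longrightarrow> of_real s * z \<in> \<Omega> \<and> \<theta> (of_real s * z) = \<theta> z"
    and cont_\<theta>: "continuous_on \<Omega> \<theta>"
    and ran: "z \<in> \<Omega> \<Longrightarrow> \<theta> z \<in> I"
    and phase: "z \<in> \<Omega> \<Longrightarrow> \<exists>g\<in>G. g $ e * cis (\<theta> z) = sgn z"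
    and conv: "convex I"
    and sec: "t \<in> I \<Longrightarrow> cis t \<in> \<Omega> \<and> \<theta> (cis t) = t"
    and \<theta>0: "\<theta>0 \<in> I"
begin

text \<open>As \<open>s\<close> runs from 0 to 1, \<open>rot s z\<close> turns \<open>z\<close> to the base angle \<open>\<theta>0\<close>.\<close>

definition "SO = {v \<in> sph K. norm (v $ e) < 1}"
definition "SN = {v \<in> sph K. v $ e \<in> \<Omega>}"
definition "rot s z = z * cis (s * (\<theta>0 - \<theta> z))"

lemma invariant_SO [simp]: "invariant G SO"
  using invariant_sph[of K] by (auto simp: SO_def invariant_def norm_mult)

lemma invariant_SN [simp]: "invariant G SN"
  using invariant_sph[of K] inv by (auto simp: SN_def invariant_def)

lemma invariant_SON [simp]: "invariant G (SO \<inter> SN)"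
  using invariant_SO invariant_SN by (auto simp: invariant_def)

lemma SO_D: assumes "v \<in> SO" shows "norm v = 1" "norm (v $ e) < 1" "supp v \<in> K"
  using assms by (auto simp: SO_def sph_def)

lemma SN_D: assumes "v \<in> SN" shows "norm v = 1" "v $ e \<in> \<Omega>" "supp v \<in> K" "v $ e \<noteq> 0"
  using assms nz by (auto simp: SN_def sph_def)

lemma norm_rot [simp]: "norm (rot s z) = norm z" by (simp add: rot_def norm_mult)

lemma rot_0 [simp]: "rot 0 z = z" by (simp add: rot_def)

lemma rot_\<Omega>: assumes "z \<in> \<Omega>" "s \<in> {0..1}" shows "rot s z \<in> \<Omega>"
proof -
  obtain g where g: "g \<in> G" "g $ e * cis (\<theta> z) = sgn z" using phase assms by auto
  let ?t = "\<theta> z + s * (\<theta>0 - \<theta> z)"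
  have "?t = (1 - s) *\<^sub>R \<theta> z + s *\<^sub>R \<theta>0" by (simp add: algebra_simps)
  then have t: "?t \<in> I" using conv ran[OF assms(1)] \<theta>0 assms(2) unfolding convex_alt by auto
  have z0: "z \<noteq> 0" using nz assms by auto
  have "z = of_real (norm z) * sgn z" using z0 by (simp add: sgn_eq)
  then have "rot s z = of_real (norm z) * (g $ e * cis (\<theta> z)) * cis (s * (\<theta>0 - \<theta> z))"
    using g by (simp add: rot_def)
  also have "\<dots> = of_real (norm z) * (g $ e * cis ?t)"
    by (simp add: cis_mult[symmetric] mult.assoc)
  finally have r: "rot s z = of_real (norm z) * (g $ e * cis ?t)" .
  have "g $ e * cis ?t \<in> \<Omega>" using inv sec[OF t] g by auto
  then show ?thesis unfolding r using scl z0 by auto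
qed

lemma rot_mult: "z \<in> \<Omega> \<Longrightarrow> g \<in> G \<Longrightarrow> rot s (g $ e * z) = g $ e * rot s z"
  using inv by (simp add: rot_def mult.assoc)

lemma scl_\<Omega>: "z \<in> \<Omega> \<Longrightarrow> c > 0 \<Longrightarrow> of_real c * z \<in> \<Omega>" using scl by blast

lemma continuous_on_rot:
  assumes "continuous_on S s" "continuous_on S f" "\<And>x. x \<in> S \<Longrightarrow> f x \<in> \<Omega>"
  shows "continuous_on S (\<lambda>x. rot (s x) (f x))"
proof -
  have "continuous_on S (\<lambda>x. \<theta> (f x))"
    using continuous_on_compose2[OF cont_\<theta> assms(2)] assms(3) by blast
  then show ?thesis unfolding rot_def by (intro continuous_intros assms)
qed

abbreviation "Y \<equiv> orbit_top G (sph (del K e))"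
abbreviation "W \<equiv> orbit_top (stab G e) (sph (lnk K e))"
abbreviation "XO \<equiv> orbit_top G SO"
abbreviation "XN \<equiv> orbit_top G SN"
abbreviation "XON \<equiv> orbit_top G (SO \<inter> SN)"

lemma del_sph_SO: "sph (del K e) \<subseteq> SO"
  by (auto simp: sph_def del_def SO_def supp_def)

lemma del_sph_D: "w \<in> sph (del K e) \<Longrightarrow> norm w = 1 \<and> w $ e = 0 \<and> supp w \<in> K"
  by (auto simp: sph_def del_def supp_def)

lemma lnk_sph_D: "w \<in> sph (lnk K e) \<Longrightarrow> norm w = 1 \<and> w $ e = 0 \<and> insert e (supp w) \<in> K"
  by (auto simp: sph_def lnk_def supp_def)

lemma unit_rest_del: "v \<in> SO \<Longrightarrow> unit_rest e v \<in> sph (del K e)"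
  using SO_D[of v] down by (auto simp: sph_def del_def norm_unit_rest supp_unit_rest)

lemma unit_rest_lnk: "v \<in> SO \<inter> SN \<Longrightarrow> unit_rest e v \<in> sph (lnk K e)"
proof -
  assume v: "v \<in> SO \<inter> SN"
  then have "e \<in> supp v" using SN_D by (auto simp: supp_def)
  then have "insert e (supp v - {e}) = supp v" by auto
  then show ?thesis using SO_D[of v] v by (auto simp: sph_def lnk_def norm_unit_rest supp_unit_rest)
qed

lemma join_SON:
  assumes "w \<in> sph (lnk K e)" "z \<in> \<Omega>" "norm z < 1"
  shows "join e w z \<in> SO \<inter> SN"
proof -
  have w: "norm w = 1" "w $ e = 0" "insert e (supp w) \<in> K" using lnk_sph_D[OF assms(1)] by auto
  moreover have "z \<noteq> 0" using nz assms by auto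
  ultimately show ?thesis using assms by (simp add: SO_def SN_def sph_def norm_join supp_join)
qed

lemma continuous_retract: "continuous_map XO Y (orbit_map G (unit_rest e))"
proof (rule continuous_map_orbit_map)
  show "continuous_on SO (unit_rest e)"
    using SO_D by (intro continuous_on_unit_rest[of _ "\<lambda>x. x"] continuous_intros) auto
qed (auto simp: unit_rest_del unit_rest_mult orb_mult torus_group_axioms)

lemma retract_orb: "orbit_map G (unit_rest e) (orb G v) = orb G (unit_rest e v)"
  by (rule orbit_map_orb[OF torus_group_axioms]) (simp add: unit_rest_mult orb_mult)

lemma continuous_include: "continuous_map Y XO id"
proof -
  have "invariant G (sph (del K e))" by simp
  from subtopology_orbit_top[OF invariant_SO this del_sph_SO]
  show ?thesis by (metis continuous_map_from_subtopology continuous_map_id)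
qed

lemma retract_include: "homotopic_with (\<lambda>_. True) Y Y (orbit_map G (unit_rest e) \<circ> id) id"
proof (rule homotopic_with_equal)
  show "continuous_map Y Y (orbit_map G (unit_rest e) \<circ> id)"
    using continuous_map_compose[OF continuous_include continuous_retract] .
  fix x assume "x \<in> topspace Y"
  then obtain w where "w \<in> sph (del K e)" "x = orb G w" by auto
  then show "(orbit_map G (unit_rest e) \<circ> id) x = id x"
    using del_sph_D by (simp add: retract_orb unit_rest_id)
qed auto

text \<open>The homotopy shrinks the coordinate \<open>e\<close> to zero and rescales the other coordinates.\<close>

lemma include_retract: "homotopic_with (\<lambda>_. True) XO XO (id \<circ> orbit_map G (unit_rest e)) id"
proof (rule homotopic_with_symD, rule homotopic_orbit_map[OF torus_group_axioms torus_group_axioms])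
  let ?h = "\<lambda>t v. join e (unit_rest e v) (of_real (1 - t) * v $ e)"
  show "continuous_on ({0..1} \<times> SO) (\<lambda>(t, v). ?h t v)"
    unfolding case_prod_beta using SO_D by (intro continuous_intros) auto
  fix t :: real and v assume t: "t \<in> {0..1}" and v: "v \<in> SO"
  note d = SO_D[OF v]
  have n: "norm (of_real (1 - t) * v $ e) < 1"
  proof -
    have "norm (of_real (1 - t) * v $ e) = (1 - t) * norm (v $ e)"
      using t unfolding norm_mult norm_of_real by simp
    also have "\<dots> \<le> norm (v $ e)" using t by (intro mult_left_le_one_le) auto
    finally show ?thesis using d by simp
  qed
  have "supp (?h t v) \<subseteq> supp v"
    using n d by (auto simp: supp_join supp_unit_rest supp_def[of v])
  then have "supp (?h t v) \<in> K" using down d by blast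
  moreover have "norm (?h t v) = 1" using n d by (intro norm_join) (auto simp: norm_unit_rest)
  ultimately show "?h t v \<in> SO" using n by (simp add: SO_def sph_def)
  fix g assume g: "g \<in> G"
  have "?h t (g * v) = join e (g * unit_rest e v) (g $ e * (of_real (1 - t) * v $ e))"
    using g by (simp add: unit_rest_mult mult.left_commute)
  also have "\<dots> = g * ?h t v" using g by (rule join_mult)
  finally show "orb G (?h t (g * v)) = orb G (?h t v)" using g by (simp add: orb_mult)
next
  fix v assume v: "v \<in> SO"
  show "id (orb G v) = orb G (join e (unit_rest e v) (of_real (1 - 0) * v $ e))"
    using SO_D[OF v] by (simp add: join_unit_rest)
  show "(id \<circ> orbit_map G (unit_rest e)) (orb G v) = orb G (join e (unit_rest e v) (of_real (1 - 1) * v $ e))"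
    by (simp add: retract_orb) (simp add: join_def axis_def vec_eq_iff zero_vec_def[symmetric])
qed

text \<open>Shrinking the other coordinates while the coordinate \<open>e\<close> turns to the angle \<open>\<theta>0\<close> moves every orbit to that of
  the vector \<open>axis e (cis \<theta>0)\<close>.\<close>

lemma contractible_XN: "contractible_space XN"
proof -
  let ?q = "\<lambda>t v. (1 - t) *\<^sub>R rest e v + axis e (rot t (v $ e))"
  let ?h = "\<lambda>t v. inverse (norm (?q t v)) *\<^sub>R ?q t v"
  have qe: "?q t v $ e = rot t (v $ e)" for t v by (simp add: axis_nth')
  have q0: "norm (?q t v) > 0" if "v \<in> SN" for t v
  proof -
    have "?q t v $ e \<noteq> 0" unfolding qe using SN_D(4)[OF that] norm_rot[of t "v $ e"] by force
    then show ?thesis by (metis zero_index zero_less_norm_iff)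
  qed
  have cr: "continuous_on ({0..1} \<times> SN) (\<lambda>x. rot (fst x) (snd x $ e))"
    using SN_D by (intro continuous_on_rot continuous_intros) auto
  have "homotopic_with (\<lambda>_. True) XN XN id (\<lambda>_. orb G (axis e (cis \<theta>0)))"
  proof (rule homotopic_orbit_map[OF torus_group_axioms torus_group_axioms])
    show "continuous_on ({0..1} \<times> SN) (\<lambda>(t, v). ?h t v)"
      unfolding case_prod_beta using q0 by (intro continuous_intros cr) force
    fix t :: real and v assume t: "t \<in> {0..1}" and v: "v \<in> SN"
    note d = SN_D[OF v]
    have "supp (?h t v) \<subseteq> supp v"
      using d by (auto simp: supp_def axis_nth')
    then have "supp (?h t v) \<in> K" using down d by blast
    moreover have "norm (?h t v) = 1" using q0[OF v, of t] by simp
    moreover have "?h t v $ e \<in> \<Omega>"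
    proof -
      have "?h t v $ e = of_real (inverse (norm (?q t v))) * rot t (v $ e)"
        by (simp only: vector_scaleR_component qe scaleR_conv_of_real[where 'a=complex])
      moreover have "\<dots> \<in> \<Omega>" using q0[OF v, of t] rot_\<Omega>[OF d(2) t] by (intro scl_\<Omega>) auto
      ultimately show ?thesis by simp
    qed
    ultimately show "?h t v \<in> SN" by (simp add: SN_def sph_def)
    fix g assume g: "g \<in> G"
    have "?q t (g * v) = g * ?q t v"
      using g rot_mult[OF d(2) g, of t] by (auto simp: vec_eq_iff axis_nth')
    then have "?h t (g * v) = g * ?h t v" using g by (simp only: norm_mult_vec scaleR_mult_vec)
    then show "orb G (?h t (g * v)) = orb G (?h t v)" using g by (simp only: orb_mult)
  next
    fix v assume v: "v \<in> SN"
    note d = SN_D[OF v]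
    have "?q 0 v = v" by (auto simp: vec_eq_iff axis_nth')
    then show "id (orb G v) = orb G (?h 0 v)" using d by simp
    obtain g where g: "g \<in> G" "g $ e * cis (\<theta> (v $ e)) = sgn (v $ e)" using phase d by auto
    have n: "norm (?q 1 v) = norm (v $ e)"
    proof -
      have "(norm (?q 1 v))\<^sup>2 = (norm (v $ e))\<^sup>2"
        unfolding norm_split[of "?q 1 v" e] qe by (simp add: vec_eq_iff axis_nth')
      then show ?thesis by simp
    qed
    have "?h 1 v = g * axis e (cis \<theta>0)"
    proof -
      have "?h 1 v $ e = inverse (norm (v $ e)) *\<^sub>R rot 1 (v $ e)"
        using n qe[of 1 v] by simp
      also have "\<dots> = sgn (v $ e) * cis (\<theta>0 - \<theta> (v $ e))"
        by (simp add: rot_def sgn_div_norm)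
      also have "\<dots> = g $ e * cis \<theta>0"
        by (simp add: g(2)[symmetric] mult.assoc cis_mult)
      finally show ?thesis by (auto simp: vec_eq_iff axis_nth')
    qed
    then show "orb G (axis e (cis \<theta>0)) = orb G (?h 1 v)" using g by (simp add: orb_mult)
  qed
  then show ?thesis unfolding contractible_space_def by blast
qed

end

context coordinate_chart
begin

lemma cis_half: "cis \<theta>0 / 2 \<in> \<Omega>" "norm (cis \<theta>0 / 2 :: complex) < 1" "\<theta> (cis \<theta>0 / 2) = \<theta>0"
  "sgn (cis \<theta>0 / 2) = cis \<theta>0"
proof -
  have "cis \<theta>0 / 2 = of_real (1/2) * cis \<theta>0" by simp
  then show "cis \<theta>0 / 2 \<in> \<Omega>" "\<theta> (cis \<theta>0 / 2) = \<theta>0"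
    using scl[of "cis \<theta>0" "1/2"] sec[OF \<theta>0] by auto
qed (auto simp: norm_divide sgn_eq)

text \<open>The link is embedded in the intersection at the base angle; the radius \<open>1/2\<close> stands for any number strictly
  between 0 and 1.\<close>

definition "link_in = orbit_map G (\<lambda>w. join e w (cis \<theta>0 / 2))"

text \<open>Every orbit in the intersection contains vectors whose coordinate \<open>e\<close> has exactly the angle \<open>\<theta>\<close>. Their
  other coordinates form, after normalization, a single orbit of the stabilizer (\<open>link_out_orb\<close>), so the
  union over all of them has one member.\<close>

definition "link_out x = (\<Union>v\<in>{v\<in>x. sgn (v $ e) = cis (\<theta> (v $ e))}. orb (stab G e) (unit_rest e v))"

interpretation stb: torus_group "stab G e" by (rule torus_group_stab)

lemma link_in_orb: "link_in (orb (stab G e) w) = orb G (join e w (cis \<theta>0 / 2))"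
  unfolding link_in_def
proof (rule orbit_map_orb[OF stb.torus_group_axioms])
  fix g assume "g \<in> stab G e"
  then have g: "g \<in> G" "g $ e = 1" by (auto simp: stab_def)
  have "join e (g * w) (g $ e * (cis \<theta>0 / 2)) = g * join e w (cis \<theta>0 / 2)" using g by (intro join_mult)
  then show "orb G (join e (g * w) (cis \<theta>0 / 2)) = orb G (join e w (cis \<theta>0 / 2))"
    using g by (simp add: orb_mult)
qed

lemma continuous_link_in: "continuous_map W XON link_in"
  unfolding link_in_def
proof (rule continuous_map_orbit_map[OF stb.torus_group_axioms torus_group_axioms])
  show "continuous_on (sph (lnk K e)) (\<lambda>w. join e w (cis \<theta>0 / 2))"
    by (intro continuous_intros)
  show "(\<lambda>w. join e w (cis \<theta>0 / 2)) ` sph (lnk K e) \<subseteq> SO \<inter> SN"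
    using join_SON cis_half by blast
  fix g v assume "g \<in> stab G e"
  then show "orb G (join e (g * v) (cis \<theta>0 / 2)) = orb G (join e v (cis \<theta>0 / 2))"
    using link_in_orb[of v] link_in_orb[of "g * v"] by (simp add: stb.orb_mult)
qed

lemma normalizer_ex:
  assumes "v \<in> SN" shows "\<exists>g\<in>G. g $ e * sgn (v $ e) = cis (\<theta> (v $ e))"
proof -
  obtain h where h: "h \<in> G" "h $ e * cis (\<theta> (v $ e)) = sgn (v $ e)" using phase SN_D(2)[OF assms] by blast
  obtain g where g: "g \<in> G" "g * h = 1" using inv_ex[OF h(1)] by metis
  then have "g $ e * h $ e = 1" by (metis one_index vector_mult_component)
  then have "g $ e * sgn (v $ e) = cis (\<theta> (v $ e))" unfolding h(2)[symmetric] by (simp flip: mult.assoc)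
  then show ?thesis using g by blast
qed

lemma sgn_mult_G: "g \<in> G \<Longrightarrow> sgn (g $ e * z) = g $ e * sgn (z :: complex)"
  by (simp add: sgn_mult) (simp add: sgn_eq)

lemma link_out_orb:
  assumes v: "v \<in> SN" and g: "g \<in> G" "g $ e * sgn (v $ e) = cis (\<theta> (v $ e))"
  shows "link_out (orb G v) = orb (stab G e) (g * unit_rest e v)"
proof -
  let ?P = "{u \<in> orb G v. sgn (u $ e) = cis (\<theta> (u $ e))}"
  have "orb (stab G e) (unit_rest e u) = orb (stab G e) (g * unit_rest e v)" if u: "u \<in> ?P" for u
  proof -
    obtain h where h: "h \<in> G" "u = h * v" using u by (auto simp: orb_def)
    have "h $ e * sgn (v $ e) = cis (\<theta> (v $ e))"
      using u h inv[OF SN_D(2)[OF v] h(1)] by (simp add: sgn_mult_G)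
    moreover have "sgn (v $ e) \<noteq> 0" using SN_D(4)[OF v] by (simp add: sgn_zero_iff)
    ultimately have he: "h $ e = g $ e" using g(2) by (metis mult_right_cancel)
    obtain k where k: "k \<in> G" "k * g = 1" using inv_ex[OF g(1)] by metis
    have "k $ e * g $ e = 1" using k(2) by (metis one_index vector_mult_component)
    then have hk: "h * k \<in> stab G e" using h k he by (simp add: stab_def mult.commute)
    have "unit_rest e u = h * (k * g) * unit_rest e v" using h k by (simp add: unit_rest_mult mult.commute)
    also have "\<dots> = (h * k) * (g * unit_rest e v)" by (simp only: mult.assoc)
    finally show ?thesis using stb.orb_mult[OF hk] by simp
  qed
  moreover have "g * v \<in> ?P"
    using g inv[OF SN_D(2)[OF v] g(1)] by (simp add: orb_def sgn_mult_G)
  ultimately show ?thesis unfolding link_out_def by blast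
qed

text \<open>A group element that turns the coordinate \<open>e\<close> of \<open>v\<close> to the angle \<open>\<theta>\<close> need not depend continuously on \<open>v\<close>, but
  the pairs of such elements and vectors form a closed set and \<open>G\<close> is compact.\<close>

lemma continuous_link_out: "continuous_map XON W link_out"
proof (rule continuous_map_from_orbit_top)
  let ?S = "SO \<inter> SN"
  let ?D = "\<lambda>p::(complex^'n) \<times> (complex^'n). fst p $ e * sgn (snd p $ e) - cis (\<theta> (snd p $ e))"
  define R where "R = {p \<in> G \<times> ?S. ?D p = 0}"
  have D: "continuous_on (G \<times> ?S) ?D"
  proof -
    have "continuous_on (G \<times> ?S) (\<lambda>p. \<theta> (snd p $ e))"
      by (rule continuous_on_compose2[OF cont_\<theta>]) (auto intro!: continuous_intros dest: SN_D)
    moreover have "continuous_on (G \<times> ?S) (\<lambda>p. sgn (snd p $ e))"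
      by (intro continuous_intros) (auto dest: SN_D)
    ultimately show ?thesis by (intro continuous_intros) (auto dest: SN_D)
  qed
  show "continuous_map (top_of_set ?S) W (\<lambda>v. link_out (orb G v))"
  proof (rule continuous_map_compact_choice[OF cpt])
    show "closedin (top_of_set (G \<times> ?S)) R"
      unfolding R_def by (rule continuous_closedin_preimage_constant[OF D])
    have "continuous_map (top_of_set R) (top_of_set (sph (lnk K e))) (\<lambda>p. fst p * unit_rest e (snd p))"
    proof -
      have "continuous_on R (\<lambda>p. fst p * unit_rest e (snd p))"
        by (intro continuous_intros) (auto simp: R_def dest: SO_D)
      moreover have "fst p * unit_rest e (snd p) \<in> sph (lnk K e)" if "p \<in> R" for p
        using that unit_rest_lnk[of "snd p"] invariant_sph[of "lnk K e"]
        by (auto simp: R_def invariant_def)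
      ultimately show ?thesis by (auto simp: continuous_map_in_subtopology)
    qed
    from continuous_map_compose[OF this quotient_imp_continuous_map[OF stb.quotient_map_orb]]
    show "continuous_map (top_of_set R) W (orb (stab G e) \<circ> (\<lambda>p. fst p * unit_rest e (snd p)))" .
    show "\<exists>g\<in>G. (g, v) \<in> R" if "v \<in> ?S" for v
      using normalizer_ex[of v] that by (auto simp: R_def)
    show "link_out (orb G v) = (orb (stab G e) \<circ> (\<lambda>p. fst p * unit_rest e (snd p))) (g, v)" if "(g, v) \<in> R" for g v
      using that by (simp add: R_def link_out_orb)
  qed
qed simp

lemma link_out_in: "homotopic_with (\<lambda>_. True) W W (link_out \<circ> link_in) id"
proof (rule homotopic_with_equal)
  show "continuous_map W W (link_out \<circ> link_in)"
    by (rule continuous_map_compose[OF continuous_link_in continuous_link_out])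
  fix x assume "x \<in> topspace W"
  then obtain w where w: "w \<in> sph (lnk K e)" "x = orb (stab G e) w" by auto
  let ?v = "join e w (cis \<theta>0 / 2)"
  note wd = lnk_sph_D[OF w(1)]
  have v: "?v \<in> SO \<inter> SN" using join_SON[OF w(1)] cis_half by auto
  have "link_out (orb G ?v) = orb (stab G e) (1 * unit_rest e ?v)"
    using v wd cis_half by (intro link_out_orb) auto
  also have "\<dots> = x" using w wd cis_half by (simp add: unit_rest_join)
  finally show "(link_out \<circ> link_in) x = id x" using w by (simp add: link_in_orb)
qed auto

lemma link_in_out: "homotopic_with (\<lambda>_. True) XON XON (link_in \<circ> link_out) id"
proof (rule homotopic_with_symD, rule homotopic_orbit_map[OF torus_group_axioms torus_group_axioms])
  let ?S = "SO \<inter> SN"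
  \<comment> \<open>the factor that moves the modulus of the coordinate \<open>e\<close> linearly to \<open>1/2\<close>\<close>
  let ?c = "\<lambda>t v. (1 - t) + t * (1/2) / norm (v $ e)"
  let ?z = "\<lambda>t v. of_real (?c t v) * rot t (v $ e)"
  let ?h = "\<lambda>t v. join e (unit_rest e v) (?z t v)"
  have vn: "0 < norm (v $ e)" "norm (v $ e) < 1" if "v \<in> ?S" for v
    using SN_D(4)[of v] SO_D(2)[of v] that by auto
  have c0: "?c t v > 0" if "t \<in> {0..1}" "v \<in> ?S" for t v
  proof (cases "t = 1")
    case False
    then have "1 - t > 0" "t * (1/2) / norm (v $ e) \<ge> 0" using that by auto
    then show ?thesis by linarith
  qed (use vn[OF that(2)] in auto)
  have z\<Omega>: "?z t v \<in> \<Omega>" if "t \<in> {0..1}" "v \<in> ?S" for t v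
    using c0[OF that] rot_\<Omega>[of "v $ e" t] SN_D(2)[of v] that by (intro scl_\<Omega>) auto
  have zn: "norm (?z t v) < 1" if t: "t \<in> {0..1}" and v: "v \<in> ?S" for t v
  proof -
    have "norm (?z t v) = ?c t v * norm (v $ e)"
      using c0[OF t v] unfolding norm_mult norm_of_real by simp
    also have "\<dots> = (1 - t) * norm (v $ e) + t * (1/2)"
      using vn[OF v] by (simp add: field_simps)
    also have "\<dots> < 1"
    proof (cases "t = 1")
      case False
      then have "(1 - t) * norm (v $ e) < (1 - t) * 1" using t vn[OF v] by (intro mult_strict_left_mono) auto
      then show ?thesis using t by simp
    qed simp
    finally show ?thesis .
  qed
  show "continuous_on ({0..1} \<times> ?S) (\<lambda>(t, v). ?h t v)"
  proof -
    have "continuous_on ({0..1} \<times> ?S) (\<lambda>p. rot (fst p) (snd p $ e))"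
      using SN_D by (intro continuous_on_rot continuous_intros) auto
    then show ?thesis
      unfolding case_prod_beta using SO_D vn by (intro continuous_intros) auto
  qed
  fix t :: real and v assume t: "t \<in> {0..1}" and v: "v \<in> ?S"
  show "?h t v \<in> ?S" using t v by (intro join_SON unit_rest_lnk z\<Omega> zn)
  fix g assume g: "g \<in> G"
  have "rot t (g $ e * v $ e) = g $ e * rot t (v $ e)" using g v by (intro rot_mult) (auto dest: SN_D)
  then have "?z t (g * v) = g $ e * ?z t v" using g by (simp add: norm_mult)
  then have "?h t (g * v) = join e (g * unit_rest e v) (g $ e * ?z t v)"
    using g by (simp only: unit_rest_mult)
  also have "\<dots> = g * ?h t v" using g by (rule join_mult)
  finally show "orb G (?h t (g * v)) = orb G (?h t v)" using g by (simp only: orb_mult)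
next
  fix v assume v: "v \<in> SO \<inter> SN"
  show "id (orb G v) = orb G (join e (unit_rest e v) (of_real ((1 - 0) + 0 * (1/2) / norm (v $ e)) * rot 0 (v $ e)))"
    using SO_D[of v] v by (simp add: join_unit_rest)
  obtain g where g: "g \<in> G" "g $ e * sgn (v $ e) = cis (\<theta> (v $ e))" using normalizer_ex[of v] v by blast
  obtain h where h: "h \<in> G" "g * h = 1" "h * g = 1" using inv_ex[OF g(1)] by metis
  have he: "h $ e * g $ e = 1" using h(3) by (metis one_index vector_mult_component)
  have v0: "v $ e \<noteq> 0" using v SN_D(4) by blast
  have z: "of_real ((1 - 1) + 1 * (1/2) / norm (v $ e)) * rot 1 (v $ e) = h $ e * (cis \<theta>0 / 2)"
  proof -
    have "sgn (v $ e) = h $ e * cis (\<theta> (v $ e))"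
      unfolding g(2)[symmetric] using he by (simp flip: mult.assoc)
    then have "sgn (v $ e) * cis (\<theta>0 - \<theta> (v $ e)) = h $ e * cis \<theta>0"
      by (simp add: mult.assoc cis_mult)
    moreover have "of_real ((1 - 1) + 1 * (1/2) / norm (v $ e)) * rot 1 (v $ e) = sgn (v $ e) * cis (\<theta>0 - \<theta> (v $ e)) / 2"
      using v0 by (simp add: rot_def sgn_eq)
    ultimately show ?thesis by simp
  qed
  have "(link_in \<circ> link_out) (orb G v) = orb G (join e (g * unit_rest e v) (cis \<theta>0 / 2))"
    using v g link_out_orb[of v g] by (simp add: link_in_orb)
  also have "\<dots> = orb G (h * join e (g * unit_rest e v) (cis \<theta>0 / 2))"
    using h by (simp add: orb_mult)
  also have "h * join e (g * unit_rest e v) (cis \<theta>0 / 2) = join e (h * (g * unit_rest e v)) (h $ e * (cis \<theta>0 / 2))"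
    using join_mult[OF h(1), of e "g * unit_rest e v" "cis \<theta>0 / 2"] by simp
  also have "h * (g * unit_rest e v) = unit_rest e v"
    using h by (simp flip: mult.assoc)
  finally show "(link_in \<circ> link_out) (orb G v) =
     orb G (join e (unit_rest e v) (of_real ((1 - 1) + 1 * (1/2) / norm (v $ e)) * rot 1 (v $ e)))"
    unfolding z .
qed

lemma XO_equiv: "XO homotopy_equivalent_space Y"
  unfolding homotopy_equivalent_space_def
  using continuous_retract continuous_include retract_include include_retract by blast

lemma XON_equiv: "XON homotopy_equivalent_space W"
  unfolding homotopy_equivalent_space_def
  using continuous_link_in continuous_link_out link_in_out link_out_in by blast

text \<open>Through the equivalences of the intersection with \<open>W\<close> and of \<open>SO\<close> with \<open>Y\<close>, the inclusion becomes the
  projection from orbits of the stabilizer to orbits of the whole group.\<close>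

lemma retract_link_in:
  assumes "x \<in> topspace W"
  shows "orbit_map G (unit_rest e) (link_in x) = orbit_map G id x"
proof -
  obtain w where w: "w \<in> sph (lnk K e)" "x = orb (stab G e) w" using assms by auto
  have "orbit_map G id (orb (stab G e) w) = orb G (id w)"
    by (rule orbit_map_orb[OF stb.torus_group_axioms]) (auto simp: stab_def orb_mult)
  then show ?thesis
    using w lnk_sph_D[OF w(1)] cis_half by (simp add: link_in_orb retract_orb unit_rest_join)
qed

end

section \<open>Deletion, contraction and coloops\<close>

lemma (in torus_group) orbit_patch:
  assumes A: "invariant G A" and B: "invariant G B"
    and "openin (top_of_set (A \<union> B)) A" "openin (top_of_set (A \<union> B)) B"
    and "contractible_space (orbit_top G B)" "B \<noteq> {}"
  shows "contractible_patch (orbit_top G (A \<union> B)) (orb G ` A) (orb G ` B)"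
    and "subtopology (orbit_top G (A \<union> B)) (orb G ` A) = orbit_top G A"
    and "subtopology (orbit_top G (A \<union> B)) (orb G ` A \<inter> orb G ` B) = orbit_top G (A \<inter> B)"
proof -
  have AB: "invariant G (A \<union> B)" "invariant G (A \<inter> B)" using A B by (auto simp: invariant_def)
  show "subtopology (orbit_top G (A \<union> B)) (orb G ` A) = orbit_top G A"
    using AB A by (intro subtopology_orbit_top) auto
  have sB: "subtopology (orbit_top G (A \<union> B)) (orb G ` B) = orbit_top G B"
    using AB B by (intro subtopology_orbit_top) auto
  show "subtopology (orbit_top G (A \<union> B)) (orb G ` A \<inter> orb G ` B) = orbit_top G (A \<inter> B)"
    unfolding orb_image_Int[OF A B] using AB by (intro subtopology_orbit_top) auto
  show "contractible_patch (orbit_top G (A \<union> B)) (orb G ` A) (orb G ` B)"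
    using assms AB by unfold_locales (auto simp: sB image_Un intro!: openin_orb_image)
qed

lemma (in torus_group) orbit_betti_sum:
  assumes "invariant G A" "invariant G B" "openin (top_of_set (A \<union> B)) A" "openin (top_of_set (A \<union> B)) B"
    "contractible_space (orbit_top G B)" "B \<noteq> {}"
    and "has_reduced_betti (orbit_top G A) i b" "has_reduced_betti (orbit_top G (A \<inter> B)) (i - 1) c"
    and "has_reduced_betti (orbit_top G (A \<inter> B)) i 0 \<or> has_reduced_betti (orbit_top G A) i 0"
    and "has_reduced_betti (orbit_top G (A \<inter> B)) (i - 1) 0 \<or> has_reduced_betti (orbit_top G A) (i - 1) 0"
  shows "has_reduced_betti (orbit_top G (A \<union> B)) i (b + c)"
proof -
  note p = orbit_patch[OF assms(1-6)]
  show ?thesis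
    using contractible_patch.betti_sum[OF p(1), of i b c] assms(7-10) unfolding p(2,3) by blast
qed

lemma (in torus_group) orbit_betti_zero:
  assumes "invariant G A" "invariant G B" "openin (top_of_set (A \<union> B)) A" "openin (top_of_set (A \<union> B)) B"
    "contractible_space (orbit_top G B)" "B \<noteq> {}"
    and e: "A \<inter> B = {} \<Longrightarrow> A = {}"
    and ri: "\<And>p. A \<inter> B \<noteq> {} \<Longrightarrow>
       rational_iso (reduced_homology_group p (orbit_top G (A \<inter> B))) (reduced_homology_group p (orbit_top G A))
         (hom_induced p (orbit_top G (A \<inter> B)) {} (orbit_top G A) {} id)"
  shows "has_reduced_betti (orbit_top G (A \<union> B)) i 0"
proof (cases "A \<inter> B = {}")
  case True
  then have "A = {}" by (rule e)
  then show ?thesis using has_reduced_betti_contractible[OF assms(5)] assms(6) by simp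
next
  case False
  note p = orbit_patch[OF assms(1-6)]
  show ?thesis
  proof (rule contractible_patch.betti_zero[OF p(1)], unfold p(2,3))
    show "orb G ` A \<inter> orb G ` B \<noteq> {}" using False by auto
  qed (rule ri[OF False])
qed

lemma (in coordinate_chart) openin_charts:
  assumes "S \<subseteq> sph K"
  shows "SO \<subseteq> S \<Longrightarrow> openin (top_of_set S) SO" "SN \<subseteq> S \<Longrightarrow> openin (top_of_set S) SN"
proof -
  have "open {v :: complex^'n. norm (v $ e) < 1}"
    by (intro open_Collect_less continuous_intros)
  moreover have "SO \<subseteq> S \<Longrightarrow> SO = S \<inter> {v. norm (v $ e) < 1}" using assms by (auto simp: SO_def)
  ultimately show "SO \<subseteq> S \<Longrightarrow> openin (top_of_set S) SO" by (auto simp: openin_open)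
  have "open ((\<lambda>v :: complex^'n. v $ e) -` \<Omega>)"
    by (intro open_vimage open_\<Omega> continuous_intros)
  moreover have "SN \<subseteq> S \<Longrightarrow> SN = S \<inter> (\<lambda>v. v $ e) -` \<Omega>" using assms by (auto simp: SN_def)
  ultimately show "SN \<subseteq> S \<Longrightarrow> openin (top_of_set S) SN" by (auto simp: openin_open)
qed

text \<open>The group is transitive on the circle of the coordinate \<open>e\<close>, so the whole punctured plane serves as \<open>\<Omega>\<close>, with
  constant angle 0. Then \<open>SO\<close> and \<open>SN\<close> cover the space, which makes the orbit space the mapping cone of the
  projection from the orbits of the link to those of the deletion.\<close>

lemma betti_deletion_contraction:
  fixes G :: "(complex ^ 'n::finite) set"
  assumes G: "torus_group G" "compact G"
    and K: "\<And>A B. A \<in> K \<Longrightarrow> B \<subseteq> A \<Longrightarrow> B \<in> K" "{e} \<in> K"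
    and full: "\<And>z. norm z = 1 \<Longrightarrow> \<exists>g\<in>G. g $ e = z"
    and b: "has_reduced_betti (orbit_top G (sph (del K e))) i b"
    and c: "has_reduced_betti (orbit_top (stab G e) (sph (lnk K e))) (i - 1) c"
    and z: "has_reduced_betti (orbit_top (stab G e) (sph (lnk K e))) i 0 \<or> has_reduced_betti (orbit_top G (sph (del K e))) i 0"
    and z': "has_reduced_betti (orbit_top (stab G e) (sph (lnk K e))) (i - 1) 0 \<or> has_reduced_betti (orbit_top G (sph (del K e))) (i - 1) 0"
  shows "has_reduced_betti (orbit_top G (sph K)) i (b + c)"
proof -
  interpret torus_group G by fact
  interpret coordinate_chart G K e "- {0}" "\<lambda>_. 0" "{0}" 0
  proof unfold_locales
    show "\<exists>g\<in>G. g $ e * cis 0 = sgn z" if "z \<in> - {0}" for z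
      using full[of "sgn z"] that by (simp add: norm_sgn)
    show "g $ e * z \<in> - {0} \<and> (0::real) = 0" if "z \<in> - {0}" "g \<in> G" for z g
    proof -
      have "g $ e \<noteq> 0" using norm_comp[OF that(2), of e] by (metis norm_zero zero_neq_one)
      then show ?thesis using that by simp
    qed
  qed (use G K in \<open>auto simp: continuous_on_const\<close>)
  have U: "sph K = SO \<union> SN"
  proof
    show "sph K \<subseteq> SO \<union> SN"
    proof
      fix v assume v: "v \<in> sph K"
      show "v \<in> SO \<union> SN" using v by (cases "v $ e = 0") (auto simp: SO_def SN_def)
    qed
  qed (auto simp: SO_def SN_def)
  have ne: "SN \<noteq> {}"
  proof -
    have "axis e 1 \<in> SN" using K by (auto simp: SN_def sph_def supp_def axis_nth' norm_axis')
    then show ?thesis by blast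
  qed
  have op: "openin (top_of_set (SO \<union> SN)) SO" "openin (top_of_set (SO \<union> SN)) SN"
    using U by (auto intro!: openin_charts)
  have tr: "has_reduced_betti XO j k" if "has_reduced_betti Y j k" for j k
    using has_reduced_betti_homotopy_equivalent[OF _ that] XO_equiv homotopy_equivalent_space_sym by blast
  have tr': "has_reduced_betti XON j k" if "has_reduced_betti W j k" for j k
    using has_reduced_betti_homotopy_equivalent[OF _ that] XON_equiv homotopy_equivalent_space_sym by blast
  show ?thesis
    unfolding U
    by (rule orbit_betti_sum[OF invariant_SO invariant_SN op contractible_XN ne])
      (use b c z z' tr tr' in blast)+
qed

text \<open>The phase of the coordinate \<open>e\<close> can be changed without moving the other coordinates in \<open>E\<close>. So every orbit
  contains a vector whose coordinate \<open>e\<close> is real and nonnegative, and from there a straight line, projected to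
  the sphere, leads to \<open>axis e 1\<close> without passing through zero.\<close>

lemma contractible_coloop:
  fixes G :: "(complex ^ 'n::finite) set"
  assumes G: "torus_group G" and e: "e \<in> E"
    and rot: "\<And>z. norm z = 1 \<Longrightarrow> \<exists>g\<in>G. g $ e = z \<and> (\<forall>j\<in>E - {e}. g $ j = 1)"
  shows "contractible_space (orbit_top G (sph (Pow E)))" "sph (Pow E) \<noteq> {}"
proof -
  interpret torus_group G by fact
  let ?S = "sph (Pow E)"
  have ax: "axis e 1 \<in> ?S" using e by (auto simp: sph_def supp_def axis_nth' norm_axis')
  then show "?S \<noteq> {}" by blast
  \<comment> \<open>the coordinate \<open>e\<close> is replaced by its modulus, which does not change the orbit\<close>
  let ?r = "\<lambda>t v. (1 - t) * norm (v $ e) + t"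
  let ?q = "\<lambda>t v. (1 - t) *\<^sub>R rest e v + axis e (of_real (?r t v))"
  let ?h = "\<lambda>t v. inverse (norm (?q t v)) *\<^sub>R ?q t v"
  have SD: "norm v = 1" "\<And>j. j \<notin> E \<Longrightarrow> v $ j = 0" if "v \<in> ?S" for v
    using that by (auto simp: sph_def supp_def)
  have r0: "?r t v \<ge> 0" if "t \<in> {0..1}" for t v using that by simp
  have q0: "norm (?q t v) > 0" if t: "t \<in> {0..1}" and v: "v \<in> ?S" for t v
  proof (rule ccontr)
    assume "\<not> norm (?q t v) > 0"
    then have 0: "?q t v = 0" by simp
    have "?q t v $ e = of_real (?r t v)" by (simp add: axis_nth')
    then have "?r t v = 0" using 0 by (metis of_real_eq_0_iff zero_index)
    moreover have "(1 - t) * norm (v $ e) \<ge> 0" "t \<ge> 0" using t by auto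
    ultimately have "t = 0" by linarith
    then have "v $ e = 0" using \<open>?r t v = 0\<close> by simp
    have "?q t v = rest e v" using \<open>t = 0\<close> \<open>v $ e = 0\<close> by (simp add: axis_def zero_vec_def[symmetric])
    then have "rest e v = 0" using 0 by simp
    then show False using norm_split[of v e] SD(1)[OF v] \<open>v $ e = 0\<close> by simp
  qed
  have "homotopic_with (\<lambda>_. True) (orbit_top G ?S) (orbit_top G ?S) id (\<lambda>_. orb G (axis e 1))"
  proof (rule homotopic_orbit_map[OF torus_group_axioms torus_group_axioms])
    show "continuous_on ({0..1} \<times> ?S) (\<lambda>(t, v). ?h t v)"
      unfolding case_prod_beta using q0 by (intro continuous_intros) force
    fix t :: real and v :: "complex ^ 'n" assume t: "t \<in> {0..1}" and v: "v \<in> ?S"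
    have "supp (?h t v) \<subseteq> E"
      using SD(2)[OF v] e by (auto simp: supp_def axis_nth' split: if_splits)
    moreover have "norm (?h t v) = 1" using q0[OF t v] by simp
    ultimately show "?h t v \<in> ?S" by (simp add: sph_def)
    fix g assume g: "g \<in> G"
    obtain h where h: "h \<in> G" "h * g = 1" using inv_ex[OF g] by metis
    obtain k where k: "k \<in> G" "k $ e = h $ e" "\<forall>j\<in>E - {e}. k $ j = 1"
      using rot[of "h $ e"] h by auto
    have ke: "k $ e * g $ e = 1" using k(2) h(2) by (metis one_index vector_mult_component)
    have "(k * g) * ?q t v = ?q t (g * v)"
    proof -
      have "((k * g) * ?q t v) $ j = ?q t (g * v) $ j" for j
      proof (cases "j = e")
        case True
        then show ?thesis using ke g by (simp add: axis_nth' norm_mult)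
      next
        case False
        then show ?thesis using k(3) SD(2)[OF v] by (cases "j \<in> E") (auto simp: axis_nth')
      qed
      then show ?thesis by (simp add: vec_eq_iff)
    qed
    moreover have "norm ((k * g) * ?q t v) = norm (?q t v)" using k g by (intro norm_mult_vec) simp
    ultimately have "?h t (g * v) = (k * g) * ?h t v" by (simp only: scaleR_mult_vec)
    then show "orb G (?h t (g * v)) = orb G (?h t v)" using k g by (simp only: orb_mult mult_mem)
  next
    fix v :: "complex ^ 'n" assume v: "v \<in> ?S"
    define z where "z = (if v $ e = 0 then 1 else cnj (sgn (v $ e)))"
    have z: "norm z = 1" "z * v $ e = of_real (norm (v $ e))"
    proof -
      show "norm z = 1" by (simp add: z_def norm_sgn)
      show "z * v $ e = of_real (norm (v $ e))"
      proof (cases "v $ e = 0")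
        case False
        have "cnj (sgn (v $ e)) * v $ e = (v $ e * cnj (v $ e)) / of_real (norm (v $ e))"
          by (simp add: sgn_eq mult.commute)
        also have "\<dots> = of_real (norm (v $ e))"
          using False by (simp flip: complex_norm_square) (simp add: power2_eq_square)
        finally show ?thesis using False by (simp add: z_def)
      qed (simp add: z_def)
    qed
    obtain k where k: "k \<in> G" "k $ e = z" "\<forall>j\<in>E - {e}. k $ j = 1" using rot[OF z(1)] by auto
    have "?q 0 v $ j = (k * v) $ j" for j
      using k z(2) SD(2)[OF v] by (cases "j = e"; cases "j \<in> E") (auto simp: axis_nth')
    then have "?q 0 v = k * v" by (simp add: vec_eq_iff)
    moreover have "norm (k * v) = 1" using k SD(1)[OF v] by simp
    ultimately have "?h 0 v = k * v" by simp
    then show "id (orb G v) = orb G (?h 0 v)" using k by (simp add: orb_mult)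
    have "?q 1 v = axis e 1" by (simp add: vec_eq_iff axis_nth')
    then show "orb G (axis e 1) = orb G (?h 1 v)" by (simp add: norm_axis')
  qed
  then show "contractible_space (orbit_top G ?S)" unfolding contractible_space_def by blast
qed

section \<open>The local degree of the orbit projection\<close>

lemma hom_finprod:
  assumes "comm_group G" "comm_group H" "h \<in> hom G H" "f \<in> A \<rightarrow> carrier G"
  shows "h (finprod G f A) = finprod H (\<lambda>a. h (f a)) A"
proof -
  interpret G: comm_group G by fact
  interpret H: comm_group H by fact
  show ?thesis
    using assms(4)
  proof (induction A rule: infinite_finite_induct)
    case (insert x F)
    then have "h (f x) \<in> carrier H" "(\<lambda>a. h (f a)) \<in> F \<rightarrow> carrier H" using assms(3) by (auto simp: hom_def)
    then show ?case using insert assms(3) by (simp add: hom_mult Pi_iff)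
  qed (simp_all add: hom_one[OF assms(3)])
qed

lemma finite_vec_set:
  assumes "\<And>j. finite (F j)"
  shows "finite {v :: 'a ^ 'n::finite. \<forall>j. v $ j \<in> F j}"
proof -
  have "{v :: 'a ^ 'n. \<forall>j. v $ j \<in> F j} = vec_lambda ` (PiE UNIV F)"
  proof
    show "{v :: 'a ^ 'n. \<forall>j. v $ j \<in> F j} \<subseteq> vec_lambda ` (PiE UNIV F)"
    proof
      fix v :: "'a ^ 'n" assume "v \<in> {v. \<forall>j. v $ j \<in> F j}"
      then show "v \<in> vec_lambda ` (PiE UNIV F)" by (intro image_eqI[of _ _ "vec_nth v"]) auto
    qed
  qed auto
  then show ?thesis using assms by (simp add: finite_PiE)
qed

lemma excision_point:
  assumes "openin T B" "q \<in> B" "closedin T {q}"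
  shows "hom_induced p (subtopology T B) (B - {q}) T (topspace T - {q}) id
    \<in> iso (relative_homology_group p (subtopology T B) (B - {q})) (relative_homology_group p T (topspace T - {q}))"
proof -
  let ?K = "topspace T - B"
  have B: "B \<subseteq> topspace T" using assms(1) openin_subset by blast
  have "T closure_of ?K = ?K" using assms(1) by (intro closure_of_closedin) auto
  moreover have "T interior_of (topspace T - {q}) = topspace T - {q}"
    using assms(3) by (intro interior_of_openin) auto
  ultimately have "T closure_of ?K \<subseteq> T interior_of (topspace T - {q})" using assms(2) by auto
  moreover have "topspace T - ?K = B" "topspace T - {q} - ?K = B - {q}" using B by auto
  ultimately show ?thesis
    using homology_excision_axiom[of T ?K "topspace T - {q}" "topspace T" p]
    by (simp only: subtopology_topspace) blast
qed

text \<open>By excision a class relative to the complement of finitely many points is a sum of classes near these points.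
  In the induction step, subtracting from \<open>c\<close> a class near \<open>q\<close> with the same image relative to the complement of
  \<open>q\<close> leaves a class that comes from the space without \<open>q\<close>.\<close>

lemma relative_homology_finite_decomposition:
  fixes T :: "'a topology"
  assumes "finite P"
    and "\<And>q. q \<in> P \<Longrightarrow> openin T (B q) \<and> q \<in> B q \<and> closedin T {q}"
    and "\<And>q r. q \<in> P \<Longrightarrow> r \<in> P \<Longrightarrow> q \<noteq> r \<Longrightarrow> B q \<inter> B r = {}"
    and "c \<in> carrier (relative_homology_group p T (topspace T - P))"
  shows "\<exists>a. (\<forall>q\<in>P. a q \<in> carrier (relative_homology_group p (subtopology T (B q)) (B q - {q}))) \<and>
    c = finprod (relative_homology_group p T (topspace T - P))
      (\<lambda>q. hom_induced p (subtopology T (B q)) (B q - {q}) T (topspace T - P) id (a q)) P"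
  using assms
proof (induction P arbitrary: T c rule: finite_induct)
  case empty
  have "trivial_group (relative_homology_group p T (topspace T - {}))"
    using trivial_relative_homology_group_topspace by simp
  note tr = this
  interpret H: comm_group "relative_homology_group p T (topspace T)" by simp
  show ?case using tr empty.prems(3) by (simp add: trivial_group_def)
next
  case (insert q P)
  let ?H = "relative_homology_group p T (topspace T - insert q P)"
  let ?Hq = "relative_homology_group p T (topspace T - {q})"
  let ?HB = "\<lambda>r. relative_homology_group p (subtopology T (B r)) (B r - {r})"
  let ?i = "\<lambda>r. hom_induced p (subtopology T (B r)) (B r - {r}) T (topspace T - insert q P) id"
  let ?j = "hom_induced p T (topspace T - insert q P) T (topspace T - {q}) id"
  let ?T = "subtopology T (topspace T - {q})"
  let ?k = "hom_induced p ?T (topspace T - insert q P) T (topspace T - insert q P) id"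
  let ?H' = "relative_homology_group p ?T (topspace T - insert q P)"
  interpret H: comm_group ?H by simp
  have q: "openin T (B q)" "q \<in> B q" "closedin T {q}" using insert.prems(1)[of q] by auto
  have Bsub: "r \<in> insert q P \<Longrightarrow> B r \<subseteq> topspace T" for r using insert.prems(1) openin_subset by blast
  have disj: "r \<in> insert q P \<Longrightarrow> r' \<in> insert q P \<Longrightarrow> r \<noteq> r' \<Longrightarrow> r' \<notin> B r" for r r'
    using insert.prems(1,2) by blast
  have ex: "hom_induced p (subtopology T (B q)) (B q - {q}) T (topspace T - {q}) id \<in> iso (?HB q) ?Hq"
    by (rule excision_point[OF q])
  have cB: "continuous_map (subtopology T (B r)) T id" for r
    by (simp add: continuous_map_from_subtopology)
  have BP: "id \<in> (B r - {r}) \<rightarrow> topspace T - insert q P" if "r \<in> insert q P" for r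
  proof -
    have "x \<notin> insert q P" if "x \<in> B r" "x \<noteq> r" for x
      using disj[of r x] \<open>r \<in> insert q P\<close> that by auto
    then show ?thesis using Bsub[OF that] by (simp add: Pi_iff) blast
  qed
  have "?j c \<in> carrier ?Hq" by (rule hom_induced_carrier)
  then obtain aq where aq: "aq \<in> carrier (?HB q)"
    "?j c = hom_induced p (subtopology T (B q)) (B q - {q}) T (topspace T - {q}) id aq"
    using ex by (auto simp: iso_def bij_betw_def)
  have "?j (?i q aq) = ?j c"
    unfolding aq(2) by (subst hom_induced_compose') (use cB BP[of q] in auto)
  define c' where "c' = c \<otimes>\<^bsub>?H\<^esub> inv\<^bsub>?H\<^esub> ?i q aq"
  have iq: "?i q aq \<in> carrier ?H" by (rule hom_induced_carrier)
  have c: "c \<in> carrier ?H" by fact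
  interpret j: group_hom ?H ?Hq ?j
    by (simp add: group_hom_def group_hom_axioms_def hom_induced_hom)
  have c': "c' \<in> kernel ?H ?Hq ?j"
    using c iq \<open>?j (?i q aq) = ?j c\<close> by (simp add: c'_def kernel_def)
  have "exact_seq ([?Hq, ?H, ?H'], [?j, ?k])"
    by (rule homology_exactness_triple_3) auto
  then obtain d where d: "d \<in> carrier ?H'" "c' = ?k d" using c' by auto
  have tT: "topspace ?T - P = topspace T - insert q P" by auto
  have subT: "subtopology ?T (B r) = subtopology T (B r)" if "r \<in> P" for r
  proof -
    have "B r \<subseteq> topspace T - {q}" using that Bsub[of r] disj[of r q] insert.hyps by auto
    then show ?thesis by (simp add: subtopology_subtopology inf.absorb2)
  qed
  have "\<exists>a. (\<forall>r\<in>P. a r \<in> carrier (relative_homology_group p (subtopology ?T (B r)) (B r - {r}))) \<and>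
    d = finprod (relative_homology_group p ?T (topspace ?T - P))
      (\<lambda>r. hom_induced p (subtopology ?T (B r)) (B r - {r}) ?T (topspace ?T - P) id (a r)) P"
  proof (rule insert.IH)
    fix r assume r: "r \<in> P"
    have "B r \<subseteq> topspace T - {q}" using r Bsub[of r] disj[of r q] insert.hyps by auto
    then show "openin ?T (B r) \<and> r \<in> B r \<and> closedin ?T {r}"
      using insert.prems(1)[of r] r by (auto simp: openin_subtopology closedin_subtopology)
  qed (use insert.prems(2) d tT in auto)
  then obtain a where a: "\<And>r. r \<in> P \<Longrightarrow> a r \<in> carrier (?HB r)"
    "d = finprod ?H' (\<lambda>r. hom_induced p (subtopology ?T (B r)) (B r - {r}) ?T (topspace T - insert q P) id (a r)) P"
    unfolding tT using subT by (metis (no_types, lifting))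
  have "c' = finprod ?H (\<lambda>r. ?k (hom_induced p (subtopology ?T (B r)) (B r - {r}) ?T (topspace T - insert q P) id (a r))) P"
    unfolding d(2) a(2) by (rule hom_finprod) (auto simp: hom_induced_hom hom_induced_carrier)
  also have "\<dots> = finprod ?H (\<lambda>r. ?i r (a r)) P"
  proof (rule H.finprod_cong')
    fix r assume r: "r \<in> P"
    have Br: "B r \<subseteq> topspace T - {q}" using r Bsub[of r] disj[of r q] insert.hyps by auto
    have "continuous_map (subtopology ?T (B r)) ?T id" by (simp add: continuous_map_from_subtopology)
    then show "?k (hom_induced p (subtopology ?T (B r)) (B r - {r}) ?T (topspace T - insert q P) id (a r)) = ?i r (a r)"
      using BP[of r] r by (subst hom_induced_compose') (auto simp: subT[OF r] continuous_map_from_subtopology)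
  qed (auto simp: hom_induced_carrier)
  finally have c'': "c' = finprod ?H (\<lambda>r. ?i r (a r)) P" .
  have "c = ?i q aq \<otimes>\<^bsub>?H\<^esub> c'"
    unfolding c'_def using c iq by (metis H.inv_closed H.inv_solve_left H.m_closed H.m_comm)
  also have "\<dots> = finprod ?H (\<lambda>r. ?i r ((a(q := aq)) r)) (insert q P)"
  proof -
    have "finprod ?H (\<lambda>r. ?i r ((a(q := aq)) r)) (insert q P)
      = ?i q ((a(q := aq)) q) \<otimes>\<^bsub>?H\<^esub> finprod ?H (\<lambda>r. ?i r ((a(q := aq)) r)) P"
      using insert.hyps by (intro H.finprod_insert) (auto simp: hom_induced_carrier)
    also have "finprod ?H (\<lambda>r. ?i r ((a(q := aq)) r)) P = c'"
      unfolding c'' using insert.hyps by (intro H.finprod_cong') (auto simp: hom_induced_carrier)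
    finally show ?thesis by (simp add: id_def)
  qed
  finally have "c = finprod ?H (\<lambda>r. ?i r ((a(q := aq)) r)) (insert q P)" .
  moreover have "\<forall>r\<in>insert q P. (a(q := aq)) r \<in> carrier (?HB r)" using a(1) aq(1) by auto
  ultimately show ?case by blast
qed

text \<open>Every point other than \<open>q\<close> moves along a great circle to \<open>- q\<close>.\<close>

lemma contractible_punctured_sphere:
  assumes "q \<in> (sph (Pow L) :: (complex ^ 'n::finite) set)"
  shows "contractible_space (top_of_set (sph (Pow L) - {q}))" "- q \<in> sph (Pow L) - {q}"
proof -
  let ?S = "sph (Pow L) :: (complex ^ 'n) set"
  have q: "norm q = 1" "supp q \<subseteq> L" using assms by (auto simp: sph_def)
  have "- q \<noteq> q"
  proof
    assume "- q = q"
    then have "q + q = 0" by (metis add.right_inverse)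
    then have "2 *\<^sub>R q = 0" by (simp add: scaleR_2)
    then show False using q by simp
  qed
  then show mq: "- q \<in> ?S - {q}" using q by (auto simp: sph_def supp_def)
  let ?u = "\<lambda>p. (1 - fst p) *\<^sub>R snd p - fst p *\<^sub>R q"
  let ?h = "\<lambda>p. inverse (norm (?u p)) *\<^sub>R ?u p"
  have notpos: "?u (t, v) \<noteq> c *\<^sub>R q" if t: "t \<in> {0..1}" and v: "v \<in> ?S - {q}" and c: "c \<ge> 0" for t v c
  proof
    assume "?u (t, v) = c *\<^sub>R q"
    then have e: "(1 - t) *\<^sub>R v = (c + t) *\<^sub>R q" by (simp add: algebra_simps)
    have nv: "norm v = 1" using v by (auto simp: sph_def)
    have "norm ((1 - t) *\<^sub>R v) = norm ((c + t) *\<^sub>R q)" using e by simp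
    then have ct: "1 - t = c + t" using t c nv q by simp
    then have "1 - t \<noteq> 0" using t c by auto
    then have "v = q" using e unfolding ct[symmetric] by simp
    then show False using v by simp
  qed
  have u0: "norm (?u (t, v)) > 0" if "t \<in> {0..1}" "v \<in> ?S - {q}" for t v
    using notpos[OF that, of 0] by simp
  have "homotopic_with (\<lambda>_. True) (top_of_set (?S - {q})) (top_of_set (?S - {q})) id (\<lambda>_. - q)"
    unfolding homotopic_with[where P="\<lambda>_. True", OF refl]
  proof (intro exI[of _ ?h] conjI ballI)
    have "continuous_on ({0..1} \<times> (?S - {q})) ?h"
      using u0 by (intro continuous_intros) force
    moreover have "?h (t, v) \<in> ?S - {q}" if t: "t \<in> {0..1}" and v: "v \<in> ?S - {q}" for t v
    proof -
      have n: "norm (?h (t, v)) = 1" using u0[OF t v] by simp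
      have "?u (t, v) = norm (?u (t, v)) *\<^sub>R ?h (t, v)" using u0[OF t v] by simp
      then have "?h (t, v) \<noteq> q" using notpos[OF t v, of "norm (?u (t, v))"] by (metis norm_ge_zero)
      moreover have "supp (?h (t, v)) \<subseteq> L"
      proof -
        have "supp v \<subseteq> L" using v by (auto simp: sph_def)
        then have "?h (t, v) $ j = 0" if "j \<notin> L" for j
        proof -
          have "v $ j = 0" "q $ j = 0" using \<open>supp v \<subseteq> L\<close> q(2) that by (auto simp: supp_def)
          then show ?thesis by simp
        qed
        then show ?thesis unfolding supp_def by blast
      qed
      ultimately show ?thesis using n by (auto simp: sph_def)
    qed
    ultimately show "continuous_map (prod_topology (top_of_set {0..1}) (top_of_set (?S - {q}))) (top_of_set (?S - {q})) ?h"
      by (auto simp: continuous_map_in_subtopology)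
  qed (auto simp: sph_def q)
  then show "contractible_space (top_of_set (?S - {q}))" unfolding contractible_space_def by blast
qed

text \<open>Multiplying the arguments of the components of \<open>g\<close> by a factor that runs from 0 to 1 joins the identity to \<open>g\<close>
  within the torus.\<close>

lemma torus_element_homotopic_id:
  fixes g :: "complex ^ 'n::finite"
  assumes "g \<in> torus"
  shows "homotopic_with (\<lambda>_. True) (top_of_set (sph K)) (top_of_set (sph K)) (\<lambda>v. g * v) id"
proof -
  let ?h = "\<lambda>p. (\<chi> j. cis (fst p * Arg (g $ j)) * snd p $ j) :: complex ^ 'n"
  have n: "norm (?h (t, v)) = norm v" for t v
    unfolding norm_vec_def by (simp add: norm_mult)
  have s: "supp (?h (t, v)) = supp v" for t v by (auto simp: supp_def)
  have g: "cis (Arg (g $ j)) = g $ j" for j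
  proof -
    have "norm (g $ j) = 1" using assms by (simp add: torus_def)
    then show ?thesis by (metis cis_Arg norm_zero sgn_eq div_by_1 of_real_1 zero_neq_one)
  qed
  have "homotopic_with (\<lambda>_. True) (top_of_set (sph K)) (top_of_set (sph K)) id (\<lambda>v. g * v)"
    unfolding homotopic_with[where P="\<lambda>_. True", OF refl]
  proof (intro exI[of _ ?h] conjI ballI)
    have "continuous_on ({0..1} \<times> sph K) ?h" by (intro continuous_intros)
    then show "continuous_map (prod_topology (top_of_set {0..1}) (top_of_set (sph K))) (top_of_set (sph K)) ?h"
      using n s by (auto simp: continuous_map_in_subtopology sph_def)
  qed (simp_all add: vec_eq_iff g)
  then show ?thesis by (rule homotopic_with_symD)
qed

text \<open>The group acts on the sphere through a finite group. At a point with trivial isotropy in that group the orbit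
  projection is a local homeomorphism. The class \<open>x\<close> gives a local class at every point of its orbit \<open>P\<close>; all of
  them have the same image in the local homology of the orbit space, since the group acts on the sphere by maps homotopic to the
  identity. Thus the image of \<open>x\<close> there is \<open>card P\<close> times the image of one
  local class, and this local class is torsion only if \<open>x\<close> is, because the sphere without a point is
  contractible.\<close>

lemma orbit_projection_reflects_torsion:
  fixes G :: "(complex ^ 'n::finite) set"
  assumes G: "torus_group G" and fin: "\<And>j. j \<in> L \<Longrightarrow> finite ((\<lambda>g. g $ j) ` G)" and L: "L \<noteq> {}"
    and x: "x \<in> carrier (reduced_homology_group p (top_of_set (sph (Pow L))))"
    and tor: "torsion_elt (reduced_homology_group p (orbit_top G (sph (Pow L))))
       (hom_induced p (top_of_set (sph (Pow L))) {} (orbit_top G (sph (Pow L))) {} (orb G) x)"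
  shows "torsion_elt (reduced_homology_group p (top_of_set (sph (Pow L)))) x"
proof -
  interpret torus_group G by fact
  let ?S = "sph (Pow L) :: (complex ^ 'n) set"
  let ?T = "top_of_set ?S"
  let ?X = "orbit_top G ?S"
  have iS: "invariant G ?S" by simp
  have cpi: "continuous_map ?T ?X (orb G)" by (rule quotient_imp_continuous_map[OF quotient_map_orb])
  \<comment> \<open>all coordinates of \<open>q0\<close> in \<open>L\<close> are nonzero, so only elements that act trivially fix it\<close>
  define q0 :: "complex ^ 'n" where "q0 = (\<chi> j. if j \<in> L then of_real (1 / sqrt (card L)) else 0)"
  have cL: "card L > 0" using L by (simp add: card_gt_0_iff)
  have q0S: "q0 \<in> ?S"
  proof -
    have "(norm q0)\<^sup>2 = (\<Sum>j\<in>UNIV. if j \<in> L then 1 / real (card L) else 0)"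
      unfolding norm_vec_sq by (rule sum.cong) (auto simp: q0_def norm_divide power_divide)
    also have "\<dots> = (\<Sum>j\<in>L. 1 / real (card L))"
      by (rule sum.mono_neutral_cong_right) auto
    also have "\<dots> = 1" using L by simp
    finally have "norm q0 = 1" by (metis norm_ge_zero one_power2 power2_eq_iff_nonneg zero_le_one)
    then show ?thesis by (auto simp: sph_def supp_def q0_def split: if_splits)
  qed
  have q0L: "q0 $ j \<noteq> 0" if "j \<in> L" for j using that by (auto simp: q0_def)
  have vL: "v $ j = 0" if "v \<in> ?S" "j \<notin> L" for v j using that by (auto simp: sph_def supp_def)
  have stab: "g * v = v" if "g \<in> G" "g * q0 = q0" "v \<in> ?S" for g v
  proof -
    have "(g * v) $ j = v $ j" for j
    proof (cases "j \<in> L")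
      case True
      have "g $ j * q0 $ j = q0 $ j" using that(2) by (metis vector_mult_component)
      then have "g $ j = 1" using q0L[OF True] by simp
      then show ?thesis by simp
    qed (use vL[OF that(3)] in simp)
    then show ?thesis by (simp add: vec_eq_iff)
  qed
  define P where "P = orb G q0"
  have PS: "P \<subseteq> ?S" unfolding P_def by (rule orb_subset[OF iS q0S])
  have "P \<subseteq> {v. \<forall>j. v $ j \<in> (if j \<in> L then (\<lambda>z. z * q0 $ j) ` ((\<lambda>g. g $ j) ` G) else {0})}"
    using vL PS by (auto simp: P_def orb_def)
  then have finP: "finite P" by (rule finite_subset) (rule finite_vec_set, use fin in simp)
  have q0P: "q0 \<in> P" by (simp add: P_def)
  \<comment> \<open>the balls of radius \<open>\<epsilon>\<close> around the points of the orbit are disjoint, and the group permutes them\<close>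
  obtain \<epsilon> where \<epsilon>: "\<epsilon> > 0" "\<And>q r. q \<in> P \<Longrightarrow> r \<in> P \<Longrightarrow> q \<noteq> r \<Longrightarrow> dist q r \<ge> 2 * \<epsilon>"
  proof -
    let ?D = "(\<lambda>(q, r). dist q r) ` {(q, r). q \<in> P \<and> r \<in> P \<and> q \<noteq> r}"
    have fD: "finite (insert 1 ?D)"
      by (intro finite.insertI finite_imageI finite_subset[OF _ finite_cartesian_product[OF finP finP]]) auto
    define m where "m = Min (insert 1 ?D)"
    have "m > 0" unfolding m_def using fD by (subst Min_gr_iff) auto
    moreover have "m \<le> dist q r" if "q \<in> P" "r \<in> P" "q \<noteq> r" for q r
      unfolding m_def using fD that by (intro Min_le) auto
    ultimately show ?thesis using that[of "m / 2"] by auto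
  qed
  define B where "B = (\<lambda>q. ?S \<inter> ball q \<epsilon>)"
  have opB: "openin ?T (B q)" for q by (auto simp: B_def openin_open_Int)
  have BS: "B q \<subseteq> ?S" for q by (auto simp: B_def)
  have qB: "q \<in> P \<Longrightarrow> q \<in> B q" for q using PS \<epsilon> by (auto simp: B_def)
  have clq: "q \<in> P \<Longrightarrow> closedin ?T {q}" for q
    using PS by (simp add: closed_subset closedin_closed_Int subset_iff)
  have disj: "B q \<inter> B r = {}" if "q \<in> P" "r \<in> P" "q \<noteq> r" for q r
  proof (rule ccontr)
    assume "B q \<inter> B r \<noteq> {}"
    then obtain v where "dist q v < \<epsilon>" "dist r v < \<epsilon>" by (auto simp: B_def)
    then have "dist q r < 2 * \<epsilon>" using dist_triangle2[of q r v] by linarith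
    then show False using \<epsilon>(2)[OF that] by simp
  qed
  have gB: "g * v \<in> B (g * q)" if "g \<in> G" "v \<in> B q" for g v q
  proof -
    have "g * q - g * v = g * (q - v)" by (simp add: vec_eq_iff algebra_simps)
    then have "dist (g * q) (g * v) = dist q v" using that by (simp add: dist_norm)
    then show ?thesis using that iS by (auto simp: B_def invariant_def)
  qed
  let ?x0 = "orb G q0"
  have fib: "orb G v = ?x0 \<longleftrightarrow> v \<in> P" for v
    unfolding P_def using mem_orb_imp_eq orb_self by metis
  have clx0: "closedin ?X {?x0}"
  proof -
    have "closedin ?T P" using finP PS by (simp add: finite_imp_closed closed_subset)
    then have "openin ?T (?S - P)" by (simp add: openin_diff)
    moreover have "{v \<in> ?S. orb G v \<in> orb G ` ?S - {?x0}} = ?S - P" using fib by auto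
    ultimately have "openin ?X (topspace ?X - {?x0})" by (auto simp: openin_orbit_top)
    then show ?thesis using q0S by (simp add: closedin_def)
  qed
  let ?A = "topspace ?T - P"
  let ?D = "topspace ?X - {?x0}"
  let ?HT = "relative_homology_group p ?T ?A"
  let ?HX = "relative_homology_group p ?X ?D"
  let ?Hq = "\<lambda>q. relative_homology_group p ?T (topspace ?T - {q})"
  let ?HB = "\<lambda>q. relative_homology_group p (subtopology ?T (B q)) (B q - {q})"
  let ?i = "\<lambda>q. hom_induced p (subtopology ?T (B q)) (B q - {q}) ?T ?A id"
  let ?e = "\<lambda>q. hom_induced p (subtopology ?T (B q)) (B q - {q}) ?T (topspace ?T - {q}) id"
  let ?pi = "hom_induced p ?T ?A ?X ?D (orb G)"
  let ?piB = "hom_induced p (subtopology ?T (B q0)) (B q0 - {q0}) ?X ?D (orb G)"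
  interpret HX: comm_group ?HX by simp
  interpret HT: comm_group ?HT by simp
  have cB: "continuous_map (subtopology ?T (B r)) ?T id" for r by (simp add: continuous_map_from_subtopology)
  have piA: "orb G \<in> ?A \<rightarrow> ?D" using fib by auto
  have BA: "id \<in> (B q - {q}) \<rightarrow> ?A" if "q \<in> P" for q
    using disj[OF that] qB BS[of q] by fastforce
  have xH: "x \<in> carrier (homology_group p ?T)" using x carrier_reduced_homology_group_subset by blast
  have ex: "?e q \<in> iso (?HB q) (?Hq q)" if "q \<in> P" for q
    using that by (intro excision_point opB qB clq)
  let ?c = "hom_induced p ?T {} ?T ?A id x"
  have "?c \<in> carrier ?HT" by (rule hom_induced_carrier)
  from relative_homology_finite_decomposition[OF finP _ _ this, of B]
  obtain a where a: "\<And>q. q \<in> P \<Longrightarrow> a q \<in> carrier (?HB q)" "?c = finprod ?HT (\<lambda>q. ?i q (a q)) P"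
    using opB qB clq disj by blast
  have ea: "?e q (a q) = hom_induced p ?T {} ?T (topspace ?T - {q}) id x" if q: "q \<in> P" for q
  proof -
    let ?j = "hom_induced p ?T ?A ?T (topspace ?T - {q}) id"
    have Aq: "id \<in> ?A \<rightarrow> topspace ?T - {q}" using q by auto
    interpret Hq: comm_group "?Hq q" by simp
    have "hom_induced p ?T {} ?T (topspace ?T - {q}) id x = ?j ?c"
      using Aq by (subst hom_induced_compose') auto
    also have "\<dots> = finprod (?Hq q) (\<lambda>r. ?j (?i r (a r))) P"
      unfolding a(2) by (rule hom_finprod) (auto simp: hom_induced_hom hom_induced_carrier)
    also have "\<dots> = finprod (?Hq q) (\<lambda>r. if r = q then ?e q (a q) else \<one>\<^bsub>?Hq q\<^esub>) P"
    proof (rule Hq.finprod_cong')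
      fix r assume r: "r \<in> P"
      have j: "?j (?i r (a r)) = hom_induced p (subtopology ?T (B r)) (B r - {r}) ?T (topspace ?T - {q}) id (a r)"
        using Aq BA[OF r] cB by (subst hom_induced_compose') auto
      show "?j (?i r (a r)) = (if r = q then ?e q (a q) else \<one>\<^bsub>?Hq q\<^esub>)"
      proof (cases "r = q")
        case False
        let ?V = "subtopology ?T (B r)"
        have Bq: "B r \<subseteq> topspace ?T - {q}" using BS[of r] disj[OF r q False] qB[OF q] by auto
        have tV: "topspace ?V = B r" using BS[of r] by auto
        have "hom_induced p ?V (B r - {r}) ?T (topspace ?T - {q}) id (a r)
          = hom_induced p ?V (B r) ?T (topspace ?T - {q}) id (hom_induced p ?V (B r - {r}) ?V (B r) id (a r))"
          using Bq cB by (subst hom_induced_compose') auto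
        also have "hom_induced p ?V (B r - {r}) ?V (B r) id (a r) = \<one>\<^bsub>relative_homology_group p ?V (B r)\<^esub>"
          using trivial_relative_homology_group_topspace[of p ?V] hom_induced_carrier[of p ?V _ ?V "B r"]
          unfolding tV by (auto simp: trivial_group_def)
        also have "hom_induced p ?V (B r) ?T (topspace ?T - {q}) id \<dots> = \<one>\<^bsub>?Hq q\<^esub>"
          by (rule hom_one[OF hom_induced_hom]) simp_all
        finally have "hom_induced p ?V (B r - {r}) ?T (topspace ?T - {q}) id (a r) = \<one>\<^bsub>?Hq q\<^esub>" .
        then show ?thesis using False by (simp only: j if_False)
      qed (use j in simp)
    qed (use hom_induced_carrier Hq.one_closed in auto)
    also have "\<dots> = ?e q (a q)"
      using q finP hom_induced_carrier by (subst Hq.finprod_singleton_swap) auto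
    finally show ?thesis by simp
  qed
  \<comment> \<open>the local class at \<open>g * q0\<close> is the translate by \<open>g\<close> of the local class at \<open>q0\<close>\<close>
  have pia: "?pi (?i q (a q)) = ?piB (a q0)" if q: "q \<in> P" for q
  proof -
    obtain g where g: "g \<in> G" "q = g * q0" using q by (auto simp: P_def orb_def)
    let ?g = "\<lambda>v. g * v"
    let ?gB = "hom_induced p (subtopology ?T (B q0)) (B q0 - {q0}) (subtopology ?T (B q)) (B q - {q}) ?g"
    obtain h where h: "h \<in> G" "h * g = 1" using inv_ex[OF g(1)] by metis
    have inj: "v = w" if "g * v = g * w" for v w
    proof -
      have "h * (g * v) = h * (g * w)" using that by simp
      then show ?thesis using h(2) by (simp flip: mult.assoc)
    qed
    have cg: "continuous_map ?T ?T ?g"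
      using iS g by (auto simp: continuous_map_in_subtopology invariant_def intro!: continuous_intros)
    have cgB: "continuous_map (subtopology ?T (B q0)) (subtopology ?T (B q)) ?g"
      using gB[OF g(1)] g(2) continuous_map_from_subtopology[OF cg]
      by (auto simp: continuous_map_in_subtopology)
    have gBm: "?g \<in> (B q0 - {q0}) \<rightarrow> B q - {q}" using gB[OF g(1)] g(2) inj by auto
    have gq: "?g \<in> (topspace ?T - {q0}) \<rightarrow> topspace ?T - {q}"
      using inj g iS by (auto simp: invariant_def)
    have "?e q (?gB (a q0)) = hom_induced p (subtopology ?T (B q0)) (B q0 - {q0}) ?T (topspace ?T - {q}) (id \<circ> ?g) (a q0)"
      using cgB gBm cB BS[of q] by (subst hom_induced_compose') auto
    also have "\<dots> = hom_induced p (subtopology ?T (B q0)) (B q0 - {q0}) ?T (topspace ?T - {q}) (?g \<circ> id) (a q0)"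
      by (simp add: comp_def)
    also have "\<dots> = hom_induced p ?T (topspace ?T - {q0}) ?T (topspace ?T - {q}) ?g (?e q0 (a q0))"
      using cg gq cB BS[of q0] by (subst hom_induced_compose') auto
    also have "\<dots> = hom_induced p ?T {} ?T (topspace ?T - {q}) (?g \<circ> id) x"
      unfolding ea[OF q0P] using cg gq by (subst hom_induced_compose') auto
    also have "\<dots> = hom_induced p ?T {} ?T (topspace ?T - {q}) (id \<circ> ?g) x" by (simp add: comp_def)
    also have "\<dots> = hom_induced p ?T {} ?T (topspace ?T - {q}) id (hom_induced p ?T {} ?T {} ?g x)"
      using cg by (subst hom_induced_compose') auto
    also have "hom_induced p ?T {} ?T {} ?g x = x"
    proof -
      have "g \<in> torus" using tg g by (auto simp: torus_subgroup_def)
      from homology_homotopy_empty[OF torus_element_homotopic_id[OF this, of "Pow L"]]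
      show ?thesis using hom_induced_id[OF xH] by metis
    qed
    finally have "?e q (?gB (a q0)) = ?e q (a q)" unfolding ea[OF q] .
    moreover have "?gB (a q0) \<in> carrier (?HB q)" by (rule hom_induced_carrier)
    ultimately have "a q = ?gB (a q0)"
      using ex[OF q] a(1)[OF q] by (auto simp: iso_def bij_betw_def dest: inj_onD)
    then have "?pi (?i q (a q)) = ?pi (?i q (?gB (a q0)))" by simp
    also have "\<dots> = hom_induced p (subtopology ?T (B q)) (B q - {q}) ?X ?D (orb G) (?gB (a q0))"
      using cpi piA BA[OF q] cB by (subst hom_induced_compose') auto
    also have "\<dots> = hom_induced p (subtopology ?T (B q0)) (B q0 - {q0}) ?X ?D (orb G \<circ> ?g) (a q0)"
    proof (rule hom_induced_compose'[OF cgB gBm continuous_map_from_subtopology[OF cpi]])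
      show "orb G \<in> (B q - {q}) \<rightarrow> ?D"
      proof
        fix v assume "v \<in> B q - {q}"
        then have "v \<in> ?A" using funcset_mem[OF BA[OF q], of v] by simp
        then show "orb G v \<in> ?D" by (rule funcset_mem[OF piA])
      qed
    qed
    also have "\<dots> = ?piB (a q0)"
      by (rule fun_cong[OF hom_induced_eq]) (simp add: orb_mult g)
    finally show ?thesis .
  qed
  have N: "?pi ?c = ?piB (a q0) [^]\<^bsub>?HX\<^esub> int (card P)"
  proof -
    have "?pi ?c = finprod ?HX (\<lambda>q. ?pi (?i q (a q))) P"
      unfolding a(2) by (rule hom_finprod) (auto simp: hom_induced_hom hom_induced_carrier)
    also have "\<dots> = finprod ?HX (\<lambda>q. ?piB (a q0)) P"
      using pia hom_induced_carrier by (intro HX.finprod_cong') auto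
    also have "\<dots> = ?piB (a q0) [^]\<^bsub>?HX\<^esub> card P"
      by (rule HX.finprod_const) (rule hom_induced_carrier)
    finally show ?thesis by (simp add: int_pow_int)
  qed
  let ?pix = "hom_induced p ?T {} ?X {} (orb G) x"
  have "?pi ?c = hom_induced p ?X {} ?X ?D id ?pix"
    using cpi piA by (simp add: hom_induced_compose')
  moreover have "torsion_elt ?HX (hom_induced p ?X {} ?X ?D id ?pix)"
  proof -
    have "hom_induced p ?X {} ?X ?D id \<in> hom (reduced_homology_group p ?X) ?HX"
      using homology_exactness_reduced_3[of p ?X ?D] by (simp add: group_hom_def group_hom_axioms_def)
    from torsion_elt_hom[OF _ _ this hom_induced_reduced[OF x] tor] show ?thesis by simp
  qed
  ultimately have tp: "torsion_elt ?HX (?piB (a q0) [^]\<^bsub>?HX\<^esub> int (card P))" using N by simp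
  have "int (card P) \<noteq> 0" using finP q0P by auto
  from HX.torsion_elt_pow[OF hom_induced_carrier tp this]
  have t1: "torsion_elt ?HX (?piB (a q0))" .
  \<comment> \<open>the orbit projection is a homeomorphism from \<open>B q0\<close> to an open set\<close>
  have isoB: "?piB \<in> iso (?HB q0) ?HX"
  proof -
    let ?V = "subtopology ?T (B q0)"
    let ?Y = "subtopology ?X (orb G ` B q0)"
    have opI: "openin ?X (orb G ` B q0)" by (rule open_map_orb[OF iS opB])
    have hm: "homeomorphic_map ?V ?Y (orb G)"
    proof (rule bijective_open_imp_homeomorphic_map)
      show "continuous_map ?V ?Y (orb G)"
        using continuous_map_from_subtopology[OF cpi] by (auto simp: continuous_map_in_subtopology)
      show "open_map ?V ?Y (orb G)"
        unfolding open_map_def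
      proof (intro allI impI)
        fix U assume "openin ?V U"
        then have U: "openin ?T U" "U \<subseteq> B q0"
          using openin_trans_full[OF _ opB] openin_imp_subset by blast+
        from open_map_orb[OF iS U(1)] show "openin ?Y (orb G ` U)"
          using U(2) by (auto simp: openin_subtopology intro!: exI[of _ "orb G ` U"])
      qed
      show "orb G ` topspace ?V = topspace ?Y" using BS[of q0] by auto
      show "inj_on (orb G) (topspace ?V)"
      proof (rule inj_onI)
        fix v w assume vw: "v \<in> topspace ?V" "w \<in> topspace ?V" "orb G v = orb G w"
        then obtain g where g: "g \<in> G" "w = g * v" using orb_eq_iff by auto
        have "w \<in> B (g * q0)" using gB[OF g(1), of v q0] g(2) vw by simp
        moreover have "g * q0 \<in> P" using g by (auto simp: P_def orb_def)
        ultimately have "g * q0 = q0" using disj[of "g * q0" q0] q0P vw(2) by auto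
        then show "v = w" using stab[OF g(1), of v] vw(1) g(2) by simp
      qed
    qed
    have im: "orb G ` (B q0 - {q0}) = orb G ` B q0 - {?x0}"
    proof -
      have "v = q0" if "v \<in> B q0" "orb G v = ?x0" for v
        using fib[of v] that disj[of v q0] qB[of v] q0P by auto
      then show ?thesis by auto
    qed
    have "hom_induced p ?V (B q0 - {q0}) ?Y (orb G ` B q0 - {?x0}) (orb G)
       \<in> iso (?HB q0) (relative_homology_group p ?Y (orb G ` B q0 - {?x0}))"
      by (rule homeomorphic_map_relative_homology_iso[OF hm]) (use BS[of q0] im in auto)
    moreover have "hom_induced p ?Y (orb G ` B q0 - {?x0}) ?X ?D id
       \<in> iso (relative_homology_group p ?Y (orb G ` B q0 - {?x0})) ?HX"
      by (rule excision_point[OF opI _ clx0]) (use qB[OF q0P] in auto)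
    ultimately have "hom_induced p ?Y (orb G ` B q0 - {?x0}) ?X ?D id \<circ> hom_induced p ?V (B q0 - {q0}) ?Y (orb G ` B q0 - {?x0}) (orb G)
      \<in> iso (?HB q0) ?HX" by (rule iso_set_trans)
    also have "hom_induced p ?Y (orb G ` B q0 - {?x0}) ?X ?D id \<circ> hom_induced p ?V (B q0 - {q0}) ?Y (orb G ` B q0 - {?x0}) (orb G)
      = hom_induced p ?V (B q0 - {q0}) ?X ?D (id \<circ> orb G)"
    proof (rule hom_induced_compose[symmetric])
      show "continuous_map ?V ?Y (orb G)" using hm homeomorphic_imp_continuous_map by blast
      show "orb G \<in> (B q0 - {q0}) \<rightarrow> orb G ` B q0 - {?x0}" using im by auto
      show "continuous_map ?Y ?X id" by (simp add: continuous_map_from_subtopology)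
      show "id \<in> (orb G ` B q0 - {?x0}) \<rightarrow> ?D" using BS[of q0] by auto
    qed
    finally show ?thesis by simp
  qed
  have "torsion_elt (?HB q0) (a q0)"
    by (rule torsion_elt_iso[OF _ _ isoB a(1)[OF q0P] t1]) simp_all
  moreover have "?e q0 \<in> hom (?HB q0) (?Hq q0)" by (rule hom_induced_hom)
  ultimately have "torsion_elt (?Hq q0) (?e q0 (a q0))"
    using torsion_elt_hom[of "?HB q0" "?Hq q0"] a(1)[OF q0P] by simp
  then have t2: "torsion_elt (?Hq q0) (hom_induced p ?T {} ?T (topspace ?T - {q0}) id x)"
    using ea[OF q0P] by simp
  have "hom_induced p ?T {} ?T (topspace ?T - {q0}) id \<in> iso (reduced_homology_group p ?T) (?Hq q0)"
  proof (rule iso_reduced_homology_by_contractible)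
    have "subtopology ?T (topspace ?T - {q0}) = top_of_set (?S - {q0})"
      by (simp add: subtopology_subtopology inf.absorb2)
    then show "contractible_space (subtopology ?T (topspace ?T - {q0}))"
      using contractible_punctured_sphere(1)[OF q0S] by simp
    show "topspace ?T \<inter> (topspace ?T - {q0}) \<noteq> {}"
      using contractible_punctured_sphere(2)[OF q0S] by auto
  qed
  from torsion_elt_iso[OF _ _ this x t2] show ?thesis by simp
qed

section \<open>Quotients of spheres by finite groups of diagonal matrices\<close>

text \<open>Multiplication by \<open>z \<in> C\<close> permutes \<open>C\<close>, so it preserves the product of all elements, which it also multiplies by
  \<open>z ^ card C\<close>.\<close>

lemma finite_circle_subgroup:
  fixes C :: "complex set"
  assumes fin: "finite C" and one: "1 \<in> C" and mult: "\<And>z w. z \<in> C \<Longrightarrow> w \<in> C \<Longrightarrow> z * w \<in> C"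
    and norm: "\<And>z. z \<in> C \<Longrightarrow> norm z = 1"
  shows "C = {z. z ^ card C = 1}" "card C > 0"
proof -
  show c: "card C > 0" using fin one by (auto simp: card_gt_0_iff)
  have nz: "z \<noteq> 0" if "z \<in> C" for z using norm[OF that] by auto
  have "z ^ card C = 1" if z: "z \<in> C" for z
  proof -
    have inj: "inj_on (\<lambda>w. z * w) C" using nz[OF z] by (auto simp: inj_on_def)
    then have "(\<lambda>w. z * w) ` C = C" using fin mult z by (intro card_subset_eq) (auto simp: card_image)
    then have "(\<Prod>w\<in>C. w) = (\<Prod>w\<in>(\<lambda>w. z * w) ` C. w)" by simp
    also have "\<dots> = (\<Prod>w\<in>C. z * w)" by (simp add: prod.reindex[OF inj])
    also have "\<dots> = z ^ card C * (\<Prod>w\<in>C. w)" by (simp add: prod.distrib)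
    finally show ?thesis using fin nz by simp
  qed
  then have "C \<subseteq> {z. z ^ card C = 1}" by auto
  moreover have "card {z :: complex. z ^ card C = 1} = card C" using c by (intro card_roots_unity_eq)
  moreover have "finite {z :: complex. z ^ card C = 1}" using finite_roots_unity[of "card C"] c by simp
  ultimately show "C = {z. z ^ card C = 1}" by (metis card_subset_eq)
qed

text \<open>The map \<open>z \<mapsto> z ^ k\<close> is the quotient of the plane by the \<open>k\<close>-th roots of unity. The angle is \<open>1/k\<close> times the
  argument of \<open>z ^ k\<close>, taken between \<open>\<alpha> - pi\<close> and \<open>\<alpha> + pi\<close>; the set \<open>J\<close> restricts this argument further, so that a
  sector is a union of \<open>k\<close> ordinary sectors which the roots of unity permute.\<close>

definition sector_angle :: "nat \<Rightarrow> real \<Rightarrow> complex \<Rightarrow> real" where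
  "sector_angle k \<alpha> z = (Arg (z ^ k * cis (- \<alpha>)) + \<alpha>) / k"

definition sector :: "nat \<Rightarrow> real \<Rightarrow> real set \<Rightarrow> complex set" where
  "sector k \<alpha> J = {z. z ^ k * cis (- \<alpha>) \<notin> \<real>\<^sub>\<le>\<^sub>0 \<and> Arg (z ^ k * cis (- \<alpha>)) + \<alpha> \<in> J}"

lemma continuous_on_sector_base:
  "continuous_on {z. z ^ k * cis (- \<alpha>) \<notin> \<real>\<^sub>\<le>\<^sub>0} (\<lambda>z. Arg (z ^ k * cis (- \<alpha>)))"
  by (intro continuous_intros) auto

text \<open>Two numbers of modulus 1 with the same \<open>k\<close>-th power differ by a root of unity. So the group can turn every number
  in the sector to the representative of its ray that \<open>cis\<close> assigns to the angle.\<close>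

lemma sector_chart:
  fixes G :: "(complex ^ 'n::finite) set"
  assumes G: "torus_group G" "compact G" and K: "\<And>A B. A \<in> K \<Longrightarrow> B \<subseteq> A \<Longrightarrow> B \<in> K"
    and k: "k > 0" and roots: "(\<lambda>g. g $ e) ` G = {z. z ^ k = 1}"
    and J: "open J" "convex J" "J \<subseteq> {\<alpha> - pi <..< \<alpha> + pi}" and t0: "real k * \<theta>0 \<in> J"
  shows "coordinate_chart G K e (sector k \<alpha> J) (sector_angle k \<alpha>) {t. real k * t \<in> J} \<theta>0"
proof -
  interpret torus_group G by fact
  let ?B = "{z::complex. z ^ k * cis (- \<alpha>) \<notin> \<real>\<^sub>\<le>\<^sub>0}"
  have opB: "open ?B"
  proof -
    have "open ((\<lambda>z::complex. z ^ k * cis (- \<alpha>)) -` (- \<real>\<^sub>\<le>\<^sub>0))"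
      by (intro open_vimage continuous_intros) auto
    then show ?thesis by (simp add: vimage_def)
  qed
  have ke: "real k * sector_angle k \<alpha> z = Arg (z ^ k * cis (- \<alpha>)) + \<alpha>" for z
    using k by (simp add: sector_angle_def)
  show ?thesis
  proof unfold_locales
    show "compact G" by fact
    show "B \<in> K" if "A \<in> K" "B \<subseteq> A" for A B using K[OF that] .
    have "open (?B \<inter> (\<lambda>z. Arg (z ^ k * cis (- \<alpha>)) + \<alpha>) -` J)"
    proof (rule continuous_open_preimage[OF _ opB J(1)])
      show "continuous_on ?B (\<lambda>z. Arg (z ^ k * cis (- \<alpha>)) + \<alpha>)"
        by (intro continuous_on_add continuous_on_sector_base continuous_on_const)
    qed
    moreover have "sector k \<alpha> J = ?B \<inter> (\<lambda>z. Arg (z ^ k * cis (- \<alpha>)) + \<alpha>) -` J"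
      by (auto simp: sector_def)
    ultimately show "open (sector k \<alpha> J)" by simp
    show "0 \<notin> sector k \<alpha> J" using k by (simp add: sector_def power_0_left)
    show "continuous_on (sector k \<alpha> J) (sector_angle k \<alpha>)"
      unfolding sector_angle_def
      by (intro continuous_intros) (use k in \<open>auto simp: sector_def\<close>)
    show "sector_angle k \<alpha> z \<in> {t. real k * t \<in> J}" if "z \<in> sector k \<alpha> J" for z
      using that by (simp add: ke sector_def)
    show "convex {t. real k * t \<in> J}"
    proof -
      have "convex ((\<lambda>t. real k * t) -` J)"
        by (rule convex_linear_vimage[OF _ J(2)]) (simp add: linear_iff algebra_simps)
      then show ?thesis by (simp add: vimage_def)
    qed
    show "\<theta>0 \<in> {t. real k * t \<in> J}" using t0 by simp
    fix z assume z: "z \<in> sector k \<alpha> J"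
    show "g $ e * z \<in> sector k \<alpha> J \<and> sector_angle k \<alpha> (g $ e * z) = sector_angle k \<alpha> z" if "g \<in> G" for g
    proof -
      have "(g $ e) ^ k = 1" using that roots by auto
      then have "(g $ e * z) ^ k = z ^ k" by (simp add: power_mult_distrib)
      then show ?thesis using z by (simp add: sector_def sector_angle_def)
    qed
    show "of_real s * z \<in> sector k \<alpha> J \<and> sector_angle k \<alpha> (of_real s * z) = sector_angle k \<alpha> z" if "s > 0" for s
    proof -
      have e: "(of_real s * z) ^ k * cis (- \<alpha>) = of_real (s ^ k) * (z ^ k * cis (- \<alpha>))"
        by (simp add: power_mult_distrib)
      have s: "s ^ k > 0" using that by simp
      have 1: "Arg (of_real (s ^ k) * w) = Arg w" for w using s by (rule Arg_times_of_real)
      have "of_real c * w \<in> \<real>\<^sub>\<le>\<^sub>0 \<longleftrightarrow> w \<in> \<real>\<^sub>\<le>\<^sub>0" if "c > 0" for c and w :: complex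
        using that by (auto simp: complex_nonpos_Reals_iff mult_le_0_iff)
      from this[OF s] have 2: "of_real (s ^ k) * w \<in> \<real>\<^sub>\<le>\<^sub>0 \<longleftrightarrow> w \<in> \<real>\<^sub>\<le>\<^sub>0" for w :: complex .
      show ?thesis using z by (simp add: sector_def sector_angle_def e 1 2 del: of_real_power)
    qed
    show "\<exists>g\<in>G. g $ e * cis (sector_angle k \<alpha> z) = sgn z"
    proof -
      let ?w = "z ^ k * cis (- \<alpha>)"
      have z0: "z \<noteq> 0" using z k by (auto simp: sector_def power_0_left)
      have "cis (sector_angle k \<alpha> z) ^ k = cis (Arg ?w + \<alpha>)"
        by (simp only: Complex.DeMoivre ke)
      also have "\<dots> = sgn ?w * cis \<alpha>" using z0 by (simp add: cis_mult[symmetric] cis_Arg)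
      also have "\<dots> = sgn z ^ k * (cis (- \<alpha>) * cis \<alpha>)" by (simp add: sgn_eq norm_mult norm_power power_divide)
      finally have p: "cis (sector_angle k \<alpha> z) ^ k = sgn z ^ k" by (simp add: cis_mult)
      have "(sgn z / cis (sector_angle k \<alpha> z)) ^ k = 1"
        using z0 by (simp add: power_divide p sgn_zero_iff)
      then have "sgn z / cis (sector_angle k \<alpha> z) \<in> (\<lambda>g. g $ e) ` G" unfolding roots by simp
      then obtain g where "sgn z / cis (sector_angle k \<alpha> z) = g $ e" "g \<in> G" by (rule imageE)
      moreover from this(1) have "g $ e = sgn z / cis (sector_angle k \<alpha> z)" by (rule sym)
      ultimately have "g \<in> G" "g $ e = sgn z / cis (sector_angle k \<alpha> z)" by blast+
      then show ?thesis by (intro bexI[of _ g]) auto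
    qed
  next
    fix t assume t: "t \<in> {t. real k * t \<in> J}"
    have e: "cis t ^ k * cis (- \<alpha>) = cis (real k * t - \<alpha>)" by (simp add: Complex.DeMoivre cis_mult)
    have r: "real k * t - \<alpha> \<in> {-pi<..<pi}" using t J(3) by auto
    then have A: "Arg (cis (real k * t - \<alpha>)) = real k * t - \<alpha>" by (intro Arg_cis) auto
    have "cis (real k * t - \<alpha>) \<notin> \<real>\<^sub>\<le>\<^sub>0"
    proof
      assume "cis (real k * t - \<alpha>) \<in> \<real>\<^sub>\<le>\<^sub>0"
      then have "sin (real k * t - \<alpha>) = 0" "cos (real k * t - \<alpha>) \<le> 0"
        unfolding complex_nonpos_Reals_iff by (simp_all only: cis.sel)
      moreover have "real k * t - \<alpha> = 0"
        by (rule sin_eq_0_pi) (use r calculation(1) in \<open>simp_all only: greaterThanLessThan_iff\<close>)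
      ultimately show False by simp
    qed
    then show "cis t \<in> sector k \<alpha> J \<and> sector_angle k \<alpha> (cis t) = t"
      using t k by (simp add: sector_def sector_angle_def e A)
  qed
qed

lemma orbit_top_trivial_group:
  "top_of_set S homeomorphic_space orbit_top {1 :: complex ^ 'n} S"
proof -
  interpret torus_group "{1 :: complex ^ 'n}" by (rule torus_group_trivial)
  have "inj_on (orb {1 :: complex ^ 'n}) S" by (auto simp: orb_def inj_on_def)
  then have "homeomorphic_map (top_of_set S) (orbit_top {1} S) (orb {1})"
    using quotient_map_orb[of S] by (simp add: homeomorphic_map_def)
  then show ?thesis by (rule homeomorphic_map_imp_homeomorphic_space)
qed

text \<open>Both orbit spaces have rational homology of rank one in degree \<open>m\<close> and none otherwise. A nontorsion class of
  the sphere has a nontorsion image in the second orbit space, and this image passes through the first.\<close>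

lemma rational_iso_orbit_map:
  assumes G: "torus_group G" and H: "torus_group H" and HG: "H \<subseteq> G" and L: "L \<noteq> {}"
    and finG: "\<And>j. j \<in> L \<Longrightarrow> finite ((\<lambda>g. g $ j) ` G)"
    and b: "\<And>i. has_reduced_betti (orbit_top G (sph (Pow L))) i (if i = m then 1 else 0)"
      "\<And>i. has_reduced_betti (orbit_top H (sph (Pow L))) i (if i = m then 1 else 0)"
      "\<And>i. has_reduced_betti (orbit_top {1} (sph (Pow L) :: (complex ^ 'n::finite) set)) i (if i = m then 1 else 0)"
  shows "rational_iso (reduced_homology_group p (orbit_top H (sph (Pow L)))) (reduced_homology_group p (orbit_top G (sph (Pow L))))
    (hom_induced p (orbit_top H (sph (Pow L))) {} (orbit_top G (sph (Pow L))) {} (orbit_map G id))"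
proof -
  let ?S = "sph (Pow L) :: (complex ^ 'n) set"
  let ?W = "orbit_top H ?S" and ?Y = "orbit_top G ?S" and ?T = "top_of_set ?S"
  let ?n = "hom_induced p ?W {} ?Y {} (orbit_map G id)"
  interpret G: torus_group G by fact
  interpret H: torus_group H by fact
  have ne: "?S \<noteq> {}"
  proof -
    obtain e where "e \<in> L" using L by auto
    then have "axis e 1 \<in> ?S" by (auto simp: sph_def supp_def axis_nth' norm_axis')
    then show ?thesis by auto
  qed
  have n: "?n \<in> hom (reduced_homology_group p ?W) (reduced_homology_group p ?Y)" by (rule hom_induced_reduced_hom)
  have rk: "has_rank (reduced_homology_group p ?W) (if p = m then 1 else 0)"
    "has_rank (reduced_homology_group p ?Y) (if p = m then 1 else 0)"
    using b(1)[of p] b(2)[of p] ne by (auto simp: has_reduced_betti_def)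
  show ?thesis
  proof (cases "p = m")
    case False
    then show ?thesis using rk n by (intro torsion_rational_iso) auto
  next
    case True
    have "has_reduced_betti ?T p 1"
      using has_reduced_betti_homotopy_equivalent[of "orbit_top {1} ?S" ?T p 1] b(3)[of p] True
        orbit_top_trivial_group[of ?S] homeomorphic_space_sym homeomorphic_imp_homotopy_equivalent_space by fastforce
    then have "\<not> has_reduced_betti ?T p 0" using has_reduced_betti_unique by fastforce
    then obtain x where x: "x \<in> carrier (reduced_homology_group p ?T)" "\<not> torsion_elt (reduced_homology_group p ?T) x"
      using has_reduced_betti_0_iff[of ?T p] ne by auto
    let ?piG = "hom_induced p ?T {} ?Y {} (orb G)" and ?piH = "hom_induced p ?T {} ?W {} (orb H)"
    have nt: "\<not> torsion_elt (reduced_homology_group p ?Y) (?piG x)"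
      using orbit_projection_reflects_torsion[OF G finG L x(1)] x(2) by blast
    have eqv: "orb G (id (g * v)) = orb G (id v)" if "g \<in> H" for g v
      using that HG by (auto simp: G.orb_mult)
    have cn: "continuous_map ?W ?Y (orbit_map G id)"
      by (rule continuous_map_orbit_map[OF H G]) (use eqv in auto)
    have "?n (?piH x) = hom_induced p ?T {} ?Y {} (orbit_map G id \<circ> orb H) x"
      using cn quotient_imp_continuous_map[OF H.quotient_map_orb] by (subst hom_induced_compose') auto
    also have "\<dots> = ?piG x"
      using eqv by (intro fun_cong[OF hom_induced_eq]) (simp add: orbit_map_orb[OF H])
    finally have "\<not> torsion_elt (reduced_homology_group p ?Y) (?n (?piH x))" using nt by simp
    moreover have "?piH x \<in> carrier (reduced_homology_group p ?W)" by (rule hom_induced_reduced[OF x(1)])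
    ultimately show ?thesis using rk n True by (intro rank_one_rational_iso[where s="?piH x"]) auto
  qed
qed

context coordinate_chart
begin

lemma link_in_iso: "hom_induced p W {} XON {} link_in \<in> iso (reduced_homology_group p W) (reduced_homology_group p XON)"
  by (rule homotopy_equivalence_reduced_homology_group_isomorphism[OF continuous_link_in continuous_link_out link_out_in link_in_out])

lemma retract_iso: "hom_induced p XO {} Y {} (orbit_map G (unit_rest e)) \<in> iso (reduced_homology_group p XO) (reduced_homology_group p Y)"
  by (rule homotopy_equivalence_reduced_homology_group_isomorphism[OF continuous_retract continuous_include include_retract retract_include])

lemma continuous_XON_XO: "continuous_map XON XO id"
proof -
  have "subtopology XO (orb G ` (SO \<inter> SN)) = XON" by (rule subtopology_orbit_top) auto
  then show ?thesis by (metis continuous_map_from_subtopology continuous_map_id)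
qed

text \<open>By \<open>retract_link_in\<close> the inclusion of the intersection into \<open>SO\<close> is, up to homotopy equivalence, the projection
  from \<open>W\<close> to \<open>Y\<close>.\<close>

lemma rational_iso_XON_XO:
  assumes "rational_iso (reduced_homology_group p W) (reduced_homology_group p Y) (hom_induced p W {} Y {} (orbit_map G id))"
  shows "rational_iso (reduced_homology_group p XON) (reduced_homology_group p XO) (hom_induced p XON {} XO {} id)"
proof (rule rational_iso_conjugate[OF _ _ _ _ link_in_iso retract_iso hom_induced_reduced_hom assms])
  fix x
  have "hom_induced p XO {} Y {} (orbit_map G (unit_rest e)) (hom_induced p XON {} XO {} id (hom_induced p W {} XON {} link_in x))
    = hom_induced p XO {} Y {} (orbit_map G (unit_rest e)) (hom_induced p W {} XO {} (id \<circ> link_in) x)"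
    using continuous_XON_XO continuous_link_in by (subst hom_induced_compose'[of W XON]) auto
  also have "\<dots> = hom_induced p W {} Y {} (orbit_map G (unit_rest e) \<circ> (id \<circ> link_in)) x"
    using continuous_map_compose[OF continuous_link_in continuous_XON_XO] continuous_retract
    by (subst hom_induced_compose') auto
  also have "\<dots> = hom_induced p W {} Y {} (orbit_map G id) x"
    by (rule fun_cong[OF hom_induced_eq]) (simp add: retract_link_in del: topspace_orbit_top)
  finally show "hom_induced p XO {} Y {} (orbit_map G (unit_rest e)) (hom_induced p XON {} XO {} id (hom_induced p W {} XON {} link_in x))
    = hom_induced p W {} Y {} (orbit_map G id) x" .
qed simp_all

lemma SN_nonempty: "{e} \<in> K \<Longrightarrow> SN \<noteq> {}"
proof -
  assume "{e} \<in> K"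
  then have "axis e (cis \<theta>0) \<in> SN"
    using sec[OF \<theta>0] by (auto simp: SN_def sph_def supp_def axis_nth' norm_axis')
  then show ?thesis by blast
qed

end

lemma cis_neg_pi: "cis (- pi) = - 1" by (simp add: complex_eq_iff)

lemma sph_empty_support [simp]: "sph {{}} = {}"
proof -
  have "v = 0" if "supp v = {}" for v :: "complex ^ 'n" using that by (simp add: supp_def vec_eq_iff)
  then show ?thesis unfolding sph_def by (metis (mono_tags, lifting) empty_Collect_eq norm_zero singletonD zero_neq_one)
qed

lemma Arg_less_pi: assumes "w \<notin> \<real>\<^sub>\<le>\<^sub>0" shows "Arg w < pi"
proof (rule ccontr)
  assume "\<not> Arg w < pi"
  then have "Arg w = pi" using Arg_bounded[of w] by simp
  then have "w = rcis (norm w) pi" using rcis_cmod_Arg[of w] by simp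
  then have "w = - of_real (norm w)" by (simp add: rcis_def)
  then have "Re w \<le> 0 \<and> Im w = 0" by (metis Im_complex_of_real Re_complex_of_real norm_ge_zero neg_le_0_iff_le uminus_complex.sel neg_0_equal_iff_equal)
  then show False using assms by (simp add: complex_nonpos_Reals_iff)
qed

lemma Arg_zero_iff_neg: "- u \<in> \<real>\<^sub>\<le>\<^sub>0 \<longleftrightarrow> Arg u = 0"
  unfolding Arg_eq_0 complex_nonpos_Reals_iff by (auto simp: complex_is_Real_iff)

text \<open>The circle modulo roots of unity is covered by two open arcs, the complements of two opposite points; they
  meet in two half circles (\<open>sector_inter\<close>).\<close>

lemma sector_cover:
  assumes "z \<noteq> 0" "k > 0"
  shows "z \<in> sector k 0 {-pi<..<pi} \<or> z \<in> sector k pi {0<..<2 * pi}"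
proof (cases "z ^ k \<in> \<real>\<^sub>\<le>\<^sub>0")
  case False
  then have "z \<in> sector k 0 {-pi<..<pi}"
    using Arg_less_pi[OF False] Arg_bounded[of "z ^ k"] by (simp add: sector_def)
  then show ?thesis ..
next
  case True
  have "- (z ^ k) \<notin> \<real>\<^sub>\<le>\<^sub>0" using True assms by (auto simp: complex_nonpos_Reals_iff complex_eq_iff)
     (metis assms(1) complex_eqI dual_order.antisym power_not_zero zero_complex.sel)+
  then have "z \<in> sector k pi {0<..<2 * pi}"
    using Arg_less_pi[of "- (z ^ k)"] Arg_bounded[of "- (z ^ k)"] by (simp add: sector_def cis_neg_pi)
  then show ?thesis ..
qed

lemma sector_inter:
  "sector k 0 {-pi<..<pi} \<inter> sector k pi {0<..<2 * pi} = sector k pi {0<..<pi} \<union> sector k pi {pi<..<2 * pi}"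
proof -
  have m: "z ^ k * cis (- pi) = - (z ^ k)" for z by (simp add: cis_neg_pi)
  have b: "Arg (- (z ^ k)) < pi" "Arg (- (z ^ k)) > - pi" if "- (z ^ k) \<notin> \<real>\<^sub>\<le>\<^sub>0" for z
    using Arg_less_pi[OF that] Arg_bounded[of "- (z ^ k)"] by auto
  have c: "z ^ k \<in> \<real>\<^sub>\<le>\<^sub>0 \<longleftrightarrow> Arg (- (z ^ k)) = 0" for z using Arg_zero_iff_neg[of "- (z ^ k)"] by simp
  have d: "- pi < Arg (z ^ k)" "z ^ k \<notin> \<real>\<^sub>\<le>\<^sub>0 \<Longrightarrow> Arg (z ^ k) < pi" for z
    using Arg_bounded[of "z ^ k"] Arg_less_pi[of "z ^ k"] by auto
  show ?thesis
  proof (rule Set.set_eqI)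
    fix z
    show "z \<in> sector k 0 {-pi<..<pi} \<inter> sector k pi {0<..<2 * pi} \<longleftrightarrow> z \<in> sector k pi {0<..<pi} \<union> sector k pi {pi<..<2 * pi}"
      using b[of z] c[of z] d[of z] unfolding sector_def Int_iff Un_iff mem_Collect_eq m greaterThanLessThan_iff
      by simp linarith
  qed
qed

lemma sector_disjoint: "sector k pi {0<..<pi} \<inter> sector k pi {pi<..<2 * pi} = {}"
  by (auto simp: sector_def)

lemma sector_mono: "J \<subseteq> J' \<Longrightarrow> sector k \<alpha> J \<subseteq> sector k \<alpha> J'"
  by (auto simp: sector_def)

lemma compact_stab:
  fixes G :: "(complex ^ 'n::finite) set"
  assumes "compact G" shows "compact (stab G e)"
proof -
  have "stab G e = G \<inter> (\<lambda>g. g $ e) -` {1}" by (auto simp: stab_def)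
  moreover have "closed ((\<lambda>g :: complex ^ 'n. g $ e) -` {1})"
    by (intro closed_vimage continuous_intros)
  ultimately show ?thesis using assms by (simp add: compact_Int_closed)
qed

text \<open>Rationally, the quotient of the unit sphere of the coordinates in \<open>L\<close> is again a sphere of that dimension. In
  the induction on \<open>L\<close>, the arcs \<open>N1\<close> and \<open>N2\<close> of \<open>sector_cover\<close> are attached to \<open>SO\<close> one after the other. The
  first one yields the mapping cone of the projection \<open>W \<rightarrow> Y\<close>; this is a rational isomorphism, so the cone is
  acyclic. The second one is attached along the part of \<open>N2\<close> that lies in \<open>SO\<close> or in one of the half arcs \<open>Na\<close>
  and \<open>Nb\<close>; that part has the Betti numbers of a suspension of \<open>W\<close>. Attaching a contractible set along it to an acyclic space suspends
  once more, and the degree grows by two.\<close>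

theorem betti_finite_quotient:
  fixes G :: "(complex ^ 'n::finite) set"
  assumes "torus_group G" "compact G" "\<And>j. j \<in> L \<Longrightarrow> finite ((\<lambda>g. g $ j) ` G)"
  shows "has_reduced_betti (orbit_top G (sph (Pow L))) i (if i = 2 * int (card L) - 1 then 1 else 0)"
proof -
  have "finite L" by simp
  then show ?thesis
    using assms
  proof (induction L arbitrary: G i rule: finite_induct)
    case empty
    interpret torus_group G by fact
    show ?case by (simp add: has_reduced_betti_def)
  next
    case (insert e L)
    let ?K = "Pow (insert e L)"
    let ?m = "2 * int (card L) - 1"
    interpret torus_group G by (rule insert.prems(1))
    interpret S: torus_group "stab G e" by (rule torus_group_stab)
    define k where "k = card ((\<lambda>g. g $ e) ` G)"
    have roots: "(\<lambda>g. g $ e) ` G = {z. z ^ k = 1}" and k: "k > 0"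
    proof -
      have f: "finite ((\<lambda>g. g $ e) ` G)" using insert.prems by simp
      have o: "1 \<in> (\<lambda>g. g $ e) ` G" using one_mem by (metis image_eqI one_index)
      have mu: "z * w \<in> (\<lambda>g. g $ e) ` G" if "z \<in> (\<lambda>g. g $ e) ` G" "w \<in> (\<lambda>g. g $ e) ` G" for z w
      proof -
        obtain g h where "g \<in> G" "h \<in> G" "z = g $ e" "w = h $ e" using \<open>z \<in> _\<close> \<open>w \<in> _\<close> by blast
        then show ?thesis by (intro image_eqI[of _ _ "g * h"]) auto
      qed
      have n: "norm z = 1" if "z \<in> (\<lambda>g. g $ e) ` G" for z using that by auto
      show "(\<lambda>g. g $ e) ` G = {z. z ^ k = 1}" "k > 0"
        unfolding k_def using finite_circle_subgroup[OF f o mu n] by blast+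
    qed
    have dl: "del ?K e = Pow L" "lnk ?K e = Pow L" using insert.hyps by (auto simp: del_def lnk_def)
    have finG: "finite ((\<lambda>g. g $ j) ` G)" if "j \<in> L" for j using insert.prems that by simp
    have finS: "finite ((\<lambda>g. g $ j) ` stab G e)" if "j \<in> L" for j
      by (rule finite_subset[OF _ finG[OF that]]) (auto simp: stab_def)
    have bY: "has_reduced_betti (orbit_top G (sph (Pow L))) p (if p = ?m then 1 else 0)" for p
      using insert.IH[OF insert.prems(1,2) finG] .
    have bW: "has_reduced_betti (orbit_top (stab G e) (sph (Pow L))) p (if p = ?m then 1 else 0)" for p
      using insert.IH[OF S.torus_group_axioms compact_stab[OF insert.prems(2)] finS] .
    have b1: "has_reduced_betti (orbit_top {1} (sph (Pow L) :: (complex ^ 'n) set)) p (if p = ?m then 1 else 0)" for p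
      using insert.IH[OF torus_group_trivial] by simp
    \<comment> \<open>the midpoints of the two half arcs\<close>
    define ta tb where "ta = pi / (2 * real k)" and "tb = 3 * pi / (2 * real k)"
    have t: "real k * ta = pi / 2" "real k * tb = 3 * pi / 2" using k by (simp_all add: ta_def tb_def)
    have dn: "\<And>A B. A \<in> ?K \<Longrightarrow> B \<subseteq> A \<Longrightarrow> B \<in> ?K" by auto
    note ch = sector_chart[OF insert.prems(1,2) dn k roots]
    interpret c1: coordinate_chart G ?K e "sector k 0 {-pi<..<pi}" "sector_angle k 0" "{t. real k * t \<in> {-pi<..<pi}}" 0
      by (rule ch) auto
    interpret c2: coordinate_chart G ?K e "sector k pi {0<..<2*pi}" "sector_angle k pi" "{t. real k * t \<in> {0<..<2*pi}}" ta
      by (rule ch) (auto simp: t)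
    interpret ca: coordinate_chart G ?K e "sector k pi {0<..<pi}" "sector_angle k pi" "{t. real k * t \<in> {0<..<pi}}" ta
      by (rule ch) (auto simp: t)
    interpret cb: coordinate_chart G ?K e "sector k pi {pi<..<2*pi}" "sector_angle k pi" "{t. real k * t \<in> {pi<..<2*pi}}" tb
      by (rule ch) (auto simp: t)
    let ?S = "sph ?K :: (complex ^ 'n) set"
    let ?O = "c1.SO" and ?N1 = "c1.SN" and ?N2 = "c2.SN" and ?Na = "ca.SN" and ?Nb = "cb.SN"
    have sub: "?O \<subseteq> ?S" "?N1 \<subseteq> ?S" "?N2 \<subseteq> ?S" "?Na \<subseteq> ?N2" "?Nb \<subseteq> ?N2"
    proof -
      have "sector k pi {0<..<pi} \<subseteq> sector k pi {0<..<2*pi}" "sector k pi {pi<..<2*pi} \<subseteq> sector k pi {0<..<2*pi}"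
        by (intro sector_mono; use pi_gt_zero in auto)+
      then show "?O \<subseteq> ?S" "?N1 \<subseteq> ?S" "?N2 \<subseteq> ?S" "?Na \<subseteq> ?N2" "?Nb \<subseteq> ?N2"
      by (auto simp: c1.SO_def c1.SN_def c2.SN_def ca.SN_def cb.SN_def)
    qed
    have e_mem: "{e} \<in> ?K" by simp
    note ne = c1.SN_nonempty[OF e_mem] c2.SN_nonempty[OF e_mem] ca.SN_nonempty[OF e_mem] cb.SN_nonempty[OF e_mem]
    have N12: "?N1 \<inter> ?N2 = ?Na \<union> ?Nb"
      using sector_inter[of k] by (auto simp: c1.SN_def c2.SN_def ca.SN_def cb.SN_def)
    have Nab: "?Na \<inter> ?Nb = {}"
      using sector_disjoint[of k] by (auto simp: ca.SN_def cb.SN_def)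
    have cover: "?O \<union> ?N1 \<union> ?N2 = ?S"
    proof
      show "?S \<subseteq> ?O \<union> ?N1 \<union> ?N2"
      proof
        fix v assume v: "v \<in> ?S"
        show "v \<in> ?O \<union> ?N1 \<union> ?N2"
          using v sector_cover[OF _ k, of "v $ e"]
          by (cases "v $ e = 0") (auto simp: c1.SO_def c1.SN_def c2.SN_def)
      qed
    qed (use sub in auto)
    have LO: "L \<noteq> {}" "\<exists>w. w \<in> (sph (Pow L) :: (complex ^ 'n) set)" if "v \<in> ?O" for v
      using c1.unit_rest_del[OF that] unfolding dl by auto
    have linkne: "?O \<inter> ?N1 \<noteq> {}" "?O \<inter> ?Na \<noteq> {}" if v: "v \<in> ?O" for v
    proof -
      obtain w where "w \<in> sph (lnk ?K e)" using LO[OF v] unfolding dl by blast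
      then show "?O \<inter> ?N1 \<noteq> {}" "?O \<inter> ?Na \<noteq> {}"
        using c1.join_SON c1.cis_half ca.join_SON ca.cis_half by blast+
    qed
    have ri: "rational_iso (reduced_homology_group p c1.W) (reduced_homology_group p c1.Y) (hom_induced p c1.W {} c1.Y {} (orbit_map G id))"
      if "L \<noteq> {}" for p
      unfolding dl
      by (rule rational_iso_orbit_map[OF insert.prems(1) S.torus_group_axioms _ that finG bY bW b1]) (auto simp: stab_def)
    have X1: "has_reduced_betti (orbit_top G (?O \<union> ?N1)) p 0" for p
    proof (rule orbit_betti_zero)
      show "openin (top_of_set (?O \<union> ?N1)) ?O" "openin (top_of_set (?O \<union> ?N1)) ?N1"
        using sub by (auto intro!: c1.openin_charts)
      show "?O \<inter> ?N1 = {} \<Longrightarrow> ?O = {}" using linkne by blast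
      show "rational_iso (reduced_homology_group p c1.XON) (reduced_homology_group p c1.XO) (hom_induced p c1.XON {} c1.XO {} id)"
        if "?O \<inter> ?N1 \<noteq> {}" for p
        using that LO by (intro c1.rational_iso_XON_XO ri) blast
    qed (use c1.contractible_XN ne in auto)
    \<comment> \<open>\<open>SO \<inter> N2\<close> and \<open>SO \<inter> Na\<close> are equivalent to the same link, so this is the cone of an equivalence\<close>
    have Q1: "has_reduced_betti (orbit_top G ((?O \<inter> ?N2) \<union> ?Na)) p 0" for p
    proof (rule orbit_betti_zero)
      let ?Q = "(?O \<inter> ?N2) \<union> ?Na"
      have Q: "?Q \<subseteq> ?S" "?Q = ?Q \<inter> ?N2" using sub by auto
      have "openin (top_of_set ?S) ?O" "openin (top_of_set ?S) ?N2" "openin (top_of_set ?S) ?Na"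
        using sub by (auto intro!: c1.openin_charts c2.openin_charts ca.openin_charts)
      then have "openin (top_of_set ?S) (?O \<inter> ?N2)" "openin (top_of_set ?S) ?Na" by auto
      then show "openin (top_of_set ?Q) (?O \<inter> ?N2)" "openin (top_of_set ?Q) ?Na"
        using Q(1) by (auto intro: openin_subset_trans)
      have AB: "(?O \<inter> ?N2) \<inter> ?Na = ?O \<inter> ?Na" using sub by auto
      show "(?O \<inter> ?N2) \<inter> ?Na = {} \<Longrightarrow> ?O \<inter> ?N2 = {}" using linkne AB by blast
      have cont: "continuous_map ca.XON c2.XON id"
      proof -
        have "subtopology c2.XON (orb G ` (?O \<inter> ?Na)) = ca.XON" using sub by (intro subtopology_orbit_top) auto
        then show ?thesis by (metis continuous_map_from_subtopology continuous_map_id)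
      qed
      show "rational_iso (reduced_homology_group p (orbit_top G (?O \<inter> ?N2 \<inter> ?Na))) (reduced_homology_group p c2.XON)
        (hom_induced p (orbit_top G (?O \<inter> ?N2 \<inter> ?Na)) {} c2.XON {} id)" for p
        unfolding AB
      proof (rule rational_iso_conjugate[OF _ _ _ _ ca.link_in_iso _ hom_induced_reduced_hom])
        show "hom_induced p c2.XON {} c2.W {} c2.link_out \<in> iso (reduced_homology_group p c2.XON) (reduced_homology_group p c2.W)"
          by (rule homotopy_equivalence_reduced_homology_group_isomorphism[OF c2.continuous_link_out c2.continuous_link_in c2.link_in_out c2.link_out_in])
        show "rational_iso (reduced_homology_group p ca.W) (reduced_homology_group p c2.W) id"
          by (rule rational_iso_of_iso) (simp_all add: iso_def hom_def)
        fix x assume x: "x \<in> carrier (reduced_homology_group p ca.W)"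
        have "hom_induced p c2.XON {} c2.W {} c2.link_out (hom_induced p ca.XON {} c2.XON {} id (hom_induced p ca.W {} ca.XON {} ca.link_in x))
          = hom_induced p c2.XON {} c2.W {} c2.link_out (hom_induced p ca.W {} c2.XON {} (id \<circ> ca.link_in) x)"
          using cont ca.continuous_link_in by (subst hom_induced_compose'[of ca.W ca.XON]) auto
        also have "\<dots> = hom_induced p ca.W {} c2.W {} (c2.link_out \<circ> (id \<circ> ca.link_in)) x"
          using continuous_map_compose[OF ca.continuous_link_in cont] c2.continuous_link_out
          by (subst hom_induced_compose') auto
        also have "\<dots> = hom_induced p c2.W {} c2.W {} id x"
          using homology_homotopy_empty[OF c2.link_out_in, of p] by simp
        also have "\<dots> = id x"
          using x carrier_reduced_homology_group_subset[of p c2.W] by (subst hom_induced_id) auto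
        finally show "hom_induced p c2.XON {} c2.W {} c2.link_out (hom_induced p ca.XON {} c2.XON {} id (hom_induced p ca.W {} ca.XON {} ca.link_in x)) = id x" .
      qed simp_all
    qed (use ca.contractible_XN ne in auto)
    \<comment> \<open>attaching \<open>Nb\<close> to this acyclic space suspends \<open>SO \<inter> Nb\<close>, which is equivalent to \<open>W\<close>\<close>
    have Qb: "has_reduced_betti (orbit_top G (((?O \<inter> ?N2) \<union> ?Na) \<union> ?Nb)) p (0 + (if p - 1 = ?m then 1 else 0))" for p
    proof (rule orbit_betti_sum[OF _ _ _ _ cb.contractible_XN ne(4) Q1])
      let ?Q = "((?O \<inter> ?N2) \<union> ?Na) \<union> ?Nb"
      have Q: "?Q \<subseteq> ?S" using sub by auto
      have "openin (top_of_set ?S) ?O" "openin (top_of_set ?S) ?N2" "openin (top_of_set ?S) ?Na" "openin (top_of_set ?S) ?Nb"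
        using sub by (auto intro!: c1.openin_charts c2.openin_charts ca.openin_charts cb.openin_charts)
      then have "openin (top_of_set ?S) ((?O \<inter> ?N2) \<union> ?Na)" "openin (top_of_set ?S) ?Nb" by auto
      then show "openin (top_of_set ?Q) ((?O \<inter> ?N2) \<union> ?Na)" "openin (top_of_set ?Q) ?Nb"
        using Q by (auto intro: openin_subset_trans)
      have AB: "((?O \<inter> ?N2) \<union> ?Na) \<inter> ?Nb = ?O \<inter> ?Nb" using sub Nab by auto
      show "has_reduced_betti (orbit_top G (((?O \<inter> ?N2) \<union> ?Na) \<inter> ?Nb)) (p - 1) (if p - 1 = ?m then 1 else 0)"
        unfolding AB
        using has_reduced_betti_homotopy_equivalent[OF _ bW[of "p - 1"]] cb.XON_equiv homotopy_equivalent_space_sym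
        unfolding dl by blast
      show "invariant G ((?O \<inter> ?N2) \<union> ?Na)" using c2.invariant_SON ca.invariant_SN by (auto simp: invariant_def)
    qed (use Q1 in auto)
    have Q: "(?O \<union> ?N1) \<inter> ?N2 = ((?O \<inter> ?N2) \<union> ?Na) \<union> ?Nb" using N12 by auto
    have "has_reduced_betti (orbit_top G ((?O \<union> ?N1) \<union> ?N2)) i (0 + (0 + (if i - 1 - 1 = ?m then 1 else 0)))"
    proof (rule orbit_betti_sum[OF _ _ _ _ c2.contractible_XN ne(2) X1])
      have "openin (top_of_set ?S) ?O" "openin (top_of_set ?S) ?N1" "openin (top_of_set ?S) ?N2"
        using sub by (auto intro!: c1.openin_charts c2.openin_charts)
      then show "openin (top_of_set ((?O \<union> ?N1) \<union> ?N2)) (?O \<union> ?N1)" "openin (top_of_set ((?O \<union> ?N1) \<union> ?N2)) ?N2"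
        unfolding cover by auto
      show "has_reduced_betti (orbit_top G ((?O \<union> ?N1) \<inter> ?N2)) (i - 1) (0 + (if i - 1 - 1 = ?m then 1 else 0))"
        unfolding Q by (rule Qb)
      show "invariant G (?O \<union> ?N1)" using c1.invariant_SO c1.invariant_SN by (auto simp: invariant_def)
    qed (use X1 in auto)
    then show ?case
      unfolding cover using insert.hyps by (simp add: card_insert_if)
  qed
qed

section \<open>Characters and ranks of columns\<close>

definition col_vec :: "int ^ 'n ^ 'r \<Rightarrow> 'n \<Rightarrow> rat ^ 'r" where
  "col_vec Z j = column j (map_matrix rat_of_int Z)"

definition rk :: "int ^ 'n ^ 'r \<Rightarrow> 'n set \<Rightarrow> nat" where
  "rk Z A = vec.dim (col_vec Z ` A)"

definition character :: "complex ^ 'r \<Rightarrow> ('r \<Rightarrow> int) \<Rightarrow> complex" where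
  "character t w = (\<Prod>i\<in>UNIV. (t $ i) powi (w i))"

definition weight_map :: "int ^ 'n ^ 'r \<Rightarrow> complex ^ 'r \<Rightarrow> complex ^ 'n" where
  "weight_map Z t = (\<chi> j. character t (\<lambda>i. Z $ i $ j))"

text \<open>The coordinates in \<open>C\<close> are held fixed, so that the stabilizer of a further coordinate is a group of the same
  kind (\<open>stab_weight_group\<close>). This mirrors the contraction of the columns in \<open>C\<close>.\<close>

definition weight_group :: "int ^ 'n ^ 'r \<Rightarrow> 'n set \<Rightarrow> (complex ^ 'n) set" where
  "weight_group Z C = weight_map Z ` {t \<in> torus. \<forall>j\<in>C. weight_map Z t $ j = 1}"

lemma col_vec_nth: "col_vec Z j $ i = rat_of_int (Z $ i $ j)"
  by (simp add: col_vec_def column_def map_matrix_def)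

lemma torusD: "t \<in> torus \<Longrightarrow> norm (t $ i) = 1" by (simp add: torus_def)

lemma torus_nz: "t \<in> torus \<Longrightarrow> t $ i \<noteq> 0" using torusD[of t i] by auto

lemma norm_character: "t \<in> torus \<Longrightarrow> norm (character t w) = 1"
  by (simp add: character_def prod_norm[symmetric] norm_power_int torusD)

lemma character_mult: "character (s * t) w = character s w * character t w"
  by (simp add: character_def power_int_mult_distrib prod.distrib)

lemma character_one [simp]: "character 1 w = 1" by (simp add: character_def)

lemma prod_cis: "(\<Prod>i\<in>A. cis (f i)) = cis (\<Sum>i\<in>A. f i)"
  by (induction A rule: infinite_finite_induct) (simp_all add: cis_mult)

lemma character_cis:
  fixes m :: "'r::finite \<Rightarrow> int"
  shows "character (\<chi> i. cis (of_int (m i) * \<theta>)) w = cis (of_int (\<Sum>i\<in>UNIV. m i * w i) * \<theta>)"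
proof -
  have "character (\<chi> i. cis (of_int (m i) * \<theta>)) w = (\<Prod>i\<in>UNIV. cis (of_int (m i * w i) * \<theta>))"
    unfolding character_def by (intro prod.cong) (auto simp: cis_power_int mult_ac)
  also have "\<dots> = cis (\<Sum>i\<in>UNIV. of_int (m i * w i) * \<theta>)"
    by (rule prod_cis)
  also have "\<dots> = cis (of_int (\<Sum>i\<in>UNIV. m i * w i) * \<theta>)"
    by (simp add: sum_distrib_right of_int_sum)
  finally show ?thesis .
qed

lemma cis_torus: "(\<chi> i. cis (f i)) \<in> torus" by (simp add: torus_def)

lemma weight_map_nth: "weight_map Z t $ j = character t (\<lambda>i. Z $ i $ j)" by (simp add: weight_map_def)

lemma weight_map_mult: "weight_map Z (s * t) = weight_map Z s * weight_map Z t"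
  by (simp add: vec_eq_iff weight_map_nth character_mult)

lemma weight_map_one [simp]: "weight_map Z 1 = 1"
  by (simp add: vec_eq_iff weight_map_nth)

lemma weight_map_torus: "t \<in> torus \<Longrightarrow> weight_map Z t \<in> torus"
proof -
  assume t: "t \<in> torus"
  have "norm (weight_map Z t $ j) = 1" for j by (simp add: weight_map_nth norm_character[OF t])
  then show ?thesis by (simp add: torus_def)
qed

lemma torus_mult: "s \<in> torus \<Longrightarrow> t \<in> torus \<Longrightarrow> s * t \<in> torus"
  by (simp add: torus_def norm_mult)

lemma torus_one [simp]: "1 \<in> torus" by (simp add: torus_def)

lemma torus_inverse:
  assumes "t \<in> torus" obtains s where "s \<in> torus" "s * t = 1"
proof
  show "(\<chi> i. inverse (t $ i)) \<in> torus" using assms by (simp add: torus_def norm_inverse)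
  show "(\<chi> i. inverse (t $ i)) * t = 1" using torus_nz[OF assms] by (simp add: vec_eq_iff)
qed

lemma torus_group_weight_group: "torus_group (weight_group Z C)"
  unfolding torus_group_def torus_subgroup_def
proof (intro conjI ballI)
  show "weight_group Z C \<subseteq> torus" by (auto simp: weight_group_def weight_map_torus)
  show "1 \<in> weight_group Z C"
    unfolding weight_group_def by (intro image_eqI[of _ _ 1]) auto
  show "g * h \<in> weight_group Z C" if gh: "g \<in> weight_group Z C" "h \<in> weight_group Z C" for g h
  proof -
    obtain s t where st: "s \<in> torus" "t \<in> torus" "\<forall>j\<in>C. weight_map Z s $ j = 1" "\<forall>j\<in>C. weight_map Z t $ j = 1"
      "g = weight_map Z s" "h = weight_map Z t"
      using gh unfolding weight_group_def by blast
    show ?thesis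
      unfolding weight_group_def using st by (intro image_eqI[of _ _ "s * t"]) (auto simp: weight_map_mult torus_mult)
  qed
  show "\<exists>h\<in>weight_group Z C. h * g = 1" if g: "g \<in> weight_group Z C" for g
  proof -
    obtain t where t: "t \<in> torus" "\<forall>j\<in>C. weight_map Z t $ j = 1" "g = weight_map Z t"
      using g unfolding weight_group_def by blast
    obtain s where s: "s \<in> torus" "s * t = 1" using torus_inverse[OF t(1)] .
    have m: "weight_map Z s * weight_map Z t = 1" using s(2) weight_map_mult[of Z s t] by simp
    have "weight_map Z s $ j = 1" if "j \<in> C" for j
    proof -
      have "weight_map Z s $ j * weight_map Z t $ j = 1" using m by (metis one_index vector_mult_component)
      then show ?thesis using t(2) that by simp
    qed
    then have "weight_map Z s \<in> weight_group Z C" using s unfolding weight_group_def by blast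
    then show ?thesis using m t(3) by blast
  qed
qed

lemma compact_torus: "compact (torus :: (complex ^ 'n::finite) set)"
proof -
  have "bounded (torus :: (complex ^ 'n) set)"
    unfolding bounded_iff
  proof (intro exI ballI)
    fix t :: "complex ^ 'n" assume "t \<in> torus"
    then have "(norm t)\<^sup>2 = real CARD('n)" by (simp add: norm_vec_sq torusD)
    then show "norm t \<le> sqrt (real CARD('n))" by (simp add: real_le_rsqrt)
  qed
  moreover have "closed (torus :: (complex ^ 'n) set)"
  proof -
    have "torus = (\<Inter>i. {t :: complex ^ 'n. norm (t $ i) = 1})" by (auto simp: torus_def)
    moreover have "closed (\<Inter>i. {t :: complex ^ 'n. norm (t $ i) = 1})"
      by (intro closed_INT ballI closed_Collect_eq continuous_intros)
    ultimately show ?thesis by simp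
  qed
  ultimately show ?thesis by (simp add: compact_eq_bounded_closed)
qed

lemma continuous_on_weight_map: "continuous_on torus (weight_map Z)"
  unfolding weight_map_def character_def
  by (intro continuous_on_vec_lambda continuous_on_prod continuous_on_power_int continuous_intros) (auto dest: torus_nz)

lemma compact_weight_group: "compact (weight_group Z C)"
proof -
  let ?T = "{t \<in> torus. \<forall>j\<in>C. weight_map Z t $ j = 1}"
  have "?T = torus \<inter> (\<Inter>j\<in>C. {t \<in> torus. weight_map Z t $ j = 1})" by auto
  moreover have "closed {t \<in> torus. weight_map Z t $ j = 1}" for j
  proof -
    have "closedin (top_of_set torus) {t \<in> torus. weight_map Z t $ j = 1}"
      by (intro continuous_closedin_preimage_constant continuous_intros continuous_on_weight_map)
    then show ?thesis using compact_torus compact_imp_closed closedin_closed_trans by blast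
  qed
  ultimately have "compact ?T" using compact_torus by (auto intro!: compact_Int_closed closed_INT)
  moreover have "continuous_on ?T (weight_map Z)" using continuous_on_weight_map by (rule continuous_on_subset) auto
  ultimately show ?thesis unfolding weight_group_def by (rule compact_continuous_image[rotated])
qed

lemma stab_weight_group: "stab (weight_group Z C) e = weight_group Z (insert e C)"
  by (auto simp: stab_def weight_group_def)

lemma common_denominator:
  fixes f :: "'a \<Rightarrow> rat"
  assumes "finite A"
  shows "\<exists>N m. N \<noteq> (0::int) \<and> (\<forall>a\<in>A. of_int N * f a = of_int (m a))"
  using assms
proof (induction A rule: finite_induct)
  case empty
  then show ?case by (intro exI[of _ 1]) auto
next
  case (insert x A)
  then obtain N m where N: "N \<noteq> 0" "\<And>a. a \<in> A \<Longrightarrow> of_int N * f a = of_int (m a)" by blast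
  obtain p q where pq: "f x = of_int p / of_int q" "q \<noteq> 0"
  proof (cases "f x")
    case (Fract p q)
    then show ?thesis using that[of p q] by (simp add: Fract_of_int_quotient)
  qed
  have "of_int (N * q) * f a = of_int ((if a = x then N * p else q * m a))" if "a \<in> insert x A" for a
  proof (cases "a = x")
    case True
    then show ?thesis using pq by simp
  next
    case False
    then have "of_int N * f a = of_int (m a)" using that N by auto
    then show ?thesis using False by (simp add: mult.commute mult.left_commute)
  qed
  moreover have "N * q \<noteq> 0" using N(1) pq(2) by simp
  ultimately show ?case
    by (intro exI[of _ "N * q"] exI[of _ "\<lambda>a. if a = x then N * p else q * m a"] conjI ballI)
qed

text \<open>A linear functional that vanishes on \<open>S\<close> and not at \<open>x\<close>, multiplied by a common denominator of its coefficients.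
  These integers serve as the exponents of a one-parameter subgroup of the torus.\<close>

lemma integer_functional:
  fixes x :: "rat ^ 'r::finite"
  assumes "x \<notin> vec.span S"
  shows "\<exists>m :: 'r \<Rightarrow> int. (\<forall>s\<in>S. (\<Sum>i\<in>UNIV. of_int (m i) * s $ i) = 0) \<and> (\<Sum>i\<in>UNIV. of_int (m i) * x $ i) \<noteq> 0"
proof -
  obtain B where B: "B \<subseteq> S" "vec.independent B" "S \<subseteq> vec.span B"
    using vec.basis_exists[of S] by metis
  have xB: "x \<notin> vec.span B" using assms vec.span_mono[OF B(1)] by blast
  then have ind: "vec.independent (insert x B)" using B(2) by (rule vec.independent_insertI)
  obtain i0 :: 'r where True by simp
  obtain f :: "rat ^ 'r \<Rightarrow> rat ^ 'r" where f: "Vector_Spaces.linear (*s) (*s) f"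
    "\<And>b. b \<in> insert x B \<Longrightarrow> f b = (if b = x then axis i0 1 else 0)"
    using vec.linear_independent_extend[OF ind, of "\<lambda>b. if b = x then axis i0 1 else 0"] by blast
  have fB: "f b = 0" if "b \<in> B" for b using f(2)[of b] that xB vec.span_base[OF that] by auto
  have fs: "f s = 0" if "s \<in> vec.span B" for s
  proof -
    interpret Vector_Spaces.linear "(*s)" "(*s)" f by (rule f(1))
    show ?thesis by (rule eq_0_on_span[OF _ that]) (rule fB)
  qed
  define a where "a = (\<lambda>i. matrix f $ i0 $ i)"
  have fa: "f y $ i0 = (\<Sum>i\<in>UNIV. a i * y $ i)" for y
  proof -
    have "f y $ i0 = (matrix f *v y) $ i0" by (simp only: matrix_works[OF f(1)])
    then show ?thesis by (simp only: a_def matrix_vector_mult_def vec_lambda_beta)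
  qed
  obtain N m where N: "N \<noteq> 0" "\<And>i. of_int N * a i = of_int (m i)"
    using common_denominator[of "UNIV :: 'r set" a] by auto
  have m: "(\<Sum>i\<in>UNIV. of_int (m i) * y $ i) = of_int N * f y $ i0" for y
    unfolding fa N(2)[symmetric] by (simp add: sum_distrib_left mult.assoc)
  have "f x $ i0 = 1" using f(2)[of x] by (simp add: axis_def)
  then have "(\<Sum>i\<in>UNIV. of_int (m i) * x $ i) \<noteq> 0" using N(1) unfolding m by simp
  moreover have "(\<Sum>i\<in>UNIV. of_int (m i) * s $ i) = 0" if "s \<in> S" for s
    using fs[of s] B(3) that unfolding m by auto
  ultimately show ?thesis by blast
qed

text \<open>A functional that vanishes on the columns in \<open>D\<close> and not on the column \<open>e\<close> defines a one-parameter subgroup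
  that fixes the coordinates in \<open>D\<close> and turns the coordinate \<open>e\<close>.\<close>

lemma character_onto_circle:
  fixes Z :: "int ^ 'n::finite ^ 'r::finite"
  assumes e: "col_vec Z e \<notin> vec.span (col_vec Z ` D)" and z: "norm z = 1"
  shows "\<exists>t\<in>torus. weight_map Z t $ e = z \<and> (\<forall>j\<in>D. weight_map Z t $ j = 1)"
proof -
  obtain m :: "'r \<Rightarrow> int" where m: "\<And>s. s \<in> col_vec Z ` D \<Longrightarrow> (\<Sum>i\<in>UNIV. of_int (m i) * s $ i) = 0"
    "(\<Sum>i\<in>UNIV. of_int (m i) * col_vec Z e $ i) \<noteq> 0"
    using integer_functional[OF e] by blast
  have s: "(\<Sum>i\<in>UNIV. of_int (m i) * col_vec Z j $ i) = of_int (\<Sum>i\<in>UNIV. m i * Z $ i $ j)" for j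
    by (simp add: col_vec_nth)
  have D: "(\<Sum>i\<in>UNIV. m i * Z $ i $ j) = 0" if "j \<in> D" for j
    using m(1)[OF imageI[OF that]] unfolding s by (simp only: of_int_eq_0_iff)
  let ?d = "\<Sum>i\<in>UNIV. m i * Z $ i $ e"
  have d: "?d \<noteq> 0" using m(2) unfolding s of_int_eq_0_iff .
  let ?t = "\<chi> i. cis (of_int (m i) * (Arg z / of_int ?d))"
  have "weight_map Z ?t $ e = cis (of_int ?d * (Arg z / of_int ?d))"
    by (simp only: weight_map_nth character_cis)
  also have "\<dots> = cis (Arg z)" using d by (simp del: of_int_sum)
  also have "\<dots> = z" using z cis_Arg[of z] by (cases "z = 0") (auto simp: sgn_eq)
  finally have "weight_map Z ?t $ e = z" .
  moreover have "weight_map Z ?t $ j = 1" if "j \<in> D" for j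
    using D[OF that] by (simp only: weight_map_nth character_cis) simp
  ultimately show ?thesis by (intro bexI[of _ ?t] conjI ballI cis_torus)
qed

text \<open>A multiple of the exponent vector is an integer combination of the columns in \<open>C\<close>, so a power of the
  character is a product of powers of characters that are equal to 1.\<close>

lemma character_root_of_unity:
  fixes Z :: "int ^ 'n::finite ^ 'r::finite"
  assumes "(\<chi> i. of_int (w i)) \<in> vec.span (col_vec Z ` C)"
  shows "\<exists>N::int. N \<noteq> 0 \<and> (\<forall>t\<in>torus. (\<forall>j\<in>C. weight_map Z t $ j = 1) \<longrightarrow> character t w powi N = 1)"
proof -
  obtain C' where C': "C' \<subseteq> C" "inj_on (col_vec Z) C'" "col_vec Z ` C' = col_vec Z ` C"
  proof -
    have "\<exists>U\<subseteq>C. inj_on (col_vec Z) U \<and> col_vec Z ` C = col_vec Z ` U"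
      using subset_image_inj[of "col_vec Z ` C" "col_vec Z" C] by simp
    then show ?thesis using that by force
  qed
  have "(\<chi> i. of_int (w i)) \<in> range (\<lambda>u. \<Sum>v\<in>col_vec Z ` C'. u v *s v)"
    using assms vec.span_finite[of "col_vec Z ` C'"] C'(3) by simp
  then obtain u where u: "(\<chi> i. of_int (w i)) = (\<Sum>v\<in>col_vec Z ` C'. u v *s v)" by auto
  then have u': "(\<chi> i. of_int (w i)) = (\<Sum>j\<in>C'. u (col_vec Z j) *s col_vec Z j)"
    by (simp add: sum.reindex[OF C'(2)])
  obtain N m where N: "N \<noteq> 0" "\<And>j. j \<in> C' \<Longrightarrow> of_int N * u (col_vec Z j) = of_int (m j)"
    using common_denominator[of C' "\<lambda>j. u (col_vec Z j)"] by auto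
  have w: "N * w i = (\<Sum>j\<in>C'. m j * Z $ i $ j)" for i
  proof -
    have "rat_of_int (w i) = (\<Sum>j\<in>C'. u (col_vec Z j) * rat_of_int (Z $ i $ j))"
      using arg_cong[OF u', of "\<lambda>v. v $ i"] by (simp add: col_vec_nth)
    then have "rat_of_int (N * w i) = (\<Sum>j\<in>C'. (of_int N * u (col_vec Z j)) * rat_of_int (Z $ i $ j))"
      by (simp add: sum_distrib_left mult.assoc)
    also have "\<dots> = (\<Sum>j\<in>C'. of_int (m j) * rat_of_int (Z $ i $ j))"
      using N(2) by (intro sum.cong) auto
    finally have "rat_of_int (N * w i) = rat_of_int (\<Sum>j\<in>C'. m j * Z $ i $ j)" by simp
    then show ?thesis by (simp only: of_int_eq_iff)
  qed
  have "character t w powi N = 1" if t: "t \<in> torus" "\<forall>j\<in>C. weight_map Z t $ j = 1" for t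
  proof -
    have nz: "t $ i \<noteq> 0" for i using torus_nz[OF t(1)] .
    have pw: "(\<Prod>i\<in>A. f i) powi k = (\<Prod>i\<in>A. f i powi k)" for A :: "'x set" and f :: "'x \<Rightarrow> complex" and k :: int
      by (induction A rule: infinite_finite_induct) (simp_all add: power_int_mult_distrib)
    have ps: "a powi (\<Sum>j\<in>A. g j) = (\<Prod>j\<in>A. a powi g j)" if "a \<noteq> 0" for A :: "'n set" and g :: "'n \<Rightarrow> int" and a :: complex
      using that by (induction A rule: infinite_finite_induct) (simp_all add: power_int_add)
    have "character t w powi N = (\<Prod>i\<in>UNIV. (t $ i) powi (N * w i))"
      unfolding character_def pw by (simp add: power_int_mult[symmetric] mult.commute)
    also have "\<dots> = (\<Prod>i\<in>UNIV. \<Prod>j\<in>C'. (t $ i) powi (m j * Z $ i $ j))"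
      unfolding w using nz by (simp add: ps)
    also have "\<dots> = (\<Prod>j\<in>C'. \<Prod>i\<in>UNIV. (t $ i) powi (m j * Z $ i $ j))" by (rule prod.swap)
    also have "\<dots> = (\<Prod>j\<in>C'. (weight_map Z t $ j) powi m j)"
      unfolding weight_map_nth character_def pw by (simp add: power_int_mult[symmetric] mult.commute)
    also have "\<dots> = 1" using t(2) C'(1) by (intro prod.neutral) auto
    finally show ?thesis .
  qed
  then show ?thesis using N(1) by blast
qed

lemma finite_powi_roots: assumes "N \<noteq> (0::int)" shows "finite {z::complex. z powi N = 1}"
proof -
  have "z ^ nat \<bar>N\<bar> = 1" if "z powi N = 1" for z :: complex
    using that by (cases "N \<ge> 0") (auto simp: power_int_def power_inverse)
  then have "{z::complex. z powi N = 1} \<subseteq> {z. z ^ nat \<bar>N\<bar> = 1}" by auto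
  then show ?thesis by (rule finite_subset) (rule finite_roots_unity, use assms in simp)
qed

text \<open>A column in the span of \<open>C\<close> is a loop of the contraction by \<open>C\<close>; its coordinate is turned by roots of unity
  only.\<close>

lemma finite_loop_image:
  fixes Z :: "int ^ 'n::finite ^ 'r::finite"
  assumes "col_vec Z e \<in> vec.span (col_vec Z ` C)"
  shows "finite ((\<lambda>g. g $ e) ` weight_group Z C)"
proof -
  have "(\<chi> i. of_int (Z $ i $ e)) = col_vec Z e" by (simp add: vec_eq_iff col_vec_nth)
  then obtain N where N: "N \<noteq> (0::int)" "\<And>t. t \<in> torus \<Longrightarrow> \<forall>j\<in>C. weight_map Z t $ j = 1 \<Longrightarrow> character t (\<lambda>i. Z $ i $ e) powi N = 1"
    using character_root_of_unity[of "\<lambda>i. Z $ i $ e" Z C] assms by auto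
  have "(\<lambda>g. g $ e) ` weight_group Z C \<subseteq> {z. z powi N = 1}"
    using N(2) by (auto simp: weight_group_def weight_map_nth)
  then show ?thesis using finite_powi_roots[OF N(1)] by (rule finite_subset)
qed

lemma rk_insert: "rk Z (insert e A) = (if col_vec Z e \<in> vec.span (col_vec Z ` A) then rk Z A else rk Z A + 1)"
  by (simp add: rk_def vec.dim_insert)

lemma rk_mono: "A \<subseteq> B \<Longrightarrow> rk Z A \<le> rk Z B"
  unfolding rk_def by (meson image_mono vec.dim_mono vec.span_superset subset_trans)

lemma rk_empty [simp]: "rk Z {} = 0" by (simp add: rk_def)

lemma rk_Un_eq_iff: "rk Z (A \<union> C) = rk Z C \<longleftrightarrow> (\<forall>a\<in>A. col_vec Z a \<in> vec.span (col_vec Z ` C))"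
proof
  assume e: "rk Z (A \<union> C) = rk Z C"
  show "\<forall>a\<in>A. col_vec Z a \<in> vec.span (col_vec Z ` C)"
  proof
    fix a assume "a \<in> A"
    then have "rk Z (insert a C) \<le> rk Z (A \<union> C)" by (intro rk_mono) auto
    then have "rk Z (insert a C) \<noteq> rk Z C + 1" using e by linarith
    then show "col_vec Z a \<in> vec.span (col_vec Z ` C)" using rk_insert[of Z a C] by metis
  qed
next
  assume s: "\<forall>a\<in>A. col_vec Z a \<in> vec.span (col_vec Z ` C)"
  have "col_vec Z ` (A \<union> C) \<subseteq> vec.span (col_vec Z ` C)" using s vec.span_superset[of "col_vec Z ` C"] by blast
  then have "rk Z (A \<union> C) \<le> rk Z C" unfolding rk_def by (rule vec.dim_mono)
  moreover have "rk Z C \<le> rk Z (A \<union> C)" by (rule rk_mono) auto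
  ultimately show "rk Z (A \<union> C) = rk Z C" by simp
qed

section \<open>Betti numbers of families of supports\<close>

text \<open>For \<open>C = {}\<close> and \<open>k\<close> one below the full rank these are the supports of the singular points. Contracting \<open>e\<close> moves
  it from \<open>E\<close> to \<open>C\<close> and keeps the threshold, because the rank of \<open>A\<close> in the contraction is
  \<open>rk Z (A \<union> C) - rk Z C\<close>.\<close>

definition support_family :: "int ^ 'n ^ 'r \<Rightarrow> nat \<Rightarrow> 'n set \<Rightarrow> 'n set \<Rightarrow> 'n set set" where
  "support_family Z k E C = {A. A \<subseteq> E \<and> rk Z (A \<union> C) \<le> k}"

text \<open>For \<open>E = UNIV\<close>, \<open>C = {}\<close> and \<open>k\<close> one below the full rank this is the difference of the Tutte polynomial at \<open>x = 1\<close>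
  and \<open>x = 0\<close>. Neither of the differences in the exponents is ever truncated.\<close>

definition rank_sum :: "int ^ 'n ^ 'r \<Rightarrow> nat \<Rightarrow> 'b::comm_ring_1 \<Rightarrow> 'n set \<Rightarrow> 'n set \<Rightarrow> 'b" where
  "rank_sum Z k y E C = (\<Sum>A\<in>support_family Z k E C.
     (- 1) ^ (k - rk Z (A \<union> C)) * (y - 1) ^ (card A + rk Z C - rk Z (A \<union> C)))"

lemma finite_support_family [simp]: "finite (support_family Z k E (C :: 'n::finite set))"
  by (rule finite_subset[of _ UNIV]) auto

lemma del_support_family: "del (support_family Z k E C) e = support_family Z k (E - {e}) C"
  by (auto simp: del_def support_family_def)

lemma lnk_support_family:
  assumes "e \<in> E" shows "lnk (support_family Z k E C) e = support_family Z k (E - {e}) (insert e C)"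
  using assms by (auto simp: lnk_def support_family_def)

lemma rank_sum_deletion_contraction:
  fixes Z :: "int ^ 'n::finite ^ 'r"
  assumes e: "e \<in> E" and nl: "col_vec Z e \<notin> vec.span (col_vec Z ` C)"
  shows "rank_sum Z k y E C = rank_sum Z k y (E - {e}) C + rank_sum Z k y (E - {e}) (insert e C)"
proof -
  let ?f = "\<lambda>C A. (- 1) ^ (k - rk Z (A \<union> C)) * (y - 1) ^ (card A + rk Z C - rk Z (A \<union> C))"
  have S: "support_family Z k E C = support_family Z k (E - {e}) C \<union> insert e ` support_family Z k (E - {e}) (insert e C)"
  proof
    show "support_family Z k E C \<subseteq> support_family Z k (E - {e}) C \<union> insert e ` support_family Z k (E - {e}) (insert e C)"
    proof
      fix A assume A: "A \<in> support_family Z k E C"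
      show "A \<in> support_family Z k (E - {e}) C \<union> insert e ` support_family Z k (E - {e}) (insert e C)"
      proof (cases "e \<in> A")
        case True
        then have "A = insert e (A - {e})" "A - {e} \<union> insert e C = A \<union> C" by auto
        then have "A - {e} \<in> support_family Z k (E - {e}) (insert e C)" "A = insert e (A - {e})"
          using A by (auto simp: support_family_def)
        then show ?thesis by blast
      qed (use A in \<open>auto simp: support_family_def\<close>)
    qed
  qed (use e in \<open>auto simp: support_family_def\<close>)
  have "rank_sum Z k y E C = sum (?f C) (support_family Z k (E - {e}) C) + sum (?f C) (insert e ` support_family Z k (E - {e}) (insert e C))"
    unfolding rank_sum_def S by (rule sum.union_disjoint) (auto simp: support_family_def)
  also have "sum (?f C) (insert e ` support_family Z k (E - {e}) (insert e C)) = sum (?f C \<circ> insert e) (support_family Z k (E - {e}) (insert e C))"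
    by (rule sum.reindex) (auto simp: inj_on_def support_family_def)
  also have "\<dots> = sum (?f (insert e C)) (support_family Z k (E - {e}) (insert e C))"
  proof (rule sum.cong)
    fix A assume "A \<in> support_family Z k (E - {e}) (insert e C)"
    then have "e \<notin> A" by (auto simp: support_family_def)
    moreover have "rk Z (insert e C) = rk Z C + 1" using nl by (simp add: rk_insert)
    ultimately show "(?f C \<circ> insert e) A = ?f (insert e C) A" by (simp add: card_insert_if)
  qed simp
  finally show ?thesis by (simp add: rank_sum_def)
qed

lemma sum_Pow_power: "finite L \<Longrightarrow> (\<Sum>A\<in>Pow L. (y :: 'b::comm_ring_1) ^ card A) = (1 + y) ^ card L"
proof (induction L rule: finite_induct)
  case (insert x F)
  have "Pow (insert x F) = Pow F \<union> insert x ` Pow F" by (rule Pow_insert)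
  then have "(\<Sum>A\<in>Pow (insert x F). y ^ card A) = (\<Sum>A\<in>Pow F. y ^ card A) + (\<Sum>A\<in>insert x ` Pow F. y ^ card A)"
    using insert.hyps by (simp only:) (rule sum.union_disjoint; auto)
  also have "(\<Sum>A\<in>insert x ` Pow F. y ^ card A) = (\<Sum>A\<in>Pow F. y ^ card (insert x A))"
    using insert.hyps by (subst sum.reindex) (auto simp: inj_on_def)
  also have "\<dots> = (\<Sum>A\<in>Pow F. y * y ^ card A)"
  proof (rule sum.cong)
    fix A assume "A \<in> Pow F"
    then have "x \<notin> A" "finite A" using insert.hyps finite_subset by auto
    then show "y ^ card (insert x A) = y * y ^ card A" by simp
  qed simp
  also have "\<dots> = y * (\<Sum>A\<in>Pow F. y ^ card A)" by (simp add: sum_distrib_left)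
  finally show ?case using insert by (simp add: algebra_simps)
qed simp

lemma support_family_loops:
  assumes "rk Z C = k"
  shows "support_family Z k E C = Pow {e \<in> E. col_vec Z e \<in> vec.span (col_vec Z ` C)}"
    "A \<in> support_family Z k E C \<Longrightarrow> rk Z (A \<union> C) = k"
proof -
  have g: "rk Z C \<le> rk Z (A \<union> C)" for A by (rule rk_mono) auto
  have eq: "rk Z (A \<union> C) \<le> k \<longleftrightarrow> (\<forall>a\<in>A. col_vec Z a \<in> vec.span (col_vec Z ` C))" for A
    using rk_Un_eq_iff[of Z A C] g[of A] assms by auto
  then show "support_family Z k E C = Pow {e \<in> E. col_vec Z e \<in> vec.span (col_vec Z ` C)}"
    by (auto simp: support_family_def)
  show "A \<in> support_family Z k E C \<Longrightarrow> rk Z (A \<union> C) = k"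
    using g[of A] assms by (simp add: support_family_def)
qed

lemma rank_sum_loops:
  fixes Z :: "int ^ 'n::finite ^ 'r"
  assumes "rk Z C = k"
  shows "rank_sum Z k y E C = y ^ card {e \<in> E. col_vec Z e \<in> vec.span (col_vec Z ` C)}"
proof -
  have "rank_sum Z k y E C = (\<Sum>A\<in>support_family Z k E C. (y - 1) ^ card A)"
    unfolding rank_sum_def using support_family_loops(2)[OF assms] assms by (intro sum.cong) auto
  also have "\<dots> = (1 + (y - 1)) ^ card {e \<in> E. col_vec Z e \<in> vec.span (col_vec Z ` C)}"
    unfolding support_family_loops(1)[OF assms] by (rule sum_Pow_power) simp
  finally show ?thesis by simp
qed

text \<open>The sets \<open>A\<close> and \<open>insert e A\<close> have the same nullity, and their ranks differ by one: their terms cancel.\<close>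

lemma rank_sum_coloop:
  fixes Z :: "int ^ 'n::finite ^ 'r"
  assumes e: "e \<in> E" and co: "col_vec Z e \<notin> vec.span (col_vec Z ` ((E - {e}) \<union> C))" and k: "rk Z (E \<union> C) = k"
  shows "support_family Z k E C = Pow E" "rank_sum Z k y E C = 0"
proof -
  have kE: "rk Z (A \<union> C) \<le> k" if "A \<subseteq> E" for A
    unfolding k[symmetric] using that by (intro rk_mono) auto
  then show S: "support_family Z k E C = Pow E" by (auto simp: support_family_def)
  let ?f = "\<lambda>A. (- 1) ^ (k - rk Z (A \<union> C)) * (y - 1) ^ (card A + rk Z C - rk Z (A \<union> C))"
  have "Pow E = Pow (E - {e}) \<union> insert e ` Pow (E - {e})"
    using e Pow_insert[of e "E - {e}"] by (simp add: insert_absorb)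
  then have "rank_sum Z k y E C = sum ?f (Pow (E - {e}) \<union> insert e ` Pow (E - {e}))"
    by (simp only: rank_sum_def S)
  also have "\<dots> = sum ?f (Pow (E - {e})) + sum ?f (insert e ` Pow (E - {e}))"
    by (rule sum.union_disjoint) auto
  also have "sum ?f (insert e ` Pow (E - {e})) = sum (?f \<circ> insert e) (Pow (E - {e}))"
    by (rule sum.reindex) (auto simp: inj_on_def)
  also have "\<dots> = (\<Sum>A\<in>Pow (E - {e}). - ?f A)"
  proof (rule sum.cong)
    fix A assume A: "A \<in> Pow (E - {e})"
    then have eA: "e \<notin> A" by auto
    have "col_vec Z ` (A \<union> C) \<subseteq> col_vec Z ` ((E - {e}) \<union> C)" using A by blast
    then have "col_vec Z e \<notin> vec.span (col_vec Z ` (A \<union> C))" using co vec.span_mono by blast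
    then have r: "rk Z (insert e A \<union> C) = rk Z (A \<union> C) + 1" by (simp add: rk_insert)
    moreover have "insert e A \<subseteq> E" using A e by auto
    ultimately have "rk Z (A \<union> C) < k" using kE[of "insert e A"] by simp
    then have "k - rk Z (A \<union> C) = Suc (k - (rk Z (A \<union> C) + 1))" by simp
    then show "(?f \<circ> insert e) A = - ?f A" using r eA by (simp add: card_insert_if)
  qed simp
  finally show "rank_sum Z k y E C = 0" by (simp add: sum_negf)
qed

text \<open>The parity statement is part of the induction: it ensures that in \<open>betti_deletion_contraction\<close> one of the two
  Betti numbers in question always vanishes. The homology lives in degrees congruent to \<open>k - rk Z C - 1\<close> modulo 2;
  the contraction of \<open>e\<close> raises \<open>rk Z C\<close> by one, and the mapping cone shifts its homology back to this parity.\<close>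

theorem betti_support_family:
  fixes Z :: "int ^ 'n::finite ^ 'r::finite"
  assumes "rk Z C \<le> k" "k \<le> rk Z (E \<union> C)"
  shows "\<exists>m. has_reduced_betti (orbit_top (weight_group Z C) (sph (support_family Z k E C))) i m \<and>
     fls_nth (rank_sum Z k (fls_X ^ 2) E C) (i - (int k - int (rk Z C) - 1)) = int m \<and>
     (odd (i - (int k - int (rk Z C) - 1)) \<longrightarrow> m = 0)"
  using assms
proof (induction "card E" arbitrary: E C i rule: less_induct)
  case less
  let ?G = "weight_group Z C" and ?K = "support_family Z k E C"
  show ?case
  proof (cases "rk Z C = k")
    case True
    let ?L = "{e \<in> E. col_vec Z e \<in> vec.span (col_vec Z ` C)}"
    have fin: "finite ((\<lambda>g. g $ j) ` ?G)" if "j \<in> ?L" for j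
      using that by (intro finite_loop_image) simp
    have "has_reduced_betti (orbit_top ?G (sph ?K)) i (if i = 2 * int (card ?L) - 1 then 1 else 0)"
      unfolding support_family_loops(1)[OF True]
      by (rule betti_finite_quotient[OF torus_group_weight_group compact_weight_group fin])
    moreover have "fls_nth (rank_sum Z k (fls_X ^ 2) E C) (i - (int k - int (rk Z C) - 1)) = int (if i = 2 * int (card ?L) - 1 then 1 else 0)"
      unfolding rank_sum_loops[OF True] power_mult[symmetric] fls_X_power_nth using True by auto
    ultimately show ?thesis using True by (intro exI conjI) (assumption | auto)+
  next
    case False
    then have rC: "rk Z C < k" using less.prems by simp
    have "\<exists>e\<in>E. col_vec Z e \<notin> vec.span (col_vec Z ` C)"
    proof (rule ccontr)
      assume "\<not> ?thesis"
      then have "rk Z (E \<union> C) = rk Z C" using rk_Un_eq_iff[of Z E C] by blast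
      then show False using rC less.prems by simp
    qed
    then obtain e where e: "e \<in> E" "col_vec Z e \<notin> vec.span (col_vec Z ` C)" by blast
    have rCe: "rk Z (insert e C) = rk Z C + 1" using e by (simp add: rk_insert)
    show ?thesis
    proof (cases "k \<le> rk Z (E - {e} \<union> C)")
      case True
      have card: "card (E - {e}) < card E" using e(1) by (intro psubset_card_mono) auto
      have pC: "k \<le> rk Z (E - {e} \<union> insert e C)"
      proof -
        have "E - {e} \<union> insert e C = E \<union> C" using e by auto
        then show ?thesis using less.prems by simp
      qed
      note IH1 = less.hyps[OF card less.prems(1) True]
      note IH2 = less.hyps[OF card _ pC, of i for i, unfolded rCe]
      have rC1: "rk Z C + 1 \<le> k" using rC by simp
      let ?s = "int k - int (rk Z C) - 1"
      have s': "j - 1 - (int k - int (rk Z C + 1) - 1) = j - ?s" for j by simp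
      have s'': "j - (int k - int (rk Z C + 1) - 1) = j + 1 - ?s" for j by simp
      obtain m1 where m1: "has_reduced_betti (orbit_top ?G (sph (support_family Z k (E - {e}) C))) i m1"
        "fls_nth (rank_sum Z k (fls_X ^ 2) (E - {e}) C) (i - ?s) = int m1" "odd (i - ?s) \<longrightarrow> m1 = 0"
        using IH1[of i] by blast
      obtain m1' where m1': "has_reduced_betti (orbit_top ?G (sph (support_family Z k (E - {e}) C))) (i - 1) m1'"
        "odd (i - 1 - ?s) \<longrightarrow> m1' = 0"
        using IH1[of "i - 1"] by blast
      obtain m2 where m2: "has_reduced_betti (orbit_top (weight_group Z (insert e C)) (sph (support_family Z k (E - {e}) (insert e C)))) (i - 1) m2"
        "fls_nth (rank_sum Z k (fls_X ^ 2) (E - {e}) (insert e C)) (i - ?s) = int m2" "odd (i - ?s) \<longrightarrow> m2 = 0"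
        using less.hyps[OF card _ pC, of "i - 1"] rC1 unfolding rCe s' by blast
      obtain m2' where m2': "has_reduced_betti (orbit_top (weight_group Z (insert e C)) (sph (support_family Z k (E - {e}) (insert e C)))) i m2'"
        "odd (i + 1 - ?s) \<longrightarrow> m2' = 0"
        using less.hyps[OF card _ pC, of i] rC1 unfolding rCe s'' by blast
      interpret torus_group ?G by (rule torus_group_weight_group)
      have "has_reduced_betti (orbit_top ?G (sph ?K)) i (m1 + m2)"
      proof (rule betti_deletion_contraction[OF torus_group_axioms compact_weight_group])
        show "B \<in> ?K" if "A \<in> ?K" "B \<subseteq> A" for A B
        proof -
          have "rk Z (B \<union> C) \<le> rk Z (A \<union> C)" using that by (intro rk_mono) auto
          then show ?thesis using that by (auto simp: support_family_def)
        qed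
        show "{e} \<in> ?K" using e rC1 rCe by (simp add: support_family_def)
        show "\<exists>g\<in>?G. g $ e = z" if "norm z = 1" for z
          using character_onto_circle[OF e(2) that] unfolding weight_group_def by blast
      qed (unfold del_support_family lnk_support_family[OF e(1)] stab_weight_group, use m1 m1' m2 m2' in auto)
      moreover have "fls_nth (rank_sum Z k (fls_X ^ 2) E C) (i - ?s) = int (m1 + m2)"
        unfolding rank_sum_deletion_contraction[OF e] using m1 m2 by simp
      ultimately show ?thesis using m1(3) m2(3) by blast
    next
      case False
      have EC: "E \<union> C = insert e (E - {e} \<union> C)" using e by auto
      have co: "col_vec Z e \<notin> vec.span (col_vec Z ` (E - {e} \<union> C))"
        using False less.prems(2) rk_insert[of Z e "E - {e} \<union> C"] EC by auto
      then have rkk: "rk Z (E \<union> C) = k" using False less.prems(2) rk_insert[of Z e "E - {e} \<union> C"] EC by auto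
      have rot: "\<exists>g\<in>?G. g $ e = z \<and> (\<forall>j\<in>E - {e}. g $ j = 1)" if "norm z = 1" for z
        using character_onto_circle[OF co that] unfolding weight_group_def by blast
      have "has_reduced_betti (orbit_top ?G (sph ?K)) i 0"
        unfolding rank_sum_coloop(1)[OF e(1) co rkk]
        using contractible_coloop[OF torus_group_weight_group e(1) rot]
        by (intro has_reduced_betti_contractible) (auto simp: torus_group.topspace_orbit_top[OF torus_group_weight_group])
      moreover have "rank_sum Z k (fls_X ^ 2 :: int fls) E C = 0"
        by (rule rank_sum_coloop(2)[OF e(1) co rkk])
      ultimately show ?thesis by (intro exI[of _ 0]) simp
    qed
  qed
qed

section \<open>The Tutte polynomial as a rank generating function\<close>

definition rank_of :: "'a set_system \<Rightarrow> 'a set \<Rightarrow> nat" where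
  "rank_of M A = Max (card ` {I \<in> indeps M. I \<subseteq> A})"

definition rank_generating :: "'a set_system \<Rightarrow> int poly poly" where
  "rank_generating M = (\<Sum>A\<in>Pow (ground M).
     (var_x - 1) ^ (rank_of M (ground M) - rank_of M A) * (var_y - 1) ^ (card A - rank_of M A))"

locale matroid_sys =
  fixes M :: "'a set_system"
  assumes mat: "matroid M"
begin

lemma fin: "finite (ground M)" and ind_sub: "I \<in> indeps M \<Longrightarrow> I \<subseteq> ground M" and empty_ind: "{} \<in> indeps M"
  and ind_down: "I \<in> indeps M \<Longrightarrow> J \<subseteq> I \<Longrightarrow> J \<in> indeps M"
  and augment: "I \<in> indeps M \<Longrightarrow> J \<in> indeps M \<Longrightarrow> card I < card J \<Longrightarrow> \<exists>e\<in>J - I. insert e I \<in> indeps M"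
  using mat unfolding matroid_def by blast+

lemma fin_ind: "I \<in> indeps M \<Longrightarrow> finite I" using ind_sub fin finite_subset by blast

lemma fin_indeps: "finite (indeps M)"
  using fin ind_sub by (meson Pow_iff finite_Pow_iff finite_subset subsetI)

lemma card_le_rank_of: "I \<in> indeps M \<Longrightarrow> I \<subseteq> A \<Longrightarrow> card I \<le> rank_of M A"
  unfolding rank_of_def using fin_indeps by (intro Max_ge) auto

lemma rank_of_attained: "\<exists>I\<in>indeps M. I \<subseteq> A \<and> card I = rank_of M A"
proof -
  have "rank_of M A \<in> card ` {I \<in> indeps M. I \<subseteq> A}"
    unfolding rank_of_def using fin_indeps empty_ind by (intro Max_in) auto
  then show ?thesis by auto
qed

text \<open>Repeated exchange with a maximal independent subset of \<open>A\<close>.\<close>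

lemma extend:
  assumes "I \<in> indeps M" "I \<subseteq> A"
  shows "\<exists>J\<in>indeps M. I \<subseteq> J \<and> J \<subseteq> A \<and> card J = rank_of M A"
  using assms
proof (induction "rank_of M A - card I" arbitrary: I rule: less_induct)
  case less
  show ?case
  proof (cases "card I = rank_of M A")
    case True
    then show ?thesis using less.prems by blast
  next
    case False
    then have lt: "card I < rank_of M A" using card_le_rank_of[OF less.prems] by simp
    obtain J where J: "J \<in> indeps M" "J \<subseteq> A" "card J = rank_of M A" using rank_of_attained by blast
    obtain e where e: "e \<in> J - I" "insert e I \<in> indeps M" using augment[OF less.prems(1) J(1)] lt J(3) by auto
    have c: "card (insert e I) = card I + 1" using e fin_ind[OF less.prems(1)] by simp
    have "\<exists>J\<in>indeps M. insert e I \<subseteq> J \<and> J \<subseteq> A \<and> card J = rank_of M A"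
      by (rule less.hyps) (use lt c e J less.prems in auto)
    then show ?thesis by blast
  qed
qed

lemma rank_of_mono: "A \<subseteq> B \<Longrightarrow> rank_of M A \<le> rank_of M B"
  using rank_of_attained[of A] card_le_rank_of by (metis subset_trans)

lemma rank_of_insert_le: "rank_of M (insert e A) \<le> rank_of M A + 1"
proof -
  obtain I where I: "I \<in> indeps M" "I \<subseteq> insert e A" "card I = rank_of M (insert e A)" using rank_of_attained by blast
  have "card (I - {e}) \<le> rank_of M A" using I by (intro card_le_rank_of ind_down[OF I(1)]) auto
  moreover have "card I \<le> card (I - {e}) + 1"
  proof (cases "e \<in> I")
    case True
    then show ?thesis using card_Suc_Diff1[OF fin_ind[OF I(1)] True] by simp
  qed simp
  ultimately show ?thesis using I by simp
qed

lemma rank_of_le_card: "finite A \<Longrightarrow> rank_of M A \<le> card A"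
  using rank_of_attained[of A] card_mono by metis

lemma basis_card: assumes "matroid_basis M B" shows "B \<in> indeps M" "card B = rank_of M (ground M)"
proof -
  show B: "B \<in> indeps M" using assms by (simp add: matroid_basis_def)
  obtain J where "J \<in> indeps M" "B \<subseteq> J" "card J = rank_of M (ground M)" using extend[OF B ind_sub[OF B]] by blast
  then show "card B = rank_of M (ground M)" using assms by (auto simp: matroid_basis_def)
qed

lemma basis_if_card:
  assumes "J \<in> indeps M" "card J = rank_of M (ground M)" shows "matroid_basis M J"
  unfolding matroid_basis_def
proof (intro conjI ballI impI)
  fix A assume A: "A \<in> indeps M" "J \<subseteq> A"
  have "card A \<le> card J" using card_le_rank_of[OF A(1) ind_sub[OF A(1)]] assms by simp
  then show "A = J" using A fin_ind[OF A(1)] card_seteq by blast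
qed fact

lemma rank_of_loop: assumes "is_loop M e" shows "rank_of M (insert e A) = rank_of M A"
proof -
  obtain I where I: "I \<in> indeps M" "I \<subseteq> insert e A" "card I = rank_of M (insert e A)" using rank_of_attained by blast
  have "e \<notin> I" using assms ind_down[OF I(1), of "{e}"] by (auto simp: is_loop_def)
  then have "rank_of M (insert e A) \<le> rank_of M A" using I by (metis card_le_rank_of subset_insert)
  then show ?thesis using rank_of_mono[OF subset_insertI[of A e]] by simp
qed

lemma rank_of_coloop:
  assumes e: "is_coloop M e" "e \<notin> A" "A \<subseteq> ground M"
  shows "rank_of M (insert e A) = rank_of M A + 1"
proof -
  obtain I where I: "I \<in> indeps M" "I \<subseteq> A" "card I = rank_of M A" using rank_of_attained by blast
  obtain J where J: "J \<in> indeps M" "I \<subseteq> J" "card J = rank_of M (ground M)" using extend[OF I(1) ind_sub[OF I(1)]] by blast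
  have "e \<in> J" using basis_if_card[OF J(1,3)] e by (auto simp: is_coloop_def)
  then have "insert e I \<in> indeps M" using ind_down[OF J(1)] J(2) by simp
  then have "card (insert e I) \<le> rank_of M (insert e A)" using I by (intro card_le_rank_of) auto
  moreover have "card (insert e I) = card I + 1" using e I fin_ind[OF I(1)] by (subst card_insert_disjoint) auto
  ultimately show ?thesis using I rank_of_insert_le[of e A] by simp
qed

lemma rank_of_not_coloop:
  assumes "e \<in> ground M" "\<not> is_coloop M e"
  shows "rank_of M (ground M - {e}) = rank_of M (ground M)"
proof -
  obtain B where B: "matroid_basis M B" "e \<notin> B" using assms by (auto simp: is_coloop_def)
  have "B \<subseteq> ground M - {e}" using B basis_card[OF B(1)] ind_sub by blast
  then have "card B \<le> rank_of M (ground M - {e})" using basis_card[OF B(1)] card_le_rank_of by blast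
  then show ?thesis using basis_card[OF B(1)] rank_of_mono[of "ground M - {e}" "ground M"] by auto
qed

lemma coloop_not_loop: "is_coloop M e \<Longrightarrow> \<not> is_loop M e"
  using rank_of_coloop[of e "{}"] rank_of_loop[of e "{}"] by auto

lemma rank_of_deletion: "e \<notin> A \<Longrightarrow> rank_of (deletion M e) A = rank_of M A"
proof -
  assume "e \<notin> A"
  then have "{I \<in> indeps (deletion M e). I \<subseteq> A} = {I \<in> indeps M. I \<subseteq> A}" by (auto simp: deletion_def)
  then show ?thesis by (simp add: rank_of_def)
qed

lemma matroid_deletion: "matroid (deletion M e)"
  unfolding matroid_def
proof (intro conjI ballI allI impI)
  show "finite (ground (deletion M e))" using fin by (simp add: deletion_def)
  show "indeps (deletion M e) \<subseteq> Pow (ground (deletion M e))" using ind_sub by (auto simp: deletion_def)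
  show "{} \<in> indeps (deletion M e)" using empty_ind by (simp add: deletion_def)
  show "B \<in> indeps (deletion M e)" if "A \<in> indeps (deletion M e)" "B \<subseteq> A" for A B
    using that ind_down by (auto simp: deletion_def)
  show "\<exists>x\<in>B - A. insert x A \<in> indeps (deletion M e)"
    if "A \<in> indeps (deletion M e)" "B \<in> indeps (deletion M e)" "card A < card B" for A B
    using that augment[of A B] by (auto simp: deletion_def)
qed

lemma contraction_nonloop:
  assumes "e \<in> ground M" "\<not> is_loop M e"
  shows "ground (contraction M e) = ground M - {e}"
    "I \<in> indeps (contraction M e) \<longleftrightarrow> e \<notin> I \<and> insert e I \<in> indeps M"
  using assms ind_sub by (auto simp: contraction_def)

lemma matroid_contraction: assumes "e \<in> ground M" shows "matroid (contraction M e)"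
proof (cases "is_loop M e")
  case True
  then show ?thesis using matroid_deletion by (simp add: contraction_def)
next
  case False
  note c = contraction_nonloop[OF assms False]
  show ?thesis
    unfolding matroid_def
  proof (intro conjI ballI allI impI)
    show "finite (ground (contraction M e))" using fin by (simp add: c)
    show "indeps (contraction M e) \<subseteq> Pow (ground (contraction M e))" using c ind_sub by blast
    show "{} \<in> indeps (contraction M e)" using False assms by (simp add: c is_loop_def)
    show "B \<in> indeps (contraction M e)" if "A \<in> indeps (contraction M e)" "B \<subseteq> A" for A B
      using that ind_down[of "insert e A" "insert e B"] by (auto simp: c)
    show "\<exists>x\<in>B - A. insert x A \<in> indeps (contraction M e)"
      if "A \<in> indeps (contraction M e)" "B \<in> indeps (contraction M e)" "card A < card B" for A B
    proof -
      have AB: "e \<notin> A" "e \<notin> B" "insert e A \<in> indeps M" "insert e B \<in> indeps M" using that c by auto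
      moreover have "finite A" "finite B" using fin_ind[OF AB(3)] fin_ind[OF AB(4)] by auto
      ultimately have "card (insert e A) < card (insert e B)" using that(3) by simp
      then obtain x where "x \<in> insert e B - insert e A" "insert x (insert e A) \<in> indeps M" using augment AB by blast
      then show ?thesis using AB by (intro bexI[of _ x]) (auto simp: c insert_commute)
    qed
  qed
qed

lemma rank_of_contraction:
  assumes e: "e \<in> ground M" "\<not> is_loop M e" "e \<notin> A"
  shows "rank_of M (insert e A) = rank_of (contraction M e) A + 1"
proof -
  interpret N: matroid_sys "contraction M e" by unfold_locales (rule matroid_contraction[OF e(1)])
  note c = contraction_nonloop[OF e(1,2)]
  have "{e} \<in> indeps M" using e by (simp add: is_loop_def)
  then obtain J where J: "J \<in> indeps M" "{e} \<subseteq> J" "J \<subseteq> insert e A" "card J = rank_of M (insert e A)"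
    using extend[of "{e}" "insert e A"] by auto
  have "insert e (J - {e}) = J" using J by auto
  then have "J - {e} \<in> indeps (contraction M e)" using J(1) unfolding c(2) by simp
  moreover have "J - {e} \<subseteq> A" using J(3) by blast
  ultimately have "card (J - {e}) \<le> rank_of (contraction M e) A" by (rule N.card_le_rank_of)
  moreover have "card J = card (J - {e}) + 1" using card_Suc_Diff1[OF fin_ind[OF J(1)], of e] J(2) by simp
  moreover obtain I where I: "I \<in> indeps (contraction M e)" "I \<subseteq> A" "card I = rank_of (contraction M e) A"
    using N.rank_of_attained by blast
  moreover have "card (insert e I) \<le> rank_of M (insert e A)" using I c by (intro card_le_rank_of) auto
  moreover have "card (insert e I) = card I + 1" using I N.fin_ind[OF I(1)] e by (subst card_insert_disjoint) auto
  ultimately show ?thesis using J by simp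
qed

text \<open>The sets containing \<open>e\<close> are paired with those that do not; the recursions for loops, coloops and other elements
  differ only in the rank of \<open>insert e A\<close>.\<close>

lemma rank_generating_split:
  assumes "e \<in> ground M"
  shows "rank_generating M = (\<Sum>A\<in>Pow (ground M - {e}).
     (var_x - 1) ^ (rank_of M (ground M) - rank_of M A) * (var_y - 1) ^ (card A - rank_of M A) +
     (var_x - 1) ^ (rank_of M (ground M) - rank_of M (insert e A)) * (var_y - 1) ^ (card A + 1 - rank_of M (insert e A)))"
    (is "_ = (\<Sum>A\<in>_. ?f A + ?h A)")
proof -
  let ?P = "Pow (ground M - {e})"
  have "Pow (ground M) = ?P \<union> insert e ` ?P"
    using assms Pow_insert[of e "ground M - {e}"] by (simp add: insert_absorb)
  then have "rank_generating M = sum ?f (?P \<union> insert e ` ?P)" by (simp only: rank_generating_def)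
  also have "\<dots> = sum ?f ?P + sum ?f (insert e ` ?P)" using fin by (intro sum.union_disjoint) auto
  also have "sum ?f (insert e ` ?P) = sum (?f \<circ> insert e) ?P" by (rule sum.reindex) (auto simp: inj_on_def)
  also have "\<dots> = sum ?h ?P"
  proof (rule sum.cong)
    fix A assume "A \<in> ?P"
    then have "e \<notin> A" "finite A" using fin finite_subset by auto
    then show "(?f \<circ> insert e) A = ?h A" by simp
  qed simp
  finally show ?thesis by (simp add: sum.distrib)
qed

lemma rank_generating_loop:
  assumes "is_loop M e" shows "rank_generating M = var_y * rank_generating (contraction M e)"
proof -
  have e: "e \<in> ground M" using assms by (simp add: is_loop_def)
  have c: "contraction M e = deletion M e" using assms by (simp add: contraction_def)
  have g: "ground (deletion M e) = ground M - {e}" by (simp add: deletion_def)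
  have r: "rank_of M (ground M) = rank_of (deletion M e) (ground M - {e})"
    using rank_of_loop[OF assms, of "ground M - {e}"] e by (simp add: insert_absorb rank_of_deletion)
  have "rank_generating M = (\<Sum>A\<in>Pow (ground M - {e}). var_y * ((var_x - 1) ^ (rank_of (deletion M e) (ground M - {e}) - rank_of (deletion M e) A) * (var_y - 1) ^ (card A - rank_of (deletion M e) A)))"
    unfolding rank_generating_split[OF e]
  proof (rule sum.cong)
    fix A assume A: "A \<in> Pow (ground M - {e})"
    then have "finite A" using fin finite_subset by auto
    then have "card A + 1 - rank_of M A = Suc (card A - rank_of M A)" using rank_of_le_card[of A] by simp
    moreover have "rank_of (deletion M e) A = rank_of M A" using A by (intro rank_of_deletion) auto
    ultimately show "(var_x - 1) ^ (rank_of M (ground M) - rank_of M A) * (var_y - 1) ^ (card A - rank_of M A) +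
      (var_x - 1) ^ (rank_of M (ground M) - rank_of M (insert e A)) * (var_y - 1) ^ (card A + 1 - rank_of M (insert e A))
      = var_y * ((var_x - 1) ^ (rank_of (deletion M e) (ground M - {e}) - rank_of (deletion M e) A) * (var_y - 1) ^ (card A - rank_of (deletion M e) A))"
      by (simp add: rank_of_loop[OF assms] r algebra_simps)
  qed simp
  then show ?thesis by (simp add: c rank_generating_def g sum_distrib_left)
qed

lemma rank_generating_coloop:
  assumes "is_coloop M e" shows "rank_generating M = var_x * rank_generating (contraction M e)"
proof -
  have e: "e \<in> ground M" using assms by (simp add: is_coloop_def)
  have nl: "\<not> is_loop M e" by (rule coloop_not_loop[OF assms])
  note g = contraction_nonloop(1)[OF e nl]
  let ?N = "contraction M e"
  have rk: "rank_of ?N A = rank_of M A" if "A \<subseteq> ground M - {e}" for A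
    using rank_of_contraction[OF e nl, of A] rank_of_coloop[OF assms, of A] that by auto
  have r: "rank_of M (ground M) = rank_of M (ground M - {e}) + 1"
    using rank_of_coloop[OF assms, of "ground M - {e}"] e by (simp add: insert_absorb)
  have "rank_generating M = (\<Sum>A\<in>Pow (ground M - {e}). var_x * ((var_x - 1) ^ (rank_of ?N (ground M - {e}) - rank_of ?N A) * (var_y - 1) ^ (card A - rank_of ?N A)))"
    unfolding rank_generating_split[OF e]
  proof (rule sum.cong)
    fix A assume A: "A \<in> Pow (ground M - {e})"
    have "rank_of M A \<le> rank_of M (ground M - {e})" using A by (intro rank_of_mono) auto
    then have "rank_of M (ground M) - rank_of M A = Suc (rank_of M (ground M - {e}) - rank_of M A)" using r by simp
    moreover have "rank_of M (insert e A) = rank_of M A + 1" using A by (intro rank_of_coloop[OF assms]) auto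
    ultimately show "(var_x - 1) ^ (rank_of M (ground M) - rank_of M A) * (var_y - 1) ^ (card A - rank_of M A) +
      (var_x - 1) ^ (rank_of M (ground M) - rank_of M (insert e A)) * (var_y - 1) ^ (card A + 1 - rank_of M (insert e A))
      = var_x * ((var_x - 1) ^ (rank_of ?N (ground M - {e}) - rank_of ?N A) * (var_y - 1) ^ (card A - rank_of ?N A))"
      using A rk[of A] rk[of "ground M - {e}"] r by (simp add: algebra_simps)
  qed simp
  then show ?thesis by (simp add: rank_generating_def g sum_distrib_left)
qed

lemma rank_generating_deletion_contraction:
  assumes "e \<in> ground M" "\<not> is_coloop M e" "\<not> is_loop M e"
  shows "rank_generating M = rank_generating (deletion M e) + rank_generating (contraction M e)"
proof -
  let ?N = "contraction M e" and ?D = "deletion M e"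
  note g = contraction_nonloop(1)[OF assms(1,3)]
  have gD: "ground ?D = ground M - {e}" by (simp add: deletion_def)
  have rN: "rank_of M (ground M) = rank_of ?N (ground M - {e}) + 1"
    using rank_of_contraction[OF assms(1,3), of "ground M - {e}"] assms(1) by (simp add: insert_absorb)
  have rD: "rank_of ?D (ground M - {e}) = rank_of M (ground M)"
    using rank_of_not_coloop[OF assms(1,2)] by (simp add: rank_of_deletion)
  have "rank_generating M = (\<Sum>A\<in>Pow (ground M - {e}).
     (var_x - 1) ^ (rank_of ?D (ground M - {e}) - rank_of ?D A) * (var_y - 1) ^ (card A - rank_of ?D A) +
     (var_x - 1) ^ (rank_of ?N (ground M - {e}) - rank_of ?N A) * (var_y - 1) ^ (card A - rank_of ?N A))"
    unfolding rank_generating_split[OF assms(1)]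
  proof (rule sum.cong)
    fix A assume A: "A \<in> Pow (ground M - {e})"
    then have "rank_of M (insert e A) = rank_of ?N A + 1" "rank_of ?D A = rank_of M A"
      using rank_of_contraction[OF assms(1,3), of A] rank_of_deletion[of e A] by auto
    then show "(var_x - 1) ^ (rank_of M (ground M) - rank_of M A) * (var_y - 1) ^ (card A - rank_of M A) +
      (var_x - 1) ^ (rank_of M (ground M) - rank_of M (insert e A)) * (var_y - 1) ^ (card A + 1 - rank_of M (insert e A)) =
      (var_x - 1) ^ (rank_of ?D (ground M - {e}) - rank_of ?D A) * (var_y - 1) ^ (card A - rank_of ?D A) +
      (var_x - 1) ^ (rank_of ?N (ground M - {e}) - rank_of ?N A) * (var_y - 1) ^ (card A - rank_of ?N A)"
      using rN rD by simp
  qed simp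
  then show ?thesis by (simp add: rank_generating_def g gD sum.distrib)
qed

end

lemma rank_generating_empty: "ground M = {} \<Longrightarrow> rank_generating M = 1"
  by (simp add: rank_generating_def)

lemma rank_generating_iso:
  assumes M: "matroid M" and N: "matroid N" and iso: "matroid_iso M N"
  shows "rank_generating M = rank_generating N"
proof -
  interpret M: matroid_sys M by unfold_locales fact
  interpret N: matroid_sys N by unfold_locales fact
  obtain f where f: "bij_betw f (ground M) (ground N)" "\<And>A. A \<subseteq> ground M \<Longrightarrow> f ` A \<in> indeps N \<longleftrightarrow> A \<in> indeps M"
    using iso by (auto simp: matroid_iso_def)
  have inj: "inj_on f (ground M)" "f ` ground M = ground N" using f(1) by (auto simp: bij_betw_def)
  have cardf: "card (f ` A) = card A" if "A \<subseteq> ground M" for A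
    using inj(1) that by (metis card_image inj_on_subset)
  have rk: "rank_of N (f ` A) = rank_of M A" if A: "A \<subseteq> ground M" for A
  proof -
    have "card ` {J \<in> indeps N. J \<subseteq> f ` A} = card ` {I \<in> indeps M. I \<subseteq> A}"
    proof
      show "card ` {J \<in> indeps N. J \<subseteq> f ` A} \<subseteq> card ` {I \<in> indeps M. I \<subseteq> A}"
      proof
        fix n assume "n \<in> card ` {J \<in> indeps N. J \<subseteq> f ` A}"
        then obtain J where J: "J \<in> indeps N" "J \<subseteq> f ` A" "n = card J" by auto
        then obtain I where I: "I \<subseteq> A" "J = f ` I" using subset_imageE by metis
        then have "I \<in> indeps M" "n = card I" using f(2)[of I] J A cardf[of I] by auto
        then show "n \<in> card ` {I \<in> indeps M. I \<subseteq> A}" using I by auto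
      qed
      show "card ` {I \<in> indeps M. I \<subseteq> A} \<subseteq> card ` {J \<in> indeps N. J \<subseteq> f ` A}"
      proof
        fix n assume "n \<in> card ` {I \<in> indeps M. I \<subseteq> A}"
        then obtain I where I: "I \<in> indeps M" "I \<subseteq> A" "n = card I" by auto
        then have "f ` I \<in> {J \<in> indeps N. J \<subseteq> f ` A}" "n = card (f ` I)" using f(2)[of I] A cardf[of I] by auto
        then show "n \<in> card ` {J \<in> indeps N. J \<subseteq> f ` A}" by blast
      qed
    qed
    then show ?thesis by (simp add: rank_of_def)
  qed
  have P: "Pow (ground N) = (`) f ` Pow (ground M)"
    using inj(2) image_Pow_surj by metis
  have "inj_on ((`) f) (Pow (ground M))" using inj(1) by (rule inj_on_image_Pow)
  then have "rank_generating N = (\<Sum>A\<in>Pow (ground M). (var_x - 1) ^ (rank_of N (f ` ground M) - rank_of N (f ` A)) * (var_y - 1) ^ (card (f ` A) - rank_of N (f ` A)))"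
    unfolding rank_generating_def P by (subst sum.reindex) (auto simp: inj(2))
  also have "\<dots> = rank_generating M"
    unfolding rank_generating_def by (intro sum.cong) (auto simp: rk cardf)
  finally show ?thesis by simp
qed

lemma tutte_invariant_rank_generating: "tutte_invariant rank_generating"
  unfolding tutte_invariant_def
proof (intro conjI allI impI)
  show "rank_generating M = rank_generating N" if "matroid M \<and> matroid N \<and> matroid_iso M N" for M N :: "'a set_system"
    using that rank_generating_iso by blast
next
  fix M :: "'a set_system" and e assume "matroid M \<and> ground M = {e}"
  then have M: "matroid M" "ground M = {e}" by auto
  interpret matroid_sys M by unfold_locales fact
  have "ground (contraction M e) = {}" using M by (auto simp: contraction_def deletion_def)
  then have 1: "rank_generating (contraction M e) = 1"
    by (rule rank_generating_empty)
  show "is_coloop M e \<Longrightarrow> rank_generating M = var_x" "is_loop M e \<Longrightarrow> rank_generating M = var_y"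
    using rank_generating_coloop[of e] rank_generating_loop[of e] 1 by simp_all
next
  fix M :: "'a set_system" and e assume "matroid M \<and> e \<in> ground M"
  then have M: "matroid M" "e \<in> ground M" by auto
  interpret matroid_sys M by unfold_locales fact
  show "is_coloop M e \<Longrightarrow> rank_generating M = var_x * rank_generating (contraction M e)"
    "is_loop M e \<Longrightarrow> rank_generating M = var_y * rank_generating (contraction M e)"
    by (rule rank_generating_coloop rank_generating_loop, assumption)+
  show "rank_generating M = rank_generating (deletion M e) + rank_generating (contraction M e)"
    if "\<not> is_coloop M e \<and> \<not> is_loop M e"
    using that by (intro rank_generating_deletion_contraction M) auto
qed

text \<open>A matroid with a single loop has the value \<open>y\<close> by one clause and \<open>y\<close> times the value of the empty matroid by
  another.\<close>

lemma tutte_invariant_empty: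
  fixes T :: "'a set_system \<Rightarrow> int poly poly"
  assumes T: "tutte_invariant T" and M: "matroid M" "ground M = {}"
  shows "T M = 1"
proof -
  obtain e :: 'a where True by simp
  let ?L = "Set_System {e} {{}} :: 'a set_system"
  have L: "matroid ?L" "ground ?L = {e}" "is_loop ?L e" by (auto simp: matroid_def is_loop_def)
  have "contraction ?L e = Set_System {} {{}}" using L(3) by (auto simp: contraction_def deletion_def)
  also have "\<dots> = M"
  proof (rule set_system.expand, intro conjI)
    show "ground (Set_System {} {{}}) = ground M" using M by simp
    have "indeps M \<subseteq> {{}}" "{} \<in> indeps M" using M by (auto simp: matroid_def)
    then show "indeps (Set_System {} {{}}) = indeps M" by auto
  qed
  finally have c: "contraction ?L e = M" .
  have "T ?L = var_y" "T ?L = var_y * T (contraction ?L e)"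
    using T L unfolding tutte_invariant_def by blast+
  then have "var_y * T M = var_y * 1" by (simp add: c)
  moreover have "var_y \<noteq> 0" by (simp add: var_y_def)
  ultimately show ?thesis using mult_left_cancel[of var_y "T M" 1] by blast
qed

lemma tutte_invariant_unique:
  assumes "tutte_invariant S" "tutte_invariant T" "matroid M"
  shows "S M = T M"
  using assms(3)
proof (induction "card (ground M)" arbitrary: M rule: less_induct)
  case less
  interpret matroid_sys M by unfold_locales fact
  show ?case
  proof (cases "ground M = {}")
    case True
    then show ?thesis using tutte_invariant_empty assms(1,2) less.prems by metis
  next
    case False
    then obtain e where e: "e \<in> ground M" by auto
    have g: "ground (deletion M e) = ground M - {e}" "ground (contraction M e) = ground M - {e}"
      by (auto simp: deletion_def contraction_def)
    have lt: "card (ground M - {e}) < card (ground M)" using e fin by (intro psubset_card_mono) auto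
    have d: "S (deletion M e) = T (deletion M e)" using lt g matroid_deletion by (intro less.hyps) auto
    have c: "S (contraction M e) = T (contraction M e)" using lt g matroid_contraction[OF e] by (intro less.hyps) auto
    have *: "(is_coloop M e \<longrightarrow> U M = var_x * U (contraction M e)) \<and> (is_loop M e \<longrightarrow> U M = var_y * U (contraction M e)) \<and>
      (\<not> is_coloop M e \<and> \<not> is_loop M e \<longrightarrow> U M = U (deletion M e) + U (contraction M e))" if "tutte_invariant U" for U
      using that less.prems e unfolding tutte_invariant_def by blast
    show ?thesis using *[OF assms(1)] *[OF assms(2)] c d by metis
  qed
qed

theorem tutte_polynomial_eq: "matroid M \<Longrightarrow> tutte_polynomial M = rank_generating M"
  unfolding tutte_polynomial_def
  using tutte_invariant_rank_generating tutte_invariant_unique by (intro the_equality) blast+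

lemma map_poly_ring_hom:
  fixes f :: "'a::comm_ring_1 \<Rightarrow> 'b::comm_ring_1"
  assumes add: "\<And>a b. f (a + b) = f a + f b" and mult: "\<And>a b. f (a * b) = f a * f b" and one: "f 1 = 1"
  shows "poly (map_poly f (p + q)) y = poly (map_poly f p) y + poly (map_poly f q) y"
    "poly (map_poly f (p * q)) y = poly (map_poly f p) y * poly (map_poly f q) y"
proof -
  have f0: "f 0 = 0" using add[of 0 0] by simp
  have "f (sum g A) = (\<Sum>a\<in>A. f (g a))" for g :: "nat \<Rightarrow> 'a" and A
    by (induction A rule: infinite_finite_induct) (simp_all add: f0 add)
  then have "map_poly f (p * q) = map_poly f p * map_poly f q"
    by (intro poly_eqI) (simp add: coeff_map_poly f0 coeff_mult mult)
  then show "poly (map_poly f (p * q)) y = poly (map_poly f p) y * poly (map_poly f q) y" by simp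
  have "map_poly f (p + q) = map_poly f p + map_poly f q"
    by (intro poly_eqI) (simp add: coeff_map_poly f0 add)
  then show "poly (map_poly f (p + q)) y = poly (map_poly f p) y + poly (map_poly f q) y" by simp
qed

lemma eval_xy_hom:
  fixes x y :: "'b::comm_ring_1"
  shows "eval_xy (p + q) x y = eval_xy p x y + eval_xy q x y"
    "eval_xy (p * q) x y = eval_xy p x y * eval_xy q x y"
    "eval_xy 0 x y = 0" "eval_xy 1 x y = 1" "eval_xy var_x x y = x" "eval_xy var_y x y = y"
proof -
  let ?h = "\<lambda>q :: int poly. poly (map_poly of_int q) x"
  have h: "?h (a + b) = ?h a + ?h b" "?h (a * b) = ?h a * ?h b" for a b
    by (rule map_poly_ring_hom; simp)+
  have h1: "?h 1 = 1" by (simp add: map_poly_1)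
  show "eval_xy (p + q) x y = eval_xy p x y + eval_xy q x y" "eval_xy (p * q) x y = eval_xy p x y * eval_xy q x y"
    unfolding eval_xy_def by (rule map_poly_ring_hom[OF h h1])+
  show "eval_xy 0 x y = 0" "eval_xy 1 x y = 1" by (simp_all add: eval_xy_def map_poly_1)
  show "eval_xy var_x x y = x" "eval_xy var_y x y = y"
    by (simp_all add: eval_xy_def var_x_def var_y_def map_poly_pCons map_poly_1 one_pCons[symmetric])
qed

lemma eval_xy_rank_generating:
  fixes x y :: "'b::comm_ring_1"
  shows "eval_xy (rank_generating M) x y =
    (\<Sum>A\<in>Pow (ground M). (x - 1) ^ (rank_of M (ground M) - rank_of M A) * (y - 1) ^ (card A - rank_of M A))"
proof -
  have s: "eval_xy (sum g A) x y = (\<Sum>a\<in>A. eval_xy (g a) x y)" for g :: "'a set \<Rightarrow> int poly poly" and A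
    by (induction A rule: infinite_finite_induct) (simp_all add: eval_xy_hom)
  have d: "eval_xy (p - 1) x y = eval_xy p x y - 1" for p
    using eval_xy_hom(1)[of "p - 1" 1 x y] by (simp add: eval_xy_hom)
  have w: "eval_xy (p ^ n) x y = eval_xy p x y ^ n" for p n
    by (induction n) (simp_all add: eval_xy_hom)
  show ?thesis unfolding rank_generating_def by (simp add: s eval_xy_hom w d)
qed

lemma column_matroid_simps:
  "ground (column_matroid Z) = UNIV"
  "I \<in> indeps (column_matroid Z) \<longleftrightarrow> inj_on (col_vec Z) I \<and> vec.independent (col_vec Z ` I)"
  by (simp_all add: column_matroid_def Let_def col_vec_def[abs_def])

lemma card_column_indep:
  "I \<in> indeps (column_matroid Z) \<Longrightarrow> card I = rk Z I"
  by (simp add: column_matroid_simps rk_def vec.dim_eq_card_independent card_image)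

lemma matroid_column_matroid: "matroid (column_matroid (Z :: int ^ 'n::finite ^ 'r::finite))"
  unfolding matroid_def
proof (intro conjI ballI allI impI)
  show "{} \<in> indeps (column_matroid Z)" by (simp add: column_matroid_simps vec.independent_empty)
  show "B \<in> indeps (column_matroid Z)" if "A \<in> indeps (column_matroid Z)" "B \<subseteq> A" for A B
    using that vec.independent_mono[of "col_vec Z ` A" "col_vec Z ` B"]
    by (auto simp: column_matroid_simps intro: inj_on_subset)
  fix A B assume A: "A \<in> indeps (column_matroid Z)" and B: "B \<in> indeps (column_matroid Z)" and c: "card A < card B"
  show "\<exists>e\<in>B - A. insert e A \<in> indeps (column_matroid Z)"
  proof (rule ccontr)
    assume no: "\<not> ?thesis"
    have "col_vec Z b \<in> vec.span (col_vec Z ` A)" if b: "b \<in> B" for b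
    proof (rule ccontr)
      assume ns: "col_vec Z b \<notin> vec.span (col_vec Z ` A)"
      then have nA: "col_vec Z b \<notin> col_vec Z ` A" using vec.span_base by blast
      then have bA: "b \<notin> A" by blast
      have "insert b A \<in> indeps (column_matroid Z)"
      proof -
        have "inj_on (col_vec Z) (insert b A)"
          using A nA bA by (simp add: column_matroid_simps inj_on_insert)
        moreover have "vec.independent (col_vec Z ` insert b A)"
          using vec.independent_insertI[OF ns] A by (simp add: column_matroid_simps)
        ultimately show ?thesis by (simp add: column_matroid_simps)
      qed
      then show False using no b bA by blast
    qed
    then have "col_vec Z ` B \<subseteq> vec.span (col_vec Z ` A)" by blast
    then have "rk Z B \<le> rk Z A" unfolding rk_def by (rule vec.dim_mono)
    then show False using c A B by (simp add: card_column_indep)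
  qed
qed (auto simp: column_matroid_simps)

lemma rank_of_column_matroid: "rank_of (column_matroid (Z :: int ^ 'n::finite ^ 'r::finite)) A = rk Z A"
proof (rule antisym)
  interpret matroid_sys "column_matroid Z" by unfold_locales (rule matroid_column_matroid)
  obtain I where I: "I \<in> indeps (column_matroid Z)" "I \<subseteq> A" "card I = rank_of (column_matroid Z) A"
    using rank_of_attained by blast
  then show "rank_of (column_matroid Z) A \<le> rk Z A" using rk_mono[OF I(2), of Z] by (simp add: card_column_indep)
  obtain B where B: "B \<subseteq> col_vec Z ` A" "vec.independent B" "card B = rk Z A"
    unfolding rk_def using vec.basis_exists[of "col_vec Z ` A"] by metis
  then obtain J where J: "J \<subseteq> A" "inj_on (col_vec Z) J" "B = col_vec Z ` J"
    using subset_image_inj[of B "col_vec Z" A] by auto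
  then have "J \<in> indeps (column_matroid Z)" using B by (simp add: column_matroid_simps)
  from card_le_rank_of[OF this J(1)] show "rk Z A \<le> rank_of (column_matroid Z) A"
    using B J by (simp add: card_image)
qed

lemma matroid_rank_column_matroid: "matroid_rank (column_matroid (Z :: int ^ 'n::finite ^ 'r::finite)) = rk Z UNIV"
  unfolding rank_of_column_matroid[symmetric] rank_of_def matroid_rank_def by simp

section \<open>The singular set\<close>

text \<open>The terms of the sets of full rank do not depend on \<open>x\<close> and cancel. For the other sets the factor \<open>(x - 1)\<close> to a
  positive power is 0 at \<open>x = 1\<close> and a sign at \<open>x = 0\<close>.\<close>

lemma rank_sum_eq_tutte_difference:
  fixes Z :: "int ^ 'n::finite ^ 'r::finite" and y :: "'b::comm_ring_1"
  assumes r: "rk Z UNIV = Suc k"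
  shows "eval_xy (tutte_polynomial (column_matroid Z)) 1 y - eval_xy (tutte_polynomial (column_matroid Z)) 0 y
    = rank_sum Z k y UNIV {}"
proof -
  let ?t = "\<lambda>x A. (x - 1) ^ (Suc k - rk Z A) * (y - 1) ^ (card A - rk Z A)"
  have ev: "eval_xy (tutte_polynomial (column_matroid Z)) x y = (\<Sum>A\<in>Pow UNIV. ?t x A)" for x
    by (simp add: tutte_polynomial_eq matroid_column_matroid eval_xy_rank_generating column_matroid_simps rank_of_column_matroid r)
  have "eval_xy (tutte_polynomial (column_matroid Z)) 1 y - eval_xy (tutte_polynomial (column_matroid Z)) 0 y
    = (\<Sum>A\<in>Pow UNIV. ?t 1 A - ?t 0 A)" by (simp add: ev sum_subtractf)
  also have "\<dots> = (\<Sum>A\<in>support_family Z k UNIV {}. (- 1) ^ (k - rk Z (A \<union> {})) * (y - 1) ^ (card A + rk Z {} - rk Z (A \<union> {})))"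
  proof (rule sum.mono_neutral_cong_right)
    show "\<forall>A\<in>Pow UNIV - support_family Z k UNIV {}. ?t 1 A - ?t 0 A = 0"
    proof
      fix A assume "A \<in> Pow UNIV - support_family Z k UNIV {}"
      then have "rk Z A > k" by (simp add: support_family_def)
      then show "?t 1 A - ?t 0 A = 0" by simp
    qed
    fix A assume "A \<in> support_family Z k UNIV {}"
    then have "Suc k - rk Z A = Suc (k - rk Z A)" by (simp add: support_family_def)
    then show "?t 1 A - ?t 0 A = (- 1) ^ (k - rk Z (A \<union> {})) * (y - 1) ^ (card A + rk Z {} - rk Z (A \<union> {}))"
      by simp
  qed auto
  finally show ?thesis by (simp add: rank_sum_def)
qed

lemma one_parameter_subgroup:
  fixes Z :: "int ^ 'n::finite ^ 'r::finite"
  assumes "rk Z A < CARD('r)"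
  obtains m :: "'r \<Rightarrow> int" and i where "m i \<noteq> 0"
    "\<And>\<theta> j. j \<in> A \<Longrightarrow> weight_map Z (\<chi> i. cis (of_int (m i) * \<theta>)) $ j = 1"
proof -
  have "vec.span (col_vec Z ` A) \<noteq> UNIV"
  proof
    assume "vec.span (col_vec Z ` A) = UNIV"
    then have "vec.dim (vec.span (col_vec Z ` A)) = vec.dim (UNIV :: (rat ^ 'r) set)" by (simp only:)
    then have "rk Z A = CARD('r)" by (simp only: vec.dim_span vec_dim_card rk_def)
    then show False using assms by simp
  qed
  then obtain x where "x \<notin> vec.span (col_vec Z ` A)" by blast
  then obtain m :: "'r \<Rightarrow> int" where m: "\<And>s. s \<in> col_vec Z ` A \<Longrightarrow> (\<Sum>i\<in>UNIV. of_int (m i) * s $ i) = 0"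
    "(\<Sum>i\<in>UNIV. of_int (m i) * x $ i) \<noteq> 0"
    using integer_functional by blast
  obtain i where "m i \<noteq> 0"
  proof (rule ccontr)
    assume "\<not> thesis"
    then have "m i = 0" for i using that by blast
    then show False using m(2) by simp
  qed
  moreover have "weight_map Z (\<chi> i. cis (of_int (m i) * \<theta>)) $ j = 1" if "j \<in> A" for \<theta> j
  proof -
    have "rat_of_int (\<Sum>i\<in>UNIV. m i * Z $ i $ j) = (\<Sum>i\<in>UNIV. of_int (m i) * col_vec Z j $ i)"
      by (simp add: col_vec_nth)
    also have "\<dots> = 0" by (rule m(1)[OF imageI[OF that]])
    finally have "(\<Sum>i\<in>UNIV. m i * Z $ i $ j) = 0" by (simp only: of_int_eq_0_iff)
    then show ?thesis by (simp only: weight_map_nth character_cis) simp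
  qed
  ultimately show ?thesis by (rule that)
qed

text \<open>If the rank is deficient, the group contains a one-parameter subgroup. Otherwise every coordinate of the torus
  is a character whose exponent vector lies in the span of the columns, so on the group it takes only finitely
  many values.\<close>

lemma infinite_isotropy_iff:
  fixes Z :: "int ^ 'n::finite ^ 'r::finite"
  shows "infinite {t \<in> torus. \<forall>j\<in>A. weight_map Z t $ j = 1} \<longleftrightarrow> rk Z A < CARD('r)"
proof
  assume "rk Z A < CARD('r)"
  then obtain m :: "'r \<Rightarrow> int" and i where m: "m i \<noteq> 0"
    "\<And>\<theta> j. j \<in> A \<Longrightarrow> weight_map Z (\<chi> i. cis (of_int (m i) * \<theta>)) $ j = 1"
    by (rule one_parameter_subgroup) blast
  let ?T = "{t \<in> torus. \<forall>j\<in>A. weight_map Z t $ j = 1}"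
  show "infinite ?T"
  proof
    assume "finite ?T"
    then have "finite ((\<lambda>t. t $ i) ` ?T)" by simp
    \<comment> \<open>the coordinate \<open>i\<close> takes all values of modulus 1, so there are more roots of unity among them than values\<close>
    moreover have "{z. z ^ Suc (card ((\<lambda>t. t $ i) ` ?T)) = 1} \<subseteq> (\<lambda>t. t $ i) ` ?T"
    proof
      fix z :: complex assume "z \<in> {z. z ^ Suc (card ((\<lambda>t. t $ i) ` ?T)) = 1}"
      then have z: "norm z = 1" by (auto dest: power_eq_1_iff simp del: power_Suc)
      let ?t = "\<chi> l. cis (of_int (m l) * (Arg z / of_int (m i)))"
      have "?t $ i = cis (Arg z)" using m(1) by simp
      also have "\<dots> = z" using z cis_Arg[of z] by (cases "z = 0") (auto simp: sgn_eq)
      finally have "?t $ i = z" .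
      moreover have "?t \<in> ?T" by (intro CollectI conjI ballI cis_torus m(2))
      then have "?t $ i \<in> (\<lambda>t. t $ i) ` ?T" by (rule imageI)
      ultimately show "z \<in> (\<lambda>t. t $ i) ` ?T" by (simp only:)
    qed
    ultimately have "card {z :: complex. z ^ Suc (card ((\<lambda>t. t $ i) ` ?T)) = 1} \<le> card ((\<lambda>t. t $ i) ` ?T)"
      by (rule card_mono)
    moreover have "card {z :: complex. z ^ Suc (card ((\<lambda>t. t $ i) ` ?T)) = 1} = Suc (card ((\<lambda>t. t $ i) ` ?T))"
      by (rule card_roots_unity_eq) simp
    ultimately show False by simp
  qed
next
  assume inf: "infinite {t \<in> torus. \<forall>j\<in>A. weight_map Z t $ j = 1}"
  show "rk Z A < CARD('r)"
  proof (rule ccontr)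
    assume "\<not> ?thesis"
    moreover have "rk Z A \<le> vec.dim (UNIV :: (rat ^ 'r) set)" unfolding rk_def by (rule vec.dim_subset) simp
    then have "rk Z A \<le> CARD('r)" by (simp only: vec_dim_card)
    ultimately have "rk Z A = CARD('r)" by simp
    then have "vec.dim (col_vec Z ` A) = vec.dim (UNIV :: (rat ^ 'r) set)" by (simp only: rk_def vec_dim_card)
    then have sp: "vec.span (col_vec Z ` A) = UNIV"
      using vec.dim_eq_full[of "col_vec Z ` A"] by (simp add: vec.dim_UNIV vec.dimension_def)
    have "\<exists>N::int. N \<noteq> 0 \<and> (\<forall>t\<in>torus. (\<forall>j\<in>A. weight_map Z t $ j = 1) \<longrightarrow> (t $ i) powi N = 1)" for i
    proof -
      have c: "character t (\<lambda>l. if l = i then 1 else 0) = t $ i" for t :: "complex ^ 'r"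
      proof -
        have "character t (\<lambda>l. if l = i then 1 else 0) = (\<Prod>l\<in>UNIV. if l = i then t $ l else 1)"
          unfolding character_def by (intro prod.cong) auto
        then show ?thesis by simp
      qed
      show ?thesis using character_root_of_unity[of "\<lambda>l. if l = i then 1 else 0" Z A] by (simp add: sp c)
    qed
    then obtain N where N: "\<And>i. N i \<noteq> (0::int)" "\<And>i t. t \<in> torus \<Longrightarrow> \<forall>j\<in>A. weight_map Z t $ j = 1 \<Longrightarrow> (t $ i) powi N i = 1"
      by metis
    have "{t \<in> torus. \<forall>j\<in>A. weight_map Z t $ j = 1} \<subseteq> {t :: complex ^ 'r. \<forall>i. t $ i \<in> {z. z powi N i = 1}}"
      using N(2) by auto
    moreover have "finite {t :: complex ^ 'r. \<forall>i. t $ i \<in> {z. z powi N i = 1}}"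
      by (rule finite_vec_set) (rule finite_powi_roots[OF N(1)])
    ultimately show False using inf finite_subset by blast
  qed
qed

text \<open>If the rank were smaller, a one-parameter subgroup would act trivially. Its element at half the period of the
  coordinate \<open>i\<close> has the value \<open>- 1\<close> there and is therefore not the identity.\<close>

lemma effective_rank:
  fixes \<rho> :: "('r::finite, 'n::finite) torus_rep" and Z :: "int ^ 'n ^ 'r"
    and g :: "complex ^ 'n \<Rightarrow> complex ^ 'n"
  assumes eff: "effective_action \<rho>" and g: "orthogonal_transformation g"
    and eq: "\<And>t v. t \<in> torus \<Longrightarrow> g (blinfun_apply (\<rho> t) v) = weight_map Z t * g v"
  shows "rk Z UNIV = CARD('r)"
proof (rule ccontr)
  assume "\<not> ?thesis"
  moreover have "rk Z UNIV \<le> vec.dim (UNIV :: (rat ^ 'r) set)" unfolding rk_def by (rule vec.dim_subset) simp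
  then have "rk Z UNIV \<le> CARD('r)" by (simp only: vec_dim_card)
  ultimately have "rk Z UNIV < CARD('r)" by simp
  then obtain m :: "'r \<Rightarrow> int" and i where m: "m i \<noteq> 0"
    "\<And>\<theta> j. weight_map Z (\<chi> i. cis (of_int (m i) * \<theta>)) $ j = 1"
    by (rule one_parameter_subgroup) blast
  let ?t = "(\<chi> l. cis (of_int (m l) * (pi / of_int (m i)))) :: complex ^ 'r"
  have "weight_map Z ?t = 1" unfolding vec_eq_iff one_index by (intro allI m(2))
  then have "g (blinfun_apply (\<rho> ?t) v) = g v" for v using eq[OF cis_torus, of "\<lambda>l. of_int (m l) * (pi / of_int (m i))" v] by simp
  then have "blinfun_apply (\<rho> ?t) v = v" for v
    using orthogonal_transformation_inj[OF g] by (meson injD)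
  then have "\<forall>v\<in>unit_sphere. blinfun_apply (\<rho> ?t) v = v" by (intro ballI)
  moreover have "(\<forall>v\<in>unit_sphere. blinfun_apply (\<rho> ?t) v = v) \<longrightarrow> ?t = 1"
    using eff cis_torus unfolding effective_action_def by (rule bspec)
  ultimately have "?t = 1" by (rule rev_mp)
  then have "?t $ i = 1" by simp
  moreover have "?t $ i = cis pi" using m(1) by simp
  ultimately show False by simp
qed

text \<open>The orthogonal map \<open>g\<close> is a homeomorphism of the sphere that carries orbits to orbits and preserves isotropy
  groups.\<close>

lemma singular_set_homeomorphic:
  fixes \<rho> :: "('r::finite, 'n::finite) torus_rep" and Z :: "int ^ 'n ^ 'r"
    and g :: "complex ^ 'n \<Rightarrow> complex ^ 'n"
  assumes g: "orthogonal_transformation g"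
    and eq: "\<And>t v. t \<in> torus \<Longrightarrow> g (blinfun_apply (\<rho> t) v) = weight_map Z t * g v"
  shows "singular_set \<rho> homeomorphic_space
    orbit_top (weight_group Z {}) (sph {A. rk Z A < CARD('r)})"
proof -
  let ?G = "weight_group Z {}" and ?K = "{A. rk Z A < CARD('r)}"
  interpret torus_group ?G by (rule torus_group_weight_group)
  let ?S = "unit_sphere :: (complex ^ 'n) set"
  have S: "?S = sph UNIV" by (auto simp: sph_def)
  have bij: "bij g" using g by (rule orthogonal_transformation_bij)
  have inj: "inj g" using bij by (rule bij_is_inj)
  have ng: "norm (g v) = norm v" for v using g by (rule orthogonal_transformation_norm)
  have lin: "linear g" using g by (rule orthogonal_transformation_linear)
  have og': "orthogonal_transformation (inv_into UNIV g)" using g by (rule orthogonal_transformation_inv)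
  have cg: "continuous_on A g" "continuous_on A (inv_into UNIV g)" for A
    using lin orthogonal_transformation_linear[OF og'] by (simp_all add: linear_continuous_on linear_conv_bounded_linear)
  have gi: "g (inv_into UNIV g v) = v" "inv_into UNIV g (g v) = v" for v using bij inj by (simp_all add: surj_f_inv_f bij_is_surj)
  have ngi: "norm (inv_into UNIV g v) = norm v" for v using og' by (rule orthogonal_transformation_norm)
  have hg: "homeomorphic_map (top_of_set ?S) (top_of_set ?S) g"
    unfolding homeomorphic_map_maps homeomorphic_maps_def
    using cg gi ng ngi by (intro exI[of _ "inv_into UNIV g"]) auto
  have orb_g: "g ` torus_orbit \<rho> v = orb ?G (g v)" for v
    unfolding torus_orbit_def orb_def weight_group_def using eq by (auto simp: image_image)
  have iso: "isotropy \<rho> v = {t \<in> torus. \<forall>j\<in>supp (g v). weight_map Z t $ j = 1}" for v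
  proof -
    have "blinfun_apply (\<rho> t) v = v \<longleftrightarrow> (\<forall>j\<in>supp (g v). weight_map Z t $ j = 1)" if t: "t \<in> torus" for t
    proof -
      have "blinfun_apply (\<rho> t) v = v \<longleftrightarrow> weight_map Z t * g v = g v"
        using eq[OF t, of v] inj by (metis injD)
      also have "\<dots> \<longleftrightarrow> (\<forall>j\<in>supp (g v). weight_map Z t $ j = 1)"
        by (auto simp: vec_eq_iff supp_def)
      finally show ?thesis .
    qed
    then show ?thesis by (auto simp: isotropy_def)
  qed
  let ?X = "orbit_space \<rho>" and ?Y = "orbit_top ?G ?S"
  have qX: "quotient_map (top_of_set ?S) ?X (torus_orbit \<rho>)"
    unfolding orbit_space_def by (rule quotient_map_quotient_topology)
  have "quotient_map (top_of_set ?S) ?Y (orb ?G \<circ> g)"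
    by (rule quotient_map_compose[OF conjunct1[OF hg[unfolded homeomorphic_map_def]] quotient_map_orb])
  moreover have "orb ?G \<circ> g = (`) g \<circ> torus_orbit \<rho>" using orb_g by auto
  ultimately have "quotient_map ?X ?Y ((`) g)" using quotient_map_compose_eq[OF qX] by metis
  moreover have "inj_on ((`) g) (topspace ?X)" using inj by (simp add: inj_on_def inj_image_eq_iff)
  ultimately have h: "homeomorphic_map ?X ?Y ((`) g)" by (simp add: homeomorphic_map_def)
  let ?V = "{v \<in> ?S. infinite (isotropy \<rho> v)}"
  have gV: "g ` ?V = sph ?K"
  proof
    show "g ` ?V \<subseteq> sph ?K" by (auto simp: iso infinite_isotropy_iff sph_def ng)
    show "sph ?K \<subseteq> g ` ?V"
    proof
      fix w assume "w \<in> sph ?K"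
      then show "w \<in> g ` ?V"
        by (intro image_eqI[of _ _ "inv_into UNIV g w"]) (auto simp: iso infinite_isotropy_iff sph_def ngi gi)
    qed
  qed
  have im: "(`) g ` (torus_orbit \<rho> ` ?V) = orb ?G ` sph ?K"
    unfolding gV[symmetric] image_image orb_g ..
  have sub: "sph ?K \<subseteq> ?S" by (auto simp: sph_def)
  have tX: "torus_orbit \<rho> ` ?V \<subseteq> topspace ?X"
    by (auto simp: orbit_space_def topspace_quotient_topology)
  have "homeomorphic_map (subtopology ?X (torus_orbit \<rho> ` ?V)) (subtopology ?Y (orb ?G ` sph ?K)) ((`) g)"
  proof (rule homeomorphic_map_subtopologies[OF h])
    show "(`) g ` (topspace ?X \<inter> torus_orbit \<rho> ` ?V) = topspace ?Y \<inter> orb ?G ` sph ?K"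
      using im tX sub by (simp add: inf.absorb2 image_mono)
  qed
  moreover have "subtopology ?Y (orb ?G ` sph ?K) = orbit_top ?G (sph ?K)"
    using sub unfolding S by (intro subtopology_orbit_top) auto
  ultimately show ?thesis
    unfolding singular_set_def by (simp only: homeomorphic_map_imp_homeomorphic_space)
qed

theorem theorem12:
  fixes \<rho> :: "complex ^ 'r \<Rightarrow> ((complex ^ 'n) \<Rightarrow>\<^sub>L (complex ^ 'n))"
    and Z :: "int ^ 'n ^ 'r"
  assumes "linear_torus_action \<rho>"
    and "effective_action \<rho>"
    and "weight_matrix \<rho> Z"
  shows "has_reduced_poincare (singular_set \<rho>)
           (fls_X_intpow (int (matroid_rank (column_matroid Z)) - 2) *
              (eval_xy (tutte_polynomial (column_matroid Z)) 1 (fls_X ^ 2)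
               - eval_xy (tutte_polynomial (column_matroid Z)) 0 (fls_X ^ 2)))"
proof -
  obtain g where g: "orthogonal_transformation g"
    and eq': "\<And>t v. t \<in> torus \<Longrightarrow> g (blinfun_apply (\<rho> t) v) =
       (\<chi> j. (\<Prod>i\<in>UNIV. (t $ i) powi (Z $ i $ j)) * g v $ j)"
    using assms(3) unfolding weight_matrix_def by blast
  have eq: "g (blinfun_apply (\<rho> t) v) = weight_map Z t * g v" if "t \<in> torus" for t v
    unfolding eq'[OF that] by (simp add: vec_eq_iff weight_map_nth character_def)
  have r: "rk Z UNIV = CARD('r)" by (rule effective_rank[OF assms(2) g eq])
  obtain k where k: "CARD('r) = Suc k" by (metis not0_implies_Suc zero_less_card_finite less_irrefl)
  let ?F = "rank_sum Z k (fls_X ^ 2 :: int fls) UNIV {}"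
  have F: "eval_xy (tutte_polynomial (column_matroid Z)) 1 (fls_X ^ 2) - eval_xy (tutte_polynomial (column_matroid Z)) 0 (fls_X ^ 2) = ?F"
    by (rule rank_sum_eq_tutte_difference) (simp add: r k)
  have K: "{A. rk Z A < CARD('r)} = support_family Z k UNIV {}" by (auto simp: support_family_def k)
  have h: "orbit_top (weight_group Z {}) (sph (support_family Z k UNIV {})) homotopy_equivalent_space singular_set \<rho>"
    using homeomorphic_imp_homotopy_equivalent_space[OF singular_set_homeomorphic[OF g eq]] unfolding K
    by (rule homotopy_equivalent_space_sym[THEN iffD1])
  show ?thesis
    unfolding has_reduced_poincare_def
  proof
    fix i
    have "rk Z {} \<le> k" "k \<le> rk Z (UNIV \<union> {})" by (simp_all add: r k)
    from betti_support_family[OF this, of i]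
    obtain m where m: "has_reduced_betti (orbit_top (weight_group Z {}) (sph (support_family Z k UNIV {}))) i m"
      "fls_nth ?F (i - (int k - int (rk Z {}) - 1)) = int m" by blast
    have "fls_nth (fls_X_intpow (int (matroid_rank (column_matroid Z)) - 2) * ?F) i = int m"
      using m(2) by (simp only: fls_X_intpow_times_conv_shift(1) fls_shift_nth matroid_rank_column_matroid r k) (simp add: algebra_simps)
    then show "\<exists>l. has_reduced_betti (singular_set \<rho>) i l \<and>
      fls_nth (fls_X_intpow (int (matroid_rank (column_matroid Z)) - 2) *
        (eval_xy (tutte_polynomial (column_matroid Z)) 1 (fls_X ^ 2)
         - eval_xy (tutte_polynomial (column_matroid Z)) 0 (fls_X ^ 2))) i = int l"
      unfolding F using has_reduced_betti_homotopy_equivalent[OF h m(1)] by blast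
  qed
qed

end
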